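(* Let $d\ge 2$ and let $\mu$ be a finite measure on $]0,+\infty[$ with positive mass. 1. Assume that $\int_{[1,+\infty[} \beta^d\ln(\beta)\,\mu(d\beta)<\infty$. Then, for all $\lambda$ with $0<\lambda<\widehat{\lambda}_c(\mu)$, there exists $\rho(\lambda)>1$ such that, for all $\rho\ge\rho(\lambda)$, $$P\left(S(r/2)\leftrightarrow_{\Sigma^{\rho}(\lambda\mu)} S(r)\right)\to 0 \text{ as } r\to\infty,$$ and therefore $\Sigma^{\rho}(\lambda\mu)$ does not percolate. 2. Assume that $\int_{[1,+\infty[} \beta^d\ln(\beta)\,\mu(d\beta)=\infty$. Then, for all $\lambda>0$ and all $\rho>1$, $\Sigma^{\rho}(\lambda\mu)$ percolates.
   Context: Boolean model: for a finite measure $\nu$ on $]0,+\infty[$, let $\xi$ be a Poisson point process on $\mathbb{R}^d\times]0,+\infty[$ with intensity the product of Lebesgue measure on $\mathbb{R}^d$ by $\nu$; the Boolean model driven by $\nu$ is the random set $\Sigma(\nu)=\bigcup_{(c,r)\in\xi}B(c,r)$, where $B(c,r)$ is the open Euclidean ball of radius $r$ centered at $c$. Multiscale Boolean model: for $\rho>1$, let $(\Sigma_n)_{n\ge0}$ be independent copies of $\Sigma(\nu)$ and set $\Sigma^{\rho}(\nu)=\bigcup_{n\ge 0}\rho^{-n}\Sigma_n$. $S(r)=\{x\in\mathbb{R}^d:\|x\|_2=r\}$. For $A,B\subset\mathbb{R}^d$ and a random set $\Sigma$, $A\leftrightarrow_{\Sigma}B$ denotes the event that there exists a continuous path contained in $\Sigma$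 from a point of $A$ to a point of $B$. A random set $\Sigma$ percolates if the connected component of $\Sigma$ containing the origin is unbounded with positive probability. Critical parameter: $\widehat{\lambda}_c(\nu)=\sup\{\lambda>0: P(S(r/2)\leftrightarrow_{\Sigma(\lambda\nu)}S(r))\to0 \text{ as } r\to\infty\}$ (equal to $0$ if the set is empty). *)

theory Defs
  imports "HOL-Probability.Probability"
begin

section \<open>Poisson point processes\<close>

definition npoints :: "'b set \<Rightarrow> 'b set \<Rightarrow> ennreal" where
  "npoints \<omega> A = emeasure (count_space UNIV) (\<omega> \<inter> A)"

text \<open>
  Point processes are random countable subsets; multiplicities are not needed because only
  atomless intensities (Lebesgue measure times a finite measure) are used below. The space of
  configurations carries the \<open>\<sigma>\<close>-algebra generated by the counting maps.
\<close>

definition configurations :: "'b measure \<Rightarrow> 'b set measure" where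
  "configurations I =
     sigma {\<omega>. \<omega> \<subseteq> space I \<and> countable \<omega>}
       {{\<omega>. \<omega> \<subseteq> space I \<and> countable \<omega> \<and> npoints \<omega> A = of_nat k} | A k. A \<in> sets I}"

definition poisson_process :: "'b measure \<Rightarrow> 'w measure \<Rightarrow> ('w \<Rightarrow> 'b set) \<Rightarrow> bool" where
  "poisson_process I M \<xi> \<longleftrightarrow>
     prob_space M \<and>
     \<xi> \<in> M \<rightarrow>\<^sub>M configurations I \<and>
     (\<forall>A\<in>sets I. emeasure I A < \<infinity> \<longrightarrow>
        (\<forall>k::nat. measure M {w \<in> space M. npoints (\<xi> w) A = of_nat k} =
                  measure I A ^ k / fact k * exp (- measure I A))) \<and>
     (\<forall>A\<in>sets I. emeasure I A = \<infinity> \<longrightarrow> (AE w in M. npoints (\<xi> w) A = \<infinity>)) \<and>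
     (\<forall>A :: nat \<Rightarrow> 'b set. range A \<subseteq> sets I \<longrightarrow> disjoint_family A \<longrightarrow>
        prob_space.indep_vars M (\<lambda>_. borel) (\<lambda>i w. npoints (\<xi> w) (A i)) UNIV)"

definition independent_poisson_processes ::
    "'b measure \<Rightarrow> 'w measure \<Rightarrow> (nat \<Rightarrow> 'w \<Rightarrow> 'b set) \<Rightarrow> bool" where
  "independent_poisson_processes I M \<Xi> \<longleftrightarrow>
     (\<forall>n. poisson_process I M (\<Xi> n)) \<and>
     prob_space.indep_vars M (\<lambda>_. configurations I) \<Xi> UNIV"


section \<open>Boolean models\<close>

definition boolean_intensity :: "real measure \<Rightarrow> ('a::euclidean_space \<times> real) measure" where
  "boolean_intensity \<nu> = lborel \<Otimes>\<^sub>M \<nu>"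

definition boolean_set :: "('a::euclidean_space \<times> real) set \<Rightarrow> 'a set" where
  "boolean_set \<omega> = (\<Union>(c, r)\<in>\<omega>. ball c r)"

definition multiscale_set ::
    "real \<Rightarrow> (nat \<Rightarrow> ('a::euclidean_space \<times> real) set) \<Rightarrow> 'a set" where
  "multiscale_set \<rho> \<omega> = (\<Union>n. (\<lambda>x. (1 / \<rho> ^ n) *\<^sub>R x) ` boolean_set (\<omega> n))"


section \<open>Connection and percolation\<close>

definition connects :: "'a::euclidean_space set \<Rightarrow> 'a set \<Rightarrow> 'a set \<Rightarrow> bool" where
  "connects S A B \<longleftrightarrow> (\<exists>a\<in>A. \<exists>b\<in>B. path_component S a b)"

text \<open>
  The events below are measurable for Boolean models and multiscale Boolean models: in a union of
  open balls, connections amount to finite chains of successively overlapping balls.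
\<close>

definition crossing_prob ::
    "'w measure \<Rightarrow> ('w \<Rightarrow> 'a::euclidean_space set) \<Rightarrow> real \<Rightarrow> real" where
  "crossing_prob M S r = measure M {w \<in> space M. connects (S w) (sphere 0 (r / 2)) (sphere 0 r)}"

definition percolates :: "'w measure \<Rightarrow> ('w \<Rightarrow> 'a::euclidean_space set) \<Rightarrow> bool" where
  "percolates M S \<longleftrightarrow>
     measure M {w \<in> space M. \<not> bounded (connected_component_set (S w) 0)} > 0"

text \<open>
  The crossing probability depends only on the law of the Poisson process, which is determined by
  its intensity; hence it suffices to let \<open>P\<close> range over measures on the configurations themselves,
  with the identity as the process. The supremum is taken in \<open>ennreal\<close>, so that it is \<open>0\<close> for the
  empty set and \<open>\<infinity>\<close> for an unbounded one. The first argument fixes the ambient space.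
\<close>

definition critical_parameter :: "'a::euclidean_space itself \<Rightarrow> real measure \<Rightarrow> ennreal" where
  "critical_parameter _ \<nu> =
     Sup {ennreal t | t. t > 0 \<and>
       (\<forall>P. poisson_process (boolean_intensity (scale_measure (ennreal t) \<nu>)) P (\<lambda>\<omega>. \<omega>) \<longrightarrow>
          (crossing_prob P (boolean_set :: ('a \<times> real) set \<Rightarrow> 'a set) \<longlongrightarrow> 0) at_top)}"

end

theory Submission
  imports Defs
begin

text \<open>
  A multiscale model is the Boolean model of a single random set of balls, and everything below uses
  that set only through its void probabilities \<open>P(\<omega> \<inter> A = {}) = exp (- \<Lambda> A)\<close>. A path is compact, so a
  crossing is a countable union of finite intersections of events ``some ball lies in \<open>Q\<close>'' with \<open>Q\<close> a
  basic open set of balls. Hence crossing events are measurable, their probability is determined by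
  \<open>\<Lambda>\<close>, and crossings inside disjoint regions are independent.

  Let \<open>f N \<alpha>\<close> be the probability that the first \<open>N\<close> levels connect \<open>S(\<alpha>)\<close> to \<open>S(2\<alpha>)\<close>. Covering \<open>S(10\<alpha>)\<close> and
  \<open>S(20\<alpha>)\<close> by balls of radius \<open>\<alpha>\<close> gives \<open>f N (10\<alpha>) \<le> C (f N \<alpha>)\<^sup>2 + h \<alpha>\<close>, where \<open>h \<alpha>\<close> bounds the probability
  of a ball of radius at least \<open>\<alpha>\<close> nearby; summing over the levels turns \<open>\<beta>^d\<close> into \<open>\<beta>^d ln \<beta>\<close>, so
  \<open>h \<alpha> \<rightarrow> 0\<close> uniformly in \<open>N\<close> and \<open>\<rho> \<ge> 2\<close>. If \<open>f N \<le> 1 / (4C)\<close> on one decade \<open>[\<alpha>0, 10\<alpha>0]\<close>, then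
  \<open>f N\<close> tends to \<open>0\<close> at a rate that does not depend on \<open>N\<close>. This bound on the decade is proved by
  induction on \<open>N\<close>: the levels from 1 on are a copy of the first \<open>N\<close> levels shrunk by \<open>\<rho>\<close>, so for large \<open>\<rho>\<close>
  they rarely make a connection of size \<open>\<epsilon>\<close>; without such a connection a crossing path stays within
  \<open>3\<epsilon>\<close> of the balls of level 0, hence inside these balls dilated by some \<open>s > 1\<close>. Dilating the radii by
  \<open>s\<close> is, up to scaling space, the same as multiplying the intensity by \<open>s^d\<close>, which keeps a
  subcritical model subcritical.

  If \<open>\<integral> \<beta>^d ln \<beta> d\<mu> = \<infinity>\<close>, then by Borel--Cantelli every ball about the origin is almost surely covered
  by a single ball of some level.
\<close>

subsection \<open>Paths and crossings\<close>

lemma connects_mono: "connects S A B \<Longrightarrow> S \<subseteq> T \<Longrightarrow> connects T A B"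
  unfolding connects_def by (meson path_component_of_subset)

text \<open>This puts a connection in the form "some compact set of a fixed family is contained in
  S", which is what \<open>sigma_sets_avoiding_cover\<close> handles.\<close>

lemma connects_iff_path_image:
  "connects S A B \<longleftrightarrow> (\<exists>K\<in>{path_image g |g. path g \<and> pathstart g \<in> A \<and> pathfinish g \<in> B}. K \<subseteq> S)"
  unfolding connects_def path_component_def by blast

text \<open>Localizes a connection. Stop the path at its first exit from \<open>ball x t\<close>;
  along what remains the distance to x takes every value between \<open>dist x a\<close> and t, in
  particular s.\<close>

lemma connects_sphere_trim:
  fixes x :: "'a::euclidean_space"
  assumes "path_component S a b" and a: "dist x a \<le> s" and st: "s < t" and b: "t \<le> dist x b"
  shows "connects (S \<inter> cball x t) (sphere x s) (sphere x t)"
proof -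
  obtain g where g: "path g" "path_image g \<subseteq> S" "pathstart g = a" "pathfinish g = b"
    using assms(1) unfolding path_component_def by blast
  have "pathstart g \<in> closure (ball x t)"
    using a st g by (intro subsetD[OF closure_subset]) auto
  moreover have "pathfinish g \<notin> ball x t" using b g by auto
  ultimately obtain h where h: "path h" "path_image h \<subseteq> path_image g" "pathstart h = pathstart g"
      "pathfinish h \<in> frontier (ball x t)" "path_image h - {pathfinish h} \<subseteq> interior (ball x t)"
    using exists_path_subpath_to_frontier[OF g(1), of "ball x t"] by metis
  have t0: "t > 0" using a st zero_le_dist[of x a] by linarith
  have fin: "pathfinish h \<in> sphere x t" using h(4) t0 by (simp add: frontier_ball)
  have sub: "path_image h \<subseteq> S \<inter> cball x t"
  proof
    fix y assume y: "y \<in> path_image h"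
    have "y \<in> cball x t"
    proof (cases "y = pathfinish h")
      case False
      then have "y \<in> interior (ball x t)" using y h(5) by blast
      then show ?thesis by simp
    qed (use fin in auto)
    then show "y \<in> S \<inter> cball x t" using y h(2) g(2) by blast
  qed
  have "connected ((\<lambda>y. dist x y) ` path_image h)"
    by (intro connected_continuous_image continuous_intros connected_path_image h)
  moreover have "dist x a \<in> (\<lambda>y. dist x y) ` path_image h"
    using h(3) g(3) pathstart_in_path_image by (metis imageI)
  moreover have "t \<in> (\<lambda>y. dist x y) ` path_image h"
    using fin pathfinish_in_path_image[of h] by force
  ultimately have "{dist x a..t} \<subseteq> (\<lambda>y. dist x y) ` path_image h"
    by (rule connected_contains_Icc)
  then have "s \<in> (\<lambda>y. dist x y) ` path_image h"
    using a st by auto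
  then obtain p where p: "p \<in> path_image h" "dist x p = s" by auto
  have "path_component (path_image h) p (pathfinish h)"
    using path_connected_path_image[OF h(1)] p pathfinish_in_path_image[of h]
    by (simp add: path_connected_component)
  then have "path_component (S \<inter> cball x t) p (pathfinish h)"
    using sub path_component_of_subset by blast
  then show ?thesis unfolding connects_def using p fin
    by (intro bexI[of _ p] bexI[of _ "pathfinish h"]) auto
qed

lemma path_component_scaleR:
  fixes S :: "'a::real_normed_vector set"
  assumes "path_component S a b"
  shows "path_component ((\<lambda>x. k *\<^sub>R x) ` S) (k *\<^sub>R a) (k *\<^sub>R b)"
proof -
  obtain g where g: "path g" "path_image g \<subseteq> S" "pathstart g = a" "pathfinish g = b"
    using assms unfolding path_component_def by blast
  have "path ((\<lambda>x. k *\<^sub>R x) \<circ> g)" using g by (intro path_continuous_image continuous_intros)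
  moreover have "path_image ((\<lambda>x. k *\<^sub>R x) \<circ> g) \<subseteq> (\<lambda>x. k *\<^sub>R x) ` S"
    using g by (auto simp: path_image_compose)
  ultimately show ?thesis
    unfolding path_component_def
    using g(3,4) by (intro exI[of _ "(\<lambda>x. k *\<^sub>R x) \<circ> g"]) (auto simp: pathstart_compose pathfinish_compose)
qed

lemma connects_scaleR:
  fixes S :: "'a::euclidean_space set"
  assumes "k > 0" and "connects S (sphere x a) (sphere x b)"
  shows "connects ((\<lambda>x. k *\<^sub>R x) ` S) (sphere (k *\<^sub>R x) (k * a)) (sphere (k *\<^sub>R x) (k * b))"
proof -
  have "dist (k *\<^sub>R x) (k *\<^sub>R y) = k * dist x y" for y
    using assms(1) by (simp add: dist_norm flip: scaleR_right_diff_distrib)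
  moreover obtain p q where "dist x p = a" "dist x q = b" "path_component S p q"
    using assms(2) unfolding connects_def by auto
  ultimately show ?thesis unfolding connects_def
    using path_component_scaleR[of S p q k]
    by (intro bexI[of _ "k *\<^sub>R p"] bexI[of _ "k *\<^sub>R q"]) auto
qed

section \<open>Unions of balls under inclusion, scaling and translation\<close>

lemma boolean_set_empty [simp]: "boolean_set {} = {}"
  by (simp add: boolean_set_def)

lemma not_connects_empty [simp]: "\<not> connects {} A B"
  unfolding connects_def path_component_def by auto

lemma mem_boolean_set: "x \<in> boolean_set \<omega> \<longleftrightarrow> (\<exists>c r. (c, r) \<in> \<omega> \<and> dist c x < r)"
  by (force simp: boolean_set_def)

lemma boolean_set_Un: "boolean_set (\<omega> \<union> \<omega>') = boolean_set \<omega> \<union> boolean_set \<omega>'"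
  by (auto simp: boolean_set_def)

lemma boolean_set_mono: "\<omega> \<subseteq> \<omega>' \<Longrightarrow> boolean_set \<omega> \<subseteq> boolean_set \<omega>'"
  by (auto simp: boolean_set_def)

lemma open_boolean_set: "open (boolean_set \<omega>)"
  by (auto simp: boolean_set_def)

lemma boolean_set_scaleR:
  fixes \<omega> :: "('a::euclidean_space \<times> real) set"
  assumes "k > 0"
  shows "boolean_set ((\<lambda>(c, r). (k *\<^sub>R c, k * r)) ` \<omega>) = (\<lambda>x. k *\<^sub>R x) ` boolean_set \<omega>"
proof -
  have "ball (k *\<^sub>R c) (k * r) = (\<lambda>x. k *\<^sub>R x) ` ball c r" for c :: 'a and r
    using ball_scale[of k c r] assms by (simp add: abs_of_pos)
  then show ?thesis by (auto simp: boolean_set_def image_UN case_prod_unfold)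
qed

lemma boolean_set_translate:
  "boolean_set ((\<lambda>(c, r). (x + c, r)) ` \<omega>) = (+) x ` boolean_set \<omega>"
proof -
  have "ball (x + c) r = (+) x ` ball c r" for c and r :: real
    by (rule ball_translation)
  then show ?thesis by (auto simp: boolean_set_def image_UN case_prod_unfold)
qed

lemma connects_translate:
  fixes S :: "'a::euclidean_space set"
  assumes "connects S (sphere y a) (sphere y b)"
  shows "connects ((+) x ` S) (sphere (x + y) a) (sphere (x + y) b)"
proof -
  obtain p q where pq: "p \<in> sphere y a" "q \<in> sphere y b" "path_component S p q"
    using assms unfolding connects_def by blast
  obtain g where g: "path g" "path_image g \<subseteq> S" "pathstart g = p" "pathfinish g = q"
    using pq(3) unfolding path_component_def by blast
  have "path ((+) x \<circ> g)" using g by (intro path_continuous_image continuous_intros)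
  moreover have "path_image ((+) x \<circ> g) \<subseteq> (+) x ` S" using g by (auto simp: path_image_compose)
  ultimately have "path_component ((+) x ` S) (x + p) (x + q)"
    unfolding path_component_def
    using g(3,4) by (intro exI[of _ "(+) x \<circ> g"]) (auto simp: pathstart_compose pathfinish_compose)
  then show ?thesis using pq(1,2) unfolding connects_def
    by (intro bexI[of _ "x + p"] bexI[of _ "x + q"]) auto
qed

subsection \<open>Measurability of connection events\<close>

text \<open>The \<open>\<sigma>\<close>-algebra generated by \<open>avoiding W\<close> describes the balls of a configuration that lie in \<open>W\<close>.\<close>

definition avoiding :: "('a::euclidean_space \<times> real) set \<Rightarrow> ('a \<times> real) set set set" where
  "avoiding W = {{\<omega>. \<omega> \<inter> A = {}} | A. A \<in> sets borel \<and> A \<subseteq> W}"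

lemma sigma_sets_avoiding_mono:
  "W \<subseteq> W' \<Longrightarrow> sigma_sets UNIV (avoiding W) \<subseteq> sigma_sets UNIV (avoiding W')"
  unfolding avoiding_def by (intro sigma_sets_mono') blast

text \<open>Being covered is an open condition on the balls: a ball that covers x with some margin
  still covers a neighbourhood of x when its centre and radius are perturbed inside a basic open set
  Q. Compactness leaves finitely many Q. The last clause concerns every configuration, so this
  finite family certifies the covering by itself.\<close>

lemma compact_cover_finitary:
  fixes \<omega> :: "('a::euclidean_space \<times> real) set"
  assumes B: "topological_basis B" and K: "compact K" "K \<subseteq> boolean_set \<omega>"
  shows "\<exists>\<Q>. finite \<Q> \<and> \<Q> \<subseteq> B \<and> (\<forall>Q\<in>\<Q>. \<omega> \<inter> Q \<noteq> {}) \<and>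
    (\<forall>\<omega>'. (\<forall>Q\<in>\<Q>. \<omega>' \<inter> Q \<noteq> {}) \<longrightarrow> K \<subseteq> boolean_set \<omega>')"
proof -
  have "\<exists>Q \<delta>. Q \<in> B \<and> \<omega> \<inter> Q \<noteq> {} \<and> \<delta> > 0 \<and> (\<forall>c r. (c, r) \<in> Q \<longrightarrow> dist c x + \<delta> < r)" if "x \<in> K" for x
  proof -
    obtain c r where cr: "(c, r) \<in> \<omega>" "dist c x < r" using \<open>x \<in> K\<close> K(2) mem_boolean_set by blast
    \<comment> \<open>Half of the slack: the strict inequality that remains defines an open set of
      parameters containing (c, r), and \<delta> is the radius of the neighbourhood of x that all
      balls with such parameters cover.\<close>
    define \<delta> where "\<delta> = (r - dist c x) / 2"
    have "open {q :: 'a \<times> real. dist (fst q) x + \<delta> < snd q}"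
      by (intro open_Collect_less continuous_intros)
    moreover have "(c, r) \<in> {q. dist (fst q) x + \<delta> < snd q}" using cr(2) by (simp add: \<delta>_def field_simps)
    ultimately obtain Q where "Q \<in> B" "(c, r) \<in> Q" "Q \<subseteq> {q. dist (fst q) x + \<delta> < snd q}"
      by (rule topological_basisE[OF B])
    then show ?thesis using cr by (intro exI[of _ Q] exI[of _ \<delta>]) (auto simp: \<delta>_def)
  qed
  then obtain Q \<delta> where Q: "\<And>x. x \<in> K \<Longrightarrow> Q x \<in> B" "\<And>x. x \<in> K \<Longrightarrow> \<omega> \<inter> Q x \<noteq> {}"
      "\<And>x. x \<in> K \<Longrightarrow> \<delta> x > 0" "\<And>x c r. x \<in> K \<Longrightarrow> (c, r) \<in> Q x \<Longrightarrow> dist c x + \<delta> x < r"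
    by metis
  have "K \<subseteq> (\<Union>x\<in>K. ball x (\<delta> x))" using Q(3) by force
  then obtain D where D: "D \<subseteq> K" "finite D" "K \<subseteq> (\<Union>x\<in>D. ball x (\<delta> x))"
    using compactE_image[OF K(1), of K "\<lambda>x. ball x (\<delta> x)"] by (metis open_ball)
  show ?thesis
  proof (intro exI[of _ "Q ` D"] conjI allI impI)
    fix \<omega>' :: "('a \<times> real) set" assume hit: "\<forall>P\<in>Q ` D. \<omega>' \<inter> P \<noteq> {}"
    show "K \<subseteq> boolean_set \<omega>'"
    proof
      fix y assume "y \<in> K"
      then obtain x where x: "x \<in> D" "dist x y < \<delta> x" using D(3) by auto
      have "\<omega>' \<inter> Q x \<noteq> {}" using hit x(1) by blast
      then obtain c r where cr: "(c, r) \<in> \<omega>'" "(c, r) \<in> Q x" by (metis Int_iff equals0I old.prod.exhaust)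
      have "dist c x + \<delta> x < r" using Q(4) cr(2) x(1) D(1) by blast
      then have "dist c y < r" using x(2) dist_triangle[of c y x] by linarith
      then show "y \<in> boolean_set \<omega>'" using cr(1) mem_boolean_set by blast
    qed
  qed (use D Q in auto)
qed

text \<open>The family of compact sets may be uncountable, as the set of all paths is. By
  \<open>compact_cover_finitary\<close> the union over it can be replaced by one over finite
  subfamilies of a countable basis.\<close>

lemma sigma_sets_avoiding_cover:
  fixes W :: "('a::euclidean_space \<times> real) set"
  assumes W: "W \<in> sets borel" and \<K>: "\<And>K. K \<in> \<K> \<Longrightarrow> compact K"
  shows "{\<omega>. \<exists>K\<in>\<K>. K \<subseteq> boolean_set (\<omega> \<inter> W)} \<in> sigma_sets UNIV (avoiding W)"
proof -
  interpret sigma_algebra UNIV "sigma_sets UNIV (avoiding W)"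
    by (intro sigma_algebra_sigma_sets) auto
  obtain B :: "('a \<times> real) set set" where B: "countable B" "topological_basis B"
    using ex_countable_basis by blast
  \<comment> \<open>A finite family is good if hitting all its members forces the covering of some
    K. The choice of K is hidden inside this predicate, so that the index set \<I> of the union is
    countable.\<close>
  define good where "good \<Q> \<longleftrightarrow>
      (\<exists>K\<in>\<K>. \<forall>\<omega>'. (\<forall>Q\<in>\<Q>. \<omega>' \<inter> Q \<noteq> {}) \<longrightarrow> K \<subseteq> boolean_set \<omega>')" for \<Q> :: "('a \<times> real) set set"
  define \<I> where "\<I> = {\<Q>. finite \<Q> \<and> \<Q> \<subseteq> B \<and> good \<Q>}"
  have "countable \<I>"
    unfolding \<I>_def by (rule countable_subset[OF _ countable_Collect_finite_subset[OF B(1)]]) blast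
  have hit: "{\<omega>. \<omega> \<inter> W \<inter> Q \<noteq> {}} \<in> sigma_sets UNIV (avoiding W)" if "Q \<in> B" for Q
  proof -
    have "open Q" using topological_basis_open[OF B(2)] that by blast
    then have "{\<omega>. \<omega> \<inter> (W \<inter> Q) = {}} \<in> avoiding W"
      using W unfolding avoiding_def by (intro CollectI exI[of _ "W \<inter> Q"]) auto
    then have "UNIV - {\<omega>. \<omega> \<inter> (W \<inter> Q) = {}} \<in> sigma_sets UNIV (avoiding W)"
      by (intro sigma_sets.Compl sigma_sets.Basic)
    moreover have "UNIV - {\<omega>. \<omega> \<inter> (W \<inter> Q) = {}} = {\<omega>. \<omega> \<inter> W \<inter> Q \<noteq> {}}" by auto
    ultimately show ?thesis by simp
  qed
  have fin: "{\<omega>. \<forall>Q\<in>\<Q>. \<omega> \<inter> W \<inter> Q \<noteq> {}} \<in> sigma_sets UNIV (avoiding W)"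
    if "finite \<Q>" "\<Q> \<subseteq> B" for \<Q>
    using that
  proof (induction \<Q>)
    case (insert Q \<Q>)
    have "{\<omega>. \<forall>P\<in>insert Q \<Q>. \<omega> \<inter> W \<inter> P \<noteq> {}} =
        {\<omega>. \<omega> \<inter> W \<inter> Q \<noteq> {}} \<inter> {\<omega>. \<forall>P\<in>\<Q>. \<omega> \<inter> W \<inter> P \<noteq> {}}" by auto
    moreover have "\<dots> \<in> sigma_sets UNIV (avoiding W)"
      using insert hit by (intro Int) auto
    ultimately show ?case by simp
  qed (use top in auto)
  have "{\<omega>. \<exists>K\<in>\<K>. K \<subseteq> boolean_set (\<omega> \<inter> W)} =
      (\<Union>\<Q>\<in>\<I>. {\<omega>. \<forall>Q\<in>\<Q>. \<omega> \<inter> W \<inter> Q \<noteq> {}})" (is "?L = ?R")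
  proof
    show "?L \<subseteq> ?R"
    proof
      fix \<omega> assume "\<omega> \<in> ?L"
      then obtain K where K: "K \<in> \<K>" "K \<subseteq> boolean_set (\<omega> \<inter> W)" by blast
      obtain \<Q> where "finite \<Q>" "\<Q> \<subseteq> B" "\<forall>Q\<in>\<Q>. (\<omega> \<inter> W) \<inter> Q \<noteq> {}"
          "\<forall>\<omega>'. (\<forall>Q\<in>\<Q>. \<omega>' \<inter> Q \<noteq> {}) \<longrightarrow> K \<subseteq> boolean_set \<omega>'"
        using compact_cover_finitary[OF B(2) \<K>[OF K(1)] K(2)] by blast
      then show "\<omega> \<in> ?R" using K(1) unfolding \<I>_def good_def by blast
    qed
    show "?R \<subseteq> ?L"
    proof
      fix \<omega> assume "\<omega> \<in> ?R"
      then obtain \<Q> where \<Q>: "\<Q> \<in> \<I>" "\<forall>Q\<in>\<Q>. \<omega> \<inter> W \<inter> Q \<noteq> {}" by blast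
      then have "good \<Q>" by (simp add: \<I>_def)
      then obtain K where "K \<in> \<K>" "\<And>\<omega>'. (\<forall>Q\<in>\<Q>. \<omega>' \<inter> Q \<noteq> {}) \<Longrightarrow> K \<subseteq> boolean_set \<omega>'"
        unfolding good_def by blast
      from this(1) this(2)[OF \<Q>(2)] show "\<omega> \<in> ?L" by blast
    qed
  qed
  also have "\<dots> \<in> sigma_sets UNIV (avoiding W)"
  proof (rule countable_UN'[OF \<open>countable \<I>\<close>], rule image_subsetI)
    show "{\<omega>. \<forall>Q\<in>\<Q>. \<omega> \<inter> W \<inter> Q \<noteq> {}} \<in> sigma_sets UNIV (avoiding W)"
      if "\<Q> \<in> \<I>" for \<Q>
      using that unfolding \<I>_def by (intro fin) blast+
  qed
  finally show ?thesis .
qed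

lemma sigma_sets_avoiding_connects:
  assumes "W \<in> sets borel"
  shows "{\<omega>. connects (boolean_set (\<omega> \<inter> W)) A B} \<in> sigma_sets UNIV (avoiding W)"
  unfolding connects_iff_path_image
  by (rule sigma_sets_avoiding_cover[OF assms]) (fastforce intro: compact_path_image)

subsection \<open>Processes determined by their void probabilities\<close>

text \<open>The function exp (- x) on extended reals. The infinite case is separate because
  \<open>enn2real\<close> sends \<infinity> to 0, which would give the value 1.\<close>

definition void_prob :: "ennreal \<Rightarrow> real" where
  "void_prob x = (if x = \<infinity> then 0 else exp (- enn2real x))"

lemma void_prob_add: "void_prob (x + y) = void_prob x * void_prob y"
  by (cases x; cases y) (auto simp: void_prob_def mult_exp_exp simp flip: ennreal_plus)

lemma void_prob_0 [simp]: "void_prob 0 = 1"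
  by (simp add: void_prob_def)

lemma void_prob_sum: "void_prob (\<Sum>i\<in>J. f i) = (\<Prod>i\<in>J. void_prob (f i))"
  by (induction J rule: infinite_finite_induct) (auto simp: void_prob_add)

lemma void_prob_ge:
  assumes "x \<le> ennreal b" "0 \<le> b" shows "1 - b \<le> void_prob x"
proof -
  have x: "x \<noteq> \<infinity>" "enn2real x \<le> b" using assms
    by (auto simp: top_unique enn2real_leI)
  have "1 + (- enn2real x) \<le> exp (- enn2real x)" by (rule exp_ge_add_one_self)
  then show ?thesis using x by (simp add: void_prob_def)
qed

text \<open>Avoidance ignores multiplicities and counts, so this weak form of a Poisson law passes
  to images under Borel maps and to unions of independent processes, while it still determines the
  probability of every connection event.\<close>

definition void_process ::
    "(('a::euclidean_space \<times> real) set \<Rightarrow> ennreal) \<Rightarrow> 'w measure \<Rightarrow> ('w \<Rightarrow> ('a \<times> real) set) \<Rightarrow> bool" where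
  "void_process \<Lambda> M \<omega> \<longleftrightarrow> prob_space M \<and>
     (\<forall>A\<in>sets borel. {w \<in> space M. \<omega> w \<inter> A = {}} \<in> sets M \<and>
        measure M {w \<in> space M. \<omega> w \<inter> A = {}} = void_prob (\<Lambda> A))"

text \<open>Avoiding both A and B is avoiding their union. This \<pi>-system carries both the
  independence and the uniqueness argument below.\<close>

lemma Int_stable_avoiding: "Int_stable (avoiding W)"
proof (rule Int_stableI)
  fix a b assume "a \<in> avoiding W" "b \<in> avoiding W"
  then obtain A B where AB: "a = {\<omega>. \<omega> \<inter> A = {}}" "A \<in> sets borel" "A \<subseteq> W"
      "b = {\<omega>. \<omega> \<inter> B = {}}" "B \<in> sets borel" "B \<subseteq> W"
    unfolding avoiding_def by blast
  then have "a \<inter> b = {\<omega>. \<omega> \<inter> (A \<union> B) = {}}" by auto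
  then show "a \<inter> b \<in> avoiding W"
    unfolding avoiding_def using AB by (intro CollectI exI[of _ "A \<union> B"]) auto
qed

context
  fixes \<Lambda> :: "('a::euclidean_space \<times> real) set \<Rightarrow> ennreal" and M :: "'w measure"
    and \<omega> :: "'w \<Rightarrow> ('a \<times> real) set"
  assumes vp: "void_process \<Lambda> M \<omega>"
begin

interpretation prob_space M using vp by (simp add: void_process_def)

lemma void_process_measurable: "\<omega> \<in> M \<rightarrow>\<^sub>M sigma UNIV (avoiding UNIV)"
proof (rule measurable_measure_of)
  fix E assume "E \<in> avoiding (UNIV :: ('a \<times> real) set)"
  then obtain A where A: "E = {\<omega>. \<omega> \<inter> A = {}}" "A \<in> sets borel"
    unfolding avoiding_def by blast
  have "\<omega> -` E \<inter> space M = {w \<in> space M. \<omega> w \<inter> A = {}}" using A by auto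
  then show "\<omega> -` E \<inter> space M \<in> sets M" using vp A by (simp add: void_process_def)
qed auto

lemma void_process_sets:
  assumes "E \<in> sigma_sets UNIV (avoiding UNIV)"
  shows "{w \<in> space M. \<omega> w \<in> E} \<in> sets M"
proof -
  have "\<omega> -` E \<inter> space M \<in> sets M"
    using assms by (intro measurable_sets[OF void_process_measurable]) simp
  also have "\<omega> -` E \<inter> space M = {w \<in> space M. \<omega> w \<in> E}" by auto
  finally show ?thesis .
qed

text \<open>The first moment bound, obtained from void probabilities alone by 1 - exp (- x) \<le>
  x.\<close>

lemma void_process_hit:
  assumes "A \<in> sets borel" "\<Lambda> A \<le> ennreal b" "0 \<le> b"
  shows "{w \<in> space M. \<omega> w \<inter> A \<noteq> {}} \<in> sets M"
    and "measure M {w \<in> space M. \<omega> w \<inter> A \<noteq> {}} \<le> b"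
proof -
  have 1: "{w \<in> space M. \<omega> w \<inter> A = {}} \<in> sets M"
    and 2: "measure M {w \<in> space M. \<omega> w \<inter> A = {}} = void_prob (\<Lambda> A)"
    using vp assms(1) by (auto simp: void_process_def)
  have 3: "{w \<in> space M. \<omega> w \<inter> A \<noteq> {}} = space M - {w \<in> space M. \<omega> w \<inter> A = {}}" by auto
  show "{w \<in> space M. \<omega> w \<inter> A \<noteq> {}} \<in> sets M" unfolding 3 using 1 by blast
  show "measure M {w \<in> space M. \<omega> w \<inter> A \<noteq> {}} \<le> b"
    unfolding 3 using prob_compl[OF 1] 2 void_prob_ge[OF assms(2,3)] by simp
qed

text \<open>On generators this is additivity: avoiding A and B, with A in W1 and B in W2, has
  probability \<open>void_prob\<close> of a sum, hence a product. Stability under intersection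
  carries it to the generated \<sigma>-algebras.\<close>

lemma void_process_indep:
  assumes add: "\<And>A B. A \<in> sets borel \<Longrightarrow> B \<in> sets borel \<Longrightarrow> A \<inter> B = {} \<Longrightarrow> \<Lambda> (A \<union> B) = \<Lambda> A + \<Lambda> B"
    and disj: "W1 \<inter> W2 = {}"
    and E: "E1 \<in> sigma_sets UNIV (avoiding W1)" "E2 \<in> sigma_sets UNIV (avoiding W2)"
  shows "measure M {w \<in> space M. \<omega> w \<in> E1 \<and> \<omega> w \<in> E2} =
    measure M {w \<in> space M. \<omega> w \<in> E1} * measure M {w \<in> space M. \<omega> w \<in> E2}"
proof -
  define \<G> where "\<G> W = (\<lambda>E. \<omega> -` E \<inter> space M) ` avoiding W" for W
  have \<G>_eq: "x \<in> \<G> W \<Longrightarrow> \<exists>A. A \<in> sets borel \<and> A \<subseteq> W \<and> x = {w \<in> space M. \<omega> w \<inter> A = {}}" for x W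
    unfolding \<G>_def avoiding_def by blast
  have ind: "indep_set (\<G> W1) (\<G> W2)"
  proof (unfold indep_sets2_eq, intro conjI ballI)
    have "\<G> W \<subseteq> events" for W
    proof
      fix x assume "x \<in> \<G> W"
      then obtain A where "A \<in> sets borel" "x = {w \<in> space M. \<omega> w \<inter> A = {}}" using \<G>_eq by blast
      then show "x \<in> events" using vp by (simp add: void_process_def)
    qed
    then show "\<G> W1 \<subseteq> events" "\<G> W2 \<subseteq> events" by auto
    fix a b assume "a \<in> \<G> W1" "b \<in> \<G> W2"
    then obtain A B where AB: "A \<in> sets borel" "A \<subseteq> W1" "a = {w \<in> space M. \<omega> w \<inter> A = {}}"
      "B \<in> sets borel" "B \<subseteq> W2" "b = {w \<in> space M. \<omega> w \<inter> B = {}}"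
      using \<G>_eq by meson
    have "a \<inter> b = {w \<in> space M. \<omega> w \<inter> (A \<union> B) = {}}" using AB by auto
    moreover have "A \<inter> B = {}" using AB disj by blast
    ultimately show "prob (a \<inter> b) = prob a * prob b"
      using vp AB add[of A B] by (simp add: void_process_def void_prob_add)
  qed
  have stable: "Int_stable (\<G> W)" for W
  proof (rule Int_stableI)
    fix a b assume "a \<in> \<G> W" "b \<in> \<G> W"
    then obtain x y where xy: "x \<in> avoiding W" "y \<in> avoiding W"
      "a = \<omega> -` x \<inter> space M" "b = \<omega> -` y \<inter> space M"
      unfolding \<G>_def by blast
    then have "x \<inter> y \<in> avoiding W" using Int_stable_avoiding by (meson Int_stable_def)
    moreover have "a \<inter> b = \<omega> -` (x \<inter> y) \<inter> space M" using xy by auto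
    ultimately show "a \<inter> b \<in> \<G> W" unfolding \<G>_def by blast
  qed
  have mem: "{w \<in> space M. \<omega> w \<in> E} \<in> sigma_sets (space M) (\<G> W)"
    if "E \<in> sigma_sets UNIV (avoiding W)" for E W
  proof -
    have "(\<lambda>E. \<omega> -` E \<inter> space M) ` sigma_sets UNIV (avoiding W) = sigma_sets (space M) (\<G> W)"
      using sigma_sets_vimage_commute[of \<omega> "space M" UNIV "avoiding W"]
      unfolding \<G>_def Setcompr_eq_image by simp
    moreover have "{w \<in> space M. \<omega> w \<in> E} = \<omega> -` E \<inter> space M" by auto
    ultimately show ?thesis using that by blast
  qed
  have "{w \<in> space M. \<omega> w \<in> E1 \<and> \<omega> w \<in> E2} = {w \<in> space M. \<omega> w \<in> E1} \<inter> {w \<in> space M. \<omega> w \<in> E2}"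
    by auto
  then show ?thesis
    using indep_setD[OF indep_set_sigma_sets[OF ind stable stable] mem[OF E(1)] mem[OF E(2)]] by simp
qed

end

text \<open>Both laws agree on the \<pi>-system of avoidance events, hence on the \<sigma>-algebra
  that it generates. The processes may live on different probability spaces.\<close>

lemma void_process_unique:
  assumes "void_process \<Lambda> M \<omega>" "void_process \<Lambda>' M' \<omega>'"
    and eq: "\<And>A. A \<in> sets borel \<Longrightarrow> \<Lambda> A = \<Lambda>' A"
    and E: "E \<in> sigma_sets UNIV (avoiding UNIV)"
  shows "measure M {w \<in> space M. \<omega> w \<in> E} = measure M' {w \<in> space M'. \<omega>' w \<in> E}"
proof -
  interpret M: prob_space M using assms(1) by (simp add: void_process_def)
  interpret M': prob_space M' using assms(2) by (simp add: void_process_def)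
  note m = void_process_measurable[OF assms(1)] void_process_measurable[OF assms(2)]
  have "distr M (sigma UNIV (avoiding UNIV)) \<omega> = distr M' (sigma UNIV (avoiding UNIV)) \<omega>'"
  proof (rule measure_eqI_generator_eq[where A="\<lambda>_. UNIV"])
    show "Int_stable (avoiding (UNIV :: ('a \<times> real) set))" by (rule Int_stable_avoiding)
    fix X assume "X \<in> avoiding (UNIV :: ('a \<times> real) set)"
    then obtain A where A: "X = {\<omega>. \<omega> \<inter> A = {}}" "A \<in> sets borel" unfolding avoiding_def by blast
    have v: "\<omega> -` X \<inter> space M = {w \<in> space M. \<omega> w \<inter> A = {}}"
        "\<omega>' -` X \<inter> space M' = {w \<in> space M'. \<omega>' w \<inter> A = {}}" using A by auto
    have "X \<in> sets (sigma UNIV (avoiding UNIV))" using \<open>X \<in> avoiding UNIV\<close> by auto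
    then show "emeasure (distr M (sigma UNIV (avoiding UNIV)) \<omega>) X =
        emeasure (distr M' (sigma UNIV (avoiding UNIV)) \<omega>') X"
      using assms A(2) m eq[OF A(2)]
      by (simp add: emeasure_distr v M.emeasure_eq_measure M'.emeasure_eq_measure void_process_def)
  next
    \<comment> \<open>The whole space is the event of avoiding the empty set.\<close>
    show "range (\<lambda>_. UNIV) \<subseteq> avoiding (UNIV :: ('a \<times> real) set)"
      unfolding avoiding_def by (auto intro!: exI[of _ "{}"])
    show "emeasure (distr M (sigma UNIV (avoiding UNIV)) \<omega>) UNIV \<noteq> \<infinity>"
      using m by (subst emeasure_distr) (auto simp: M.emeasure_eq_measure sigma_sets_top)
  qed auto
  then have "measure (distr M (sigma UNIV (avoiding UNIV)) \<omega>) E =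
      measure (distr M' (sigma UNIV (avoiding UNIV)) \<omega>') E" by simp
  moreover have "\<omega> -` E \<inter> space M = {w \<in> space M. \<omega> w \<in> E}"
    "\<omega>' -` E \<inter> space M' = {w \<in> space M'. \<omega>' w \<in> E}" by auto
  ultimately show ?thesis using m E by (simp add: measure_distr)
qed

lemma void_process_image:
  assumes "void_process \<Lambda> M \<omega>" and f: "f \<in> borel \<rightarrow>\<^sub>M borel"
  shows "void_process (\<lambda>A. \<Lambda> (f -` A)) M (\<lambda>w. f ` \<omega> w)"
proof -
  have "f -` A \<in> sets borel" if "A \<in> sets borel" for A
    using measurable_sets[OF f that] by simp
  moreover have "(f ` \<omega> w \<inter> A = {}) = (\<omega> w \<inter> f -` A = {})" for w A by auto
  ultimately show ?thesis using assms(1) by (simp add: void_process_def)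
qed

section \<open>Void probabilities of Poisson processes\<close>

lemma npoints_eq_0_iff: "npoints \<omega> A = 0 \<longleftrightarrow> \<omega> \<inter> A = {}"
  unfolding npoints_def by (subst emeasure_count_space_eq_0) auto

lemma configurations_count_sets:
  assumes "A \<in> sets I"
  shows "{\<omega> \<in> space (configurations I). npoints \<omega> A = of_nat k} \<in> sets (configurations I)"
proof -
  have "{{\<omega>. \<omega> \<subseteq> space I \<and> countable \<omega> \<and> npoints \<omega> A = of_nat k} | A k. A \<in> sets I}
      \<subseteq> Pow {\<omega>. \<omega> \<subseteq> space I \<and> countable \<omega>}" by auto
  note * = space_measure_of[OF this] sets_measure_of[OF this]
  show ?thesis unfolding configurations_def * using assms
    by (intro sigma_sets.Basic) auto
qed

lemma space_configurations: "space (configurations I) = {\<omega>. \<omega> \<subseteq> space I \<and> countable \<omega>}"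
  unfolding configurations_def by (rule space_measure_of) auto

lemma configurations_void_sets:
  assumes "A \<in> sets I"
  shows "{\<omega> \<in> space (configurations I). \<omega> \<inter> A = {}} \<in> sets (configurations I)"
  using configurations_count_sets[OF assms, of 0] by (simp add: npoints_eq_0_iff)

lemma poisson_process_void:
  assumes pp: "poisson_process I M \<xi>" and A: "A \<in> sets I"
  shows "{w \<in> space M. \<xi> w \<inter> A = {}} \<in> sets M"
    and "measure M {w \<in> space M. \<xi> w \<inter> A = {}} = void_prob (emeasure I A)"
proof -
  interpret prob_space M using pp by (simp add: poisson_process_def)
  have \<xi>: "\<xi> \<in> M \<rightarrow>\<^sub>M configurations I" using pp by (simp add: poisson_process_def)
  have "\<xi> -` {\<omega> \<in> space (configurations I). \<omega> \<inter> A = {}} \<inter> space M \<in> sets M"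
    by (rule measurable_sets[OF \<xi> configurations_void_sets[OF A]])
  also have "\<xi> -` {\<omega> \<in> space (configurations I). \<omega> \<inter> A = {}} \<inter> space M = {w \<in> space M. \<xi> w \<inter> A = {}}"
    using measurable_space[OF \<xi>] by auto
  finally show S: "{w \<in> space M. \<xi> w \<inter> A = {}} \<in> sets M" .
  show "measure M {w \<in> space M. \<xi> w \<inter> A = {}} = void_prob (emeasure I A)"
  proof (cases "emeasure I A = \<infinity>")
    case True
    then have "AE w in M. npoints (\<xi> w) A = \<infinity>" using pp A by (simp add: poisson_process_def)
    then have "AE w in M. \<not> \<xi> w \<inter> A = {}"
      by eventually_elim (auto simp: npoints_eq_0_iff[symmetric])
    then have "prob {w \<in> space M. \<xi> w \<inter> A = {}} = 0"
      using S by (simp add: prob_Collect_eq_0)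
    then show ?thesis using True by (simp add: void_prob_def)
  next
    case False
    then have "emeasure I A < \<infinity>" by (simp add: less_top)
    then have "\<forall>k::nat. measure M {w \<in> space M. npoints (\<xi> w) A = of_nat k} =
                  measure I A ^ k / fact k * exp (- measure I A)"
      using pp A by (simp add: poisson_process_def)
    \<comment> \<open>Avoidance is the count 0 of the Poisson law.\<close>
    from this[rule_format, of 0] show ?thesis
      using False by (simp add: void_prob_def npoints_eq_0_iff measure_def)
  qed
qed

lemma independent_poisson_processes_void:
  assumes ip: "independent_poisson_processes I M \<Xi>" and J: "finite J"
    and A: "\<And>n. n \<in> J \<Longrightarrow> A n \<in> sets I"
  shows "{w \<in> space M. \<forall>n\<in>J. \<Xi> n w \<inter> A n = {}} \<in> sets M"
    and "measure M {w \<in> space M. \<forall>n\<in>J. \<Xi> n w \<inter> A n = {}} = (\<Prod>n\<in>J. void_prob (emeasure I (A n)))"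
proof -
  have pp: "poisson_process I M (\<Xi> n)" for n
    using ip by (simp add: independent_poisson_processes_def)
  interpret prob_space M using pp[of 0] by (simp add: poisson_process_def)
  define B where "B n = \<Xi> n -` {\<omega> \<in> space (configurations I). \<omega> \<inter> A n = {}} \<inter> space M" for n
  have \<Xi>: "\<Xi> n \<in> M \<rightarrow>\<^sub>M configurations I" for n using pp[of n] by (simp add: poisson_process_def)
  have B: "B n = {w \<in> space M. \<Xi> n w \<inter> A n = {}}" for n
    using measurable_space[OF \<Xi>[of n]] by (auto simp: B_def)
  show sets: "{w \<in> space M. \<forall>n\<in>J. \<Xi> n w \<inter> A n = {}} \<in> sets M"
    using poisson_process_void(1)[OF pp A] J by (intro sets.sets_Collect_finite_All) auto
  show "measure M {w \<in> space M. \<forall>n\<in>J. \<Xi> n w \<inter> A n = {}} = (\<Prod>n\<in>J. void_prob (emeasure I (A n)))"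
  \<comment> \<open>\<open>indep_setsD\<close> asks for a nonempty index set, so the empty product
    is treated apart.\<close>
  proof (cases "J = {}")
    case False
    have "indep_vars (\<lambda>_. configurations I) \<Xi> UNIV"
      using ip by (simp add: independent_poisson_processes_def)
    then have "indep_sets (\<lambda>i. {\<Xi> i -` A \<inter> space M | A. A \<in> sets (configurations I)}) UNIV"
      by (simp add: indep_vars_def2)
    then have "prob (\<Inter>n\<in>J. B n) = (\<Prod>n\<in>J. prob (B n))"
    proof (rule indep_setsD)
      show "\<forall>n\<in>J. B n \<in> {\<Xi> n -` A \<inter> space M | A. A \<in> sets (configurations I)}"
        using configurations_void_sets[OF A] unfolding B_def by blast
    qed (use False J in auto)
    moreover have "(\<Inter>n\<in>J. B n) = {w \<in> space M. \<forall>n\<in>J. \<Xi> n w \<inter> A n = {}}"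
      using False B by auto
    moreover have "prob (B n) = void_prob (emeasure I (A n))" if "n \<in> J" for n
      unfolding B by (rule poisson_process_void(2)[OF pp A[OF that]])
    ultimately show ?thesis by simp
  qed (simp add: prob_space)
qed

subsection \<open>The intensity of the Boolean model\<close>

text \<open>The intersection with the space, where radii are positive, extends the intensity to all
  Borel sets of pairs. Every process then shares one \<sigma>-algebra.\<close>

definition ball_intensity :: "real measure \<Rightarrow> ('a::euclidean_space \<times> real) set \<Rightarrow> ennreal" where
  "ball_intensity \<nu> A = emeasure (boolean_intensity \<nu>) (A \<inter> space (boolean_intensity \<nu>))"

definition scale_points :: "real \<Rightarrow> 'a::euclidean_space \<times> real \<Rightarrow> 'a \<times> real" where
  "scale_points k = (\<lambda>(c, r). (k *\<^sub>R c, k * r))"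

lemma scale_points_measurable [measurable]: "scale_points k \<in> borel \<rightarrow>\<^sub>M borel"
  unfolding scale_points_def case_prod_beta
  by (intro borel_measurable_continuous_onI continuous_intros)

lemma boolean_set_scale_points:
  "k > 0 \<Longrightarrow> boolean_set (scale_points k ` \<omega>) = (\<lambda>x. k *\<^sub>R x) ` boolean_set \<omega>"
  unfolding scale_points_def by (rule boolean_set_scaleR)

lemma multiscale_set_eq:
  assumes "\<rho> > 0"
  shows "multiscale_set \<rho> \<omega> = boolean_set (\<Union>n. scale_points (1 / \<rho> ^ n) ` \<omega> n)"
proof -
  have "boolean_set (\<Union>n. scale_points (1 / \<rho> ^ n) ` \<omega> n) = (\<Union>n. boolean_set (scale_points (1 / \<rho> ^ n) ` \<omega> n))"
    by (simp add: boolean_set_def)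
  then show ?thesis using assms by (simp add: multiscale_set_def boolean_set_scale_points)
qed

lemma emeasure_lborel_vimage_scaleR:
  fixes S :: "'a::euclidean_space set"
  assumes "s > 0" "S \<in> sets borel"
  shows "emeasure lborel {c. c /\<^sub>R s \<in> S} = ennreal (s ^ DIM('a)) * emeasure lborel S"
proof -
  have *: "(\<lambda>x. 0 + inverse s *\<^sub>R x) \<in> lborel \<rightarrow>\<^sub>M (borel :: 'a measure)" by simp
  have "emeasure lborel S = emeasure (density (distr lborel borel (\<lambda>x::'a. 0 + inverse s *\<^sub>R x))
      (\<lambda>_. ennreal (\<bar>inverse s\<bar> ^ DIM('a)))) S"
    using assms by (subst lborel_affine[where c="inverse s" and t=0]) auto
  also have "\<dots> = ennreal (\<bar>inverse s\<bar> ^ DIM('a)) * emeasure (distr lborel borel (\<lambda>x::'a. 0 + inverse s *\<^sub>R x)) S"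
    using assms(2) by (subst emeasure_density) (auto simp: nn_integral_cmult_indicator)
  also have "emeasure (distr lborel borel (\<lambda>x::'a. 0 + inverse s *\<^sub>R x)) S = emeasure lborel {c. c /\<^sub>R s \<in> S}"
    using assms(2) by (subst emeasure_distr) (auto simp: vimage_def)
  finally have "ennreal (s ^ DIM('a)) * emeasure lborel S =
      ennreal (s ^ DIM('a)) * (ennreal (inverse s ^ DIM('a)) * emeasure lborel {c. c /\<^sub>R s \<in> S})"
    using assms(1) by simp
  also have "\<dots> = emeasure lborel {c. c /\<^sub>R s \<in> S}"
    using assms(1) by (simp add: mult.assoc[symmetric] ennreal_mult[symmetric] power_mult_distrib[symmetric])
  finally show ?thesis by simp
qed

lemma emeasure_lborel_vimage_translation:
  fixes S :: "'a::euclidean_space set"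
  assumes "S \<in> sets borel"
  shows "emeasure lborel {c. x + c \<in> S} = emeasure lborel S"
proof -
  have "emeasure lborel S = emeasure (distr lborel borel ((+) x)) S"
    by (simp add: lborel_distr_plus)
  also have "\<dots> = emeasure lborel {c. x + c \<in> S}"
    using assms by (subst emeasure_distr) (auto simp: vimage_def)
  finally show ?thesis by simp
qed

lemma section_sets: "A \<in> sets borel \<Longrightarrow> {c. (c, r :: real) \<in> A} \<in> sets (borel :: 'a::euclidean_space measure)"
  using measurable_sets[of "\<lambda>c. (c, r :: real)" borel borel A]
  by (auto simp: vimage_def borel_prod[symmetric])

lemma poisson_process_subset:
  assumes "poisson_process I M \<xi>" "w \<in> space M"
  shows "\<xi> w \<subseteq> space I"
proof -
  have "\<xi> w \<in> space (configurations I)"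
    using assms by (intro measurable_space[of \<xi> M]) (auto simp: poisson_process_def)
  then show ?thesis by (simp add: space_configurations)
qed

context
  fixes \<nu> :: "real measure"
  assumes sets_\<nu>: "sets \<nu> = sets (restrict_space borel {0<..})"
begin

lemma space_boolean_intensity: "space (boolean_intensity \<nu> :: ('a::euclidean_space \<times> real) measure) = UNIV \<times> {0<..}"
  using sets_eq_imp_space_eq[OF sets_\<nu>]
  by (simp add: boolean_intensity_def space_pair_measure space_restrict_space)

lemma measurable_radius: "(\<lambda>r. r) \<in> \<nu> \<rightarrow>\<^sub>M borel"
  unfolding measurable_cong_sets[OF sets_\<nu> refl] by (rule measurable_restrict_space1) simp

lemma boolean_intensity_id_measurable: "(\<lambda>x. x) \<in> boolean_intensity \<nu> \<rightarrow>\<^sub>M (borel :: ('a::euclidean_space \<times> real) measure)"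
proof -
  have "(\<lambda>x. (fst x, snd x)) \<in> boolean_intensity \<nu> \<rightarrow>\<^sub>M (borel \<Otimes>\<^sub>M borel :: ('a \<times> real) measure)"
    unfolding boolean_intensity_def
    by (intro measurable_Pair measurable_compose[OF measurable_snd measurable_radius]) simp
  then show ?thesis by (simp add: borel_prod)
qed

lemma boolean_intensity_sets:
  "A \<in> sets borel \<Longrightarrow> A \<inter> space (boolean_intensity \<nu>) \<in> sets (boolean_intensity \<nu>)"
  using measurable_sets[OF boolean_intensity_id_measurable, of A] by (simp add: vimage_def)

lemma ball_intensity_Un:
  assumes "A \<in> sets borel" "B \<in> sets borel" "A \<inter> B = {}"
  shows "ball_intensity \<nu> (A \<union> B) = ball_intensity \<nu> A + ball_intensity \<nu> B"
  unfolding ball_intensity_def using assms boolean_intensity_sets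
  by (subst plus_emeasure) (auto simp: Int_Un_distrib2)

lemma void_process_poisson:
  assumes "poisson_process (boolean_intensity \<nu>) M \<xi>"
  shows "void_process (ball_intensity \<nu>) M \<xi>"
proof -
  have "prob_space M"
    using assms by (auto simp: poisson_process_def)
  have "{w \<in> space M. \<xi> w \<inter> A = {}} = {w \<in> space M. \<xi> w \<inter> (A \<inter> space (boolean_intensity \<nu>)) = {}}" for A
    using poisson_process_subset[OF assms] by blast
  then show ?thesis
    using poisson_process_void[OF assms boolean_intensity_sets] \<open>prob_space M\<close>
    by (simp add: void_process_def ball_intensity_def)
qed

text \<open>Superposition: the union avoids A iff each level n avoids the preimage of A under
  \<open>T n\<close>. Independence multiplies these void probabilities, so the intensities
  add.\<close>

lemma void_process_levels:
  assumes ip: "independent_poisson_processes (boolean_intensity \<nu>) M \<Xi>" and J: "finite J"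
    and T: "\<And>n. T n \<in> borel \<rightarrow>\<^sub>M borel"
  shows "void_process (\<lambda>A. \<Sum>n\<in>J. ball_intensity \<nu> (T n -` A)) M (\<lambda>w. \<Union>n\<in>J. T n ` \<Xi> n w)"
proof -
  have pp: "poisson_process (boolean_intensity \<nu>) M (\<Xi> n)" for n
    using ip by (simp add: independent_poisson_processes_def)
  then have "prob_space M" by (auto simp: poisson_process_def)
  have sub: "\<Xi> n w \<subseteq> space (boolean_intensity \<nu>)" if "w \<in> space M" for n w
    by (rule poisson_process_subset[OF pp that])
  have "{w \<in> space M. (\<Union>n\<in>J. T n ` \<Xi> n w) \<inter> A = {}} =
      {w \<in> space M. \<forall>n\<in>J. \<Xi> n w \<inter> (T n -` A \<inter> space (boolean_intensity \<nu>)) = {}}" (is "?L A = ?R A") for A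
  proof (rule Collect_cong, rule conj_cong[OF refl])
    fix w assume "w \<in> space M"
    then have "(\<Xi> n w \<inter> (T n -` A \<inter> space (boolean_intensity \<nu>)) = {}) = (T n ` \<Xi> n w \<inter> A = {})" for n
      using sub by blast
    then show "((\<Union>n\<in>J. T n ` \<Xi> n w) \<inter> A = {}) =
      (\<forall>n\<in>J. \<Xi> n w \<inter> (T n -` A \<inter> space (boolean_intensity \<nu>)) = {})"
      by (simp only:) blast
  qed
  moreover have "T n -` A \<inter> space (boolean_intensity \<nu>) \<in> sets (boolean_intensity \<nu>)"
    if "A \<in> sets borel" for n A
    using measurable_sets[OF T that] by (intro boolean_intensity_sets) simp
  ultimately show ?thesis
    using independent_poisson_processes_void[OF ip J, of "\<lambda>n. T n -` A \<inter> space (boolean_intensity \<nu>)" for A]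
      \<open>prob_space M\<close>
    by (simp add: void_process_def ball_intensity_def void_prob_sum)
qed

context
  assumes fin: "finite_measure \<nu>"
begin

lemma ball_intensity_section:
  fixes A :: "('a::euclidean_space \<times> real) set"
  assumes A: "A \<in> sets borel"
  shows "ball_intensity \<nu> A = (\<integral>\<^sup>+ r. emeasure lborel {c. (c, r) \<in> A} \<partial>\<nu>)"
proof -
  interpret \<nu>: finite_measure \<nu> by (rule fin)
  interpret pair_sigma_finite "lborel :: 'a measure" \<nu> ..
  have "ball_intensity \<nu> A = (\<integral>\<^sup>+ r. emeasure lborel ((\<lambda>x. (x, r)) -` (A \<inter> space (boolean_intensity \<nu>))) \<partial>\<nu>)"
    unfolding ball_intensity_def using boolean_intensity_sets[OF A]
    unfolding boolean_intensity_def by (rule emeasure_pair_measure_alt2)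
  also have "\<dots> = (\<integral>\<^sup>+ r. emeasure lborel {c. (c, r) \<in> A} \<partial>\<nu>)"
    using sets_eq_imp_space_eq[OF sets_\<nu>]
    by (intro nn_integral_cong arg_cong2[where f=emeasure] refl)
      (auto simp: space_boolean_intensity space_restrict_space)
  finally show ?thesis .
qed

lemma measurable_section_measure:
  fixes A :: "('a::euclidean_space \<times> real) set"
  assumes A: "A \<in> sets borel"
  shows "(\<lambda>r. emeasure lborel {c. (c, r) \<in> A}) \<in> borel_measurable \<nu>"
proof -
  interpret \<nu>: finite_measure \<nu> by (rule fin)
  interpret pair_sigma_finite "lborel :: 'a measure" \<nu> ..
  have "(\<lambda>r. emeasure lborel ((\<lambda>x. (x, r)) -` (A \<inter> space (boolean_intensity \<nu>)))) \<in> borel_measurable \<nu>"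
    using boolean_intensity_sets[OF A] unfolding boolean_intensity_def
    by (rule measurable_emeasure_Pair2)
  then show ?thesis
    by (rule measurable_cong[THEN iffD1, rotated])
      (use sets_eq_imp_space_eq[OF sets_\<nu>] in \<open>auto simp: space_boolean_intensity space_restrict_space
        intro!: arg_cong2[where f=emeasure]\<close>)
qed

lemma ball_intensity_translate:
  fixes A :: "('a::euclidean_space \<times> real) set"
  assumes A: "A \<in> sets borel"
  shows "ball_intensity \<nu> ((\<lambda>(c, r). (x + c, r)) -` A) = ball_intensity \<nu> A"
proof -
  have "(\<lambda>(c, r). (x + c, r)) \<in> borel \<rightarrow>\<^sub>M (borel :: ('a \<times> real) measure)"
    unfolding case_prod_beta by (intro borel_measurable_continuous_onI continuous_intros)
  from measurable_sets[OF this A] have "(\<lambda>(c, r). (x + c, r)) -` A \<in> sets borel" by simp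
  moreover have "emeasure lborel {c. (x + c, r) \<in> A} = emeasure lborel {c. (c, r) \<in> A}" for r
    using emeasure_lborel_vimage_translation[OF section_sets[OF A, of r], of x] by simp
  ultimately show ?thesis using A by (simp add: ball_intensity_section)
qed

text \<open>The preimage dilates each section at fixed radius by s, which multiplies its Lebesgue
  measure by s^d. Contracting the centres thus raises the intensity, the exchange used for
  subcriticality under dilation.\<close>

lemma ball_intensity_scale_centers:
  fixes A :: "('a::euclidean_space \<times> real) set"
  assumes A: "A \<in> sets borel" and s: "s > 0"
  shows "ball_intensity \<nu> ((\<lambda>(c, r). (c /\<^sub>R s, r)) -` A) = ennreal (s ^ DIM('a)) * ball_intensity \<nu> A"
proof -
  have "(\<lambda>(c, r). (c /\<^sub>R s, r)) \<in> borel \<rightarrow>\<^sub>M (borel :: ('a \<times> real) measure)"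
    unfolding case_prod_beta by (intro borel_measurable_continuous_onI continuous_intros)
  from measurable_sets[OF this A] have "(\<lambda>(c, r). (c /\<^sub>R s, r)) -` A \<in> sets borel" by simp
  moreover have "emeasure lborel {c. (c /\<^sub>R s, r) \<in> A} =
      ennreal (s ^ DIM('a)) * emeasure lborel {c. (c, r) \<in> A}" for r
    using emeasure_lborel_vimage_scaleR[OF s section_sets[OF A, of r]] by simp
  ultimately show ?thesis using A by (simp add: ball_intensity_section nn_integral_cmult measurable_section_measure)
qed

end

lemma boolean_intensity_sets_borel:
  assumes "A \<in> sets (boolean_intensity \<nu>)"
  shows "A \<in> sets (borel :: ('a::euclidean_space \<times> real) measure)"
proof -
  \<comment> \<open>The default radius 1 makes this a total Borel map into the space of \<nu>. Where
    radii are positive it is the identity, so A is recovered as a preimage.\<close>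
  have "(\<lambda>p :: 'a \<times> real. if snd p > 0 then snd p else 1) \<in> borel \<rightarrow>\<^sub>M \<nu>"
    unfolding measurable_cong_sets[OF refl sets_\<nu>]
    by (rule measurable_restrict_space2) (auto simp: borel_prod[symmetric])
  moreover have "fst \<in> borel \<rightarrow>\<^sub>M (lborel :: 'a measure)"
    unfolding measurable_lborel1 by (intro borel_measurable_continuous_onI continuous_intros)
  ultimately have m: "(\<lambda>p :: 'a \<times> real. (fst p, if snd p > 0 then snd p else 1)) \<in> borel \<rightarrow>\<^sub>M boolean_intensity \<nu>"
    unfolding boolean_intensity_def by (intro measurable_Pair) auto
  have "A = (\<lambda>p. (fst p, if snd p > 0 then snd p else 1)) -` A \<inter> (UNIV \<times> {0<..})"
    using sets.sets_into_space[OF assms] by (auto simp: space_boolean_intensity)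
  also have "\<dots> \<in> sets borel"
    using measurable_sets[OF m assms]
    by (intro sets.Int borel_open[OF open_Times]) auto
  finally show ?thesis .
qed

end

lemma ball_intensity_scale_measure:
  fixes A :: "('a::euclidean_space \<times> real) set"
  assumes "sets \<nu> = sets (restrict_space borel {0<..})" "finite_measure \<nu>" "A \<in> sets borel" "k < \<infinity>"
  shows "ball_intensity (scale_measure k \<nu>) A = k * ball_intensity \<nu> A"
proof -
  interpret finite_measure \<nu> by fact
  have "finite_measure (scale_measure k \<nu>)"
    using assms(4) emeasure_finite[of "space \<nu>"] by (intro finite_measureI) (simp add: space_scale_measure ennreal_mult_eq_top_iff)
  moreover have "sets (scale_measure k \<nu>) = sets (restrict_space borel {0<..})" using assms(1) by simp
  ultimately show ?thesis
    using assms by (simp add: ball_intensity_section nn_integral_scale_measure measurable_section_measure)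
qed

subsection \<open>Images of Poisson processes and subcriticality under dilation\<close>

lemma indep_vars_cong_space:
  assumes "prob_space M" "\<And>i w. w \<in> space M \<Longrightarrow> X i w = Y i w"
  shows "prob_space.indep_vars M N X I \<longleftrightarrow> prob_space.indep_vars M N Y I"
proof -
  interpret prob_space M by fact
  have "X i -` A \<inter> space M = Y i -` A \<inter> space M" for i A using assms(2) by auto
  moreover have "(X i \<in> M \<rightarrow>\<^sub>M N i) = (Y i \<in> M \<rightarrow>\<^sub>M N i)" for i
    using assms(2) by (intro measurable_cong)
  ultimately show ?thesis by (simp add: indep_vars_def2)
qed

text \<open>Independence is carried along f to the image measure by pulling events back: a preimage
  under X i followed by one under f is a preimage under the composition.\<close>

lemma indep_vars_distr:
  assumes "prob_space M" and f: "f \<in> M \<rightarrow>\<^sub>M L" and X: "\<And>i. i \<in> I \<Longrightarrow> X i \<in> L \<rightarrow>\<^sub>M N i"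
    and indep: "prob_space.indep_vars M N (\<lambda>i w. X i (f w)) I"
  shows "prob_space.indep_vars (distr M L f) N X I"
proof -
  interpret M: prob_space M by fact
  interpret D: prob_space "distr M L f" using f by (rule M.prob_space_distr)
  have ind: "M.indep_sets (\<lambda>i. {(\<lambda>w. X i (f w)) -` A \<inter> space M |A. A \<in> sets (N i)}) I"
    using indep by (simp add: M.indep_vars_def2)
  show ?thesis unfolding D.indep_vars_def2
  proof (intro conjI ballI D.indep_setsI)
    fix i assume i: "i \<in> I"
    show "X i \<in> distr M L f \<rightarrow>\<^sub>M N i" using X[OF i] by simp
    show "{X i -` A \<inter> space (distr M L f) |A. A \<in> sets (N i)} \<subseteq> D.events"
      using measurable_sets[OF X[OF i]] by auto
  next
    fix A J assume J: "J \<noteq> {}" "J \<subseteq> I" "finite J"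
      and A: "\<forall>j\<in>J. A j \<in> {X j -` A \<inter> space (distr M L f) |A. A \<in> sets (N j)}"
    have A_sets: "A j \<in> sets L" if "j \<in> J" for j
      using A J(2) measurable_sets[OF X] that by force
    have "M.prob (\<Inter>j\<in>J. f -` A j \<inter> space M) = (\<Prod>j\<in>J. M.prob (f -` A j \<inter> space M))"
    proof (rule M.indep_setsD[OF ind J(2,1,3)], rule ballI)
      fix j assume j: "j \<in> J"
      then obtain B where B: "B \<in> sets (N j)" "A j = X j -` B \<inter> space L" using A by auto
      have "f -` A j \<inter> space M = (\<lambda>w. X j (f w)) -` B \<inter> space M"
        using B(2) measurable_space[OF f] by auto
      then show "f -` A j \<inter> space M \<in> {(\<lambda>w. X j (f w)) -` A \<inter> space M |A. A \<in> sets (N j)}"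
        using B(1) by blast
    qed
    moreover have "(\<Inter>j\<in>J. f -` A j \<inter> space M) = f -` (\<Inter>j\<in>J. A j) \<inter> space M" using J(1) by auto
    moreover have "(\<Inter>j\<in>J. A j) \<in> sets L" using J A_sets by (intro sets.finite_INT) auto
    ultimately show "D.prob (\<Inter>j\<in>J. A j) = (\<Prod>j\<in>J. D.prob (A j))"
      using f A_sets by (simp add: measure_distr)
  qed
qed

lemma npoints_image:
  assumes "inj_on T \<omega>"
  shows "npoints (T ` \<omega>) A = npoints \<omega> (T -` A)"
proof -
  have inj: "inj_on T (\<omega> \<inter> T -` A)" using assms by (rule inj_on_subset) auto
  moreover have "T ` \<omega> \<inter> A = T ` (\<omega> \<inter> T -` A)" by auto
  ultimately show ?thesis
    by (simp add: npoints_def emeasure_count_space finite_image_iff card_image)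
qed

lemma npoints_cases: "(\<exists>k::nat. npoints \<omega> A = of_nat k) \<or> npoints \<omega> A = \<infinity>"
  by (auto simp: npoints_def emeasure_count_space)

text \<open>Counts are natural numbers or \<infinity>, so any set of values is a countable union of
  the generating events, together with the complement of all of them if it contains
  \<infinity>.\<close>

lemma npoints_measurable:
  assumes A: "A \<in> sets I"
  shows "(\<lambda>\<omega>. npoints \<omega> A) \<in> configurations I \<rightarrow>\<^sub>M borel"
proof (rule measurableI)
  fix B :: "ennreal set"
  let ?C = "configurations I"
  let ?E = "\<lambda>k::nat. {\<omega> \<in> space ?C. npoints \<omega> A = of_nat k}"
  have E: "?E k \<in> sets ?C" for k by (rule configurations_count_sets[OF A])
  have "(\<lambda>\<omega>. npoints \<omega> A) -` B \<inter> space ?C =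
      (\<Union>k\<in>{k. of_nat k \<in> B}. ?E k) \<union> (if \<infinity> \<in> B then space ?C - (\<Union>k. ?E k) else {})"
    using npoints_cases[of _ A] by (auto split: if_splits) (metis+)?
  also have "\<dots> \<in> sets ?C"
    using E by (intro sets.Un sets.countable_UN'') auto
  finally show "(\<lambda>\<omega>. npoints \<omega> A) -` B \<inter> space ?C \<in> sets ?C" .
qed simp

text \<open>By injectivity the image has as many points in A as the original has in the preimage of
  A. The full Poisson property is carried over, not only void probabilities, because
  \<open>critical_parameter\<close> quantifies over Poisson processes.\<close>

lemma poisson_process_image:
  fixes I' :: "'c measure"
  assumes pp: "poisson_process I M \<xi>"
    and T: "T \<in> I \<rightarrow>\<^sub>M I'" and inj: "inj T"
    and eq: "\<And>A. A \<in> sets I' \<Longrightarrow> emeasure I' A = emeasure I (T -` A \<inter> space I)"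
  shows "poisson_process I' M (\<lambda>w. T ` \<xi> w)"
proof -
  interpret prob_space M using pp by (simp add: poisson_process_def)
  have \<xi>: "\<xi> \<in> M \<rightarrow>\<^sub>M configurations I" using pp by (simp add: poisson_process_def)
  have \<xi>_space: "\<xi> w \<subseteq> space I" "countable (\<xi> w)" if "w \<in> space M" for w
    using measurable_space[OF \<xi> that] by (auto simp: space_configurations)
  define T' where "T' A = T -` A \<inter> space I" for A
  have T'[simp]: "T' A \<in> sets I" if "A \<in> sets I'" for A
    using measurable_sets[OF T that] by (simp add: T'_def)
  have np: "npoints (T ` \<xi> w) A = npoints (\<xi> w) (T' A)" if "w \<in> space M" for w A
  proof -
    have "npoints (T ` \<xi> w) A = npoints (\<xi> w) (T -` A)"
      by (rule npoints_image) (use inj in \<open>auto simp: inj_on_def\<close>)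
    also have "\<dots> = npoints (\<xi> w) (T' A)"
      using \<xi>_space(1)[OF that] unfolding npoints_def T'_def by (intro arg_cong[where f="emeasure _"]) auto
    finally show ?thesis .
  qed
  have meas: "measure I' A = measure I (T' A)" if "A \<in> sets I'" for A
    using eq[OF that] by (simp add: measure_def T'_def)
  show ?thesis
    unfolding poisson_process_def
  proof (intro conjI ballI allI impI)
    show "prob_space M" by (rule prob_space_axioms)
    show "(\<lambda>w. T ` \<xi> w) \<in> M \<rightarrow>\<^sub>M configurations I'"
      unfolding configurations_def
    proof (rule measurable_measure_of)
      show "(\<lambda>w. T ` \<xi> w) \<in> space M \<rightarrow> {\<omega>. \<omega> \<subseteq> space I' \<and> countable \<omega>}"
        using \<xi>_space measurable_space[OF T] by fast
      fix y assume "y \<in> {{\<omega>. \<omega> \<subseteq> space I' \<and> countable \<omega> \<and> npoints \<omega> A = of_nat k} |A k. A \<in> sets I'}"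
      then obtain A k where y: "A \<in> sets I'" "y = {\<omega>. \<omega> \<subseteq> space I' \<and> countable \<omega> \<and> npoints \<omega> A = of_nat k}"
        by auto
      have "(\<lambda>w. T ` \<xi> w) -` y \<inter> space M =
          \<xi> -` {\<omega> \<in> space (configurations I). npoints \<omega> (T' A) = of_nat k} \<inter> space M"
        unfolding y(2) using \<xi>_space measurable_space[OF T] by (auto simp: np space_configurations subset_iff)
      also have "\<dots> \<in> sets M"
        by (rule measurable_sets[OF \<xi> configurations_count_sets]) (use y in simp)
      finally show "(\<lambda>w. T ` \<xi> w) -` y \<inter> space M \<in> sets M" .
    qed auto
  next
    fix A k assume A: "A \<in> sets I'" "emeasure I' A < \<infinity>"
    then have "emeasure I (T' A) < \<infinity>" using eq by (simp add: T'_def)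
    then have "measure M {w \<in> space M. npoints (\<xi> w) (T' A) = of_nat k} =
        measure I (T' A) ^ k / fact k * exp (- measure I (T' A))"
      using pp A by (simp add: poisson_process_def)
    then show "measure M {w \<in> space M. npoints (T ` \<xi> w) A = of_nat k} =
        measure I' A ^ k / fact k * exp (- measure I' A)"
      using A by (simp add: meas np cong: conj_cong)
  next
    fix A assume A: "A \<in> sets I'" "emeasure I' A = \<infinity>"
    then have "emeasure I (T' A) = \<infinity>" using eq by (simp add: T'_def)
    then have "AE w in M. npoints (\<xi> w) (T' A) = \<infinity>"
      using pp A by (simp add: poisson_process_def)
    then show "AE w in M. npoints (T ` \<xi> w) A = \<infinity>"
      using AE_space by eventually_elim (simp add: np)
  next
    fix A :: "nat \<Rightarrow> 'c set" assume A: "range A \<subseteq> sets I'" "disjoint_family A"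
    have "range (\<lambda>i. T' (A i)) \<subseteq> sets I" using A(1) by auto
    moreover have "disjoint_family (\<lambda>i. T' (A i))" using A(2) unfolding disjoint_family_on_def T'_def by blast
    ultimately have "indep_vars (\<lambda>_. borel) (\<lambda>i w. npoints (\<xi> w) (T' (A i))) UNIV"
      using pp unfolding poisson_process_def by blast
    then show "indep_vars (\<lambda>_. borel) (\<lambda>i w. npoints (T ` \<xi> w) (A i)) UNIV"
      by (subst indep_vars_cong_space[OF prob_space_axioms np])
  qed
qed

text \<open>Passes to the canonical space, the form in which \<open>critical_parameter\<close> can
  be applied.\<close>

lemma poisson_process_distr:
  assumes pp: "poisson_process I M \<xi>"
  shows "poisson_process I (distr M (configurations I) \<xi>) (\<lambda>\<omega>. \<omega>)"
proof -
  interpret prob_space M using pp by (simp add: poisson_process_def)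
  have \<xi>: "\<xi> \<in> M \<rightarrow>\<^sub>M configurations I" using pp by (simp add: poisson_process_def)
  let ?C = "configurations I"
  show ?thesis
    unfolding poisson_process_def
  proof (intro conjI ballI allI impI)
    show "prob_space (distr M ?C \<xi>)" using \<xi> by (rule prob_space_distr)
    show "(\<lambda>\<omega>. \<omega>) \<in> distr M ?C \<xi> \<rightarrow>\<^sub>M ?C" by simp
  next
    fix A k assume A: "A \<in> sets I" "emeasure I A < \<infinity>"
    have "measure (distr M ?C \<xi>) {\<omega> \<in> space ?C. npoints \<omega> A = of_nat k} =
        measure M (\<xi> -` {\<omega> \<in> space ?C. npoints \<omega> A = of_nat k} \<inter> space M)"
      by (rule measure_distr[OF \<xi> configurations_count_sets[OF A(1)]])
    also have "\<xi> -` {\<omega> \<in> space ?C. npoints \<omega> A = of_nat k} \<inter> space M = {w \<in> space M. npoints (\<xi> w) A = of_nat k}"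
      using measurable_space[OF \<xi>] by auto
    finally show "measure (distr M ?C \<xi>) {\<omega> \<in> space (distr M ?C \<xi>). npoints \<omega> A = of_nat k} =
        measure I A ^ k / fact k * exp (- measure I A)"
      using pp A by (simp add: poisson_process_def)
  next
    fix A assume A: "A \<in> sets I" "emeasure I A = \<infinity>"
    have "{\<omega> \<in> space ?C. npoints \<omega> A = \<infinity>} \<in> sets ?C"
      using npoints_measurable[OF A(1)] by measurable
    then show "AE \<omega> in distr M ?C \<xi>. npoints \<omega> A = \<infinity>"
      using pp A by (subst AE_distr_iff[OF \<xi>]) (auto simp: poisson_process_def)
  next
    fix A :: "nat \<Rightarrow> 'a set" assume A: "range A \<subseteq> sets I" "disjoint_family A"
    then have "indep_vars (\<lambda>_. borel) (\<lambda>i w. npoints (\<xi> w) (A i)) UNIV"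
      using pp by (simp add: poisson_process_def)
    then show "prob_space.indep_vars (distr M ?C \<xi>) (\<lambda>_. borel) (\<lambda>i \<omega>. npoints \<omega> (A i)) UNIV"
      using A npoints_measurable by (intro indep_vars_distr[OF prob_space_axioms \<xi>]) auto
  qed
qed

lemma ball_intensity_eq_emeasure:
  "A \<in> sets (boolean_intensity \<nu>) \<Longrightarrow> ball_intensity \<nu> A = emeasure (boolean_intensity \<nu>) A"
  unfolding ball_intensity_def using sets.sets_into_space by (metis Int_absorb2)

lemma finite_measure_scale_measure:
  assumes "finite_measure \<nu>" "k < \<infinity>"
  shows "finite_measure (scale_measure k \<nu>)"
proof -
  interpret finite_measure \<nu> by fact
  show ?thesis
    using assms(2) emeasure_finite[of "space \<nu>"]
    by (intro finite_measureI) (simp add: space_scale_measure ennreal_mult_eq_top_iff)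
qed

lemma poisson_process_scale_centers:
  fixes \<xi> :: "'w \<Rightarrow> ('a::euclidean_space \<times> real) set"
  assumes \<mu>: "sets \<mu> = sets (restrict_space borel {0<..})" "finite_measure \<mu>"
    and s: "s > 0" and t: "t > 0"
    and pp: "poisson_process (boolean_intensity (scale_measure (ennreal t) \<mu>)) M \<xi>"
  shows "poisson_process (boolean_intensity (scale_measure (ennreal (s ^ DIM('a) * t)) \<mu>)) M
    (\<lambda>w. (\<lambda>(c, r). (c /\<^sub>R s, r)) ` \<xi> w)"
proof (rule poisson_process_image[OF pp])
  let ?T = "\<lambda>(c :: 'a, r :: real). (c /\<^sub>R s, r)"
  let ?I = "\<lambda>t. boolean_intensity (scale_measure (ennreal t) \<mu>) :: ('a \<times> real) measure"
  have sets: "sets (scale_measure k \<mu>) = sets (restrict_space borel {0<..})" for k using \<mu>(1) by simp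
  have sI: "sets (?I t') = sets (?I t)" for t'
    unfolding boolean_intensity_def by (intro sets_pair_measure_cong) auto
  have T: "(\<lambda>p :: 'a \<times> real. (fst p /\<^sub>R s, snd p)) \<in> ?I t \<rightarrow>\<^sub>M ?I t"
    unfolding boolean_intensity_def
    by (intro measurable_Pair measurable_snd measurable_compose[OF measurable_fst]) simp
  then show m: "?T \<in> ?I t \<rightarrow>\<^sub>M ?I (s ^ DIM('a) * t)"
    unfolding measurable_cong_sets[OF refl sI[of "s ^ DIM('a) * t"]] case_prod_beta .
  show "inj ?T" using s by (auto simp: inj_on_def)
  fix A assume A: "A \<in> sets (?I (s ^ DIM('a) * t))"
  then have AB: "A \<in> sets borel" by (rule boolean_intensity_sets_borel[OF sets])
  have "emeasure (?I t) (?T -` A \<inter> space (?I t)) = ball_intensity (scale_measure (ennreal t) \<mu>) (?T -` A)"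
    by (simp add: ball_intensity_def)
  also have "\<dots> = ennreal (s ^ DIM('a)) * ball_intensity (scale_measure (ennreal t) \<mu>) A"
    by (rule ball_intensity_scale_centers[OF sets finite_measure_scale_measure[OF \<mu>(2)] AB s]) simp
  also have "\<dots> = ball_intensity (scale_measure (ennreal (s ^ DIM('a) * t)) \<mu>) A"
    using s t by (subst (1 2) ball_intensity_scale_measure[OF \<mu> AB]) (simp_all add: ennreal_mult mult.assoc ennreal_mult_less_top)
  also have "\<dots> = emeasure (?I (s ^ DIM('a) * t)) A" by (rule ball_intensity_eq_emeasure[OF A])
  finally show "emeasure (?I (s ^ DIM('a) * t)) A = emeasure (?I t) (?T -` A \<inter> space (?I t))" by simp
qed

text \<open>Since t lies below a supremum, some t' > t also has vanishing crossing probabilities.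
  Dilating all radii by s is contracting the centres by s and then scaling space by s; the
  contraction turns intensity t into s^d t. The radius R is common to all processes of this
  intensity because their crossing probabilities coincide.\<close>

lemma subcritical_dilated_crossing:
  fixes \<mu> :: "real measure"
  assumes \<mu>: "sets \<mu> = sets (restrict_space borel {0<..})" "finite_measure \<mu>"
    and t: "0 < t" "ennreal t < critical_parameter TYPE('a::euclidean_space) \<mu>"
  shows "\<exists>s>1. \<forall>\<epsilon>>0. \<exists>R>0. \<forall>(M :: 'w measure) (\<xi> :: 'w \<Rightarrow> ('a \<times> real) set).
    poisson_process (boolean_intensity (scale_measure (ennreal t) \<mu>)) M \<xi> \<longrightarrow>
    (\<forall>r\<ge>R. measure M {w \<in> space M.
       connects (boolean_set ((\<lambda>(c, r). (c, s * r)) ` \<xi> w)) (sphere 0 r) (sphere 0 (2 * r))} \<le> \<epsilon>)"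
proof -
  let ?I = "\<lambda>t. boolean_intensity (scale_measure (ennreal t) \<mu>) :: ('a \<times> real) measure"
  obtain t' where t': "ennreal t < ennreal t'" "t' > 0"
    and cr: "\<And>P. poisson_process (?I t') P (\<lambda>\<omega>. \<omega>) \<Longrightarrow>
          (crossing_prob P (boolean_set :: ('a \<times> real) set \<Rightarrow> 'a set) \<longlongrightarrow> 0) at_top"
    using t(2) unfolding critical_parameter_def less_Sup_iff by blast
  \<comment> \<open>Chosen so that s^d t = t'.\<close>
  define s where "s = root DIM('a) (t' / t)"
  have tt': "t < t'" using t' t by (simp add: ennreal_less_iff)
  have s: "s > 1" using tt' t(1) by (simp add: s_def)
  have sd: "s ^ DIM('a) * t = t'" using t(1) t'(2) by (simp add: s_def)
  let ?T = "\<lambda>(c :: 'a, r :: real). (c /\<^sub>R s, r)"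
  have sets: "sets (scale_measure k \<mu>) = sets (restrict_space borel {0<..})" for k using \<mu>(1) by simp
  have T: "poisson_process (?I t') M (\<lambda>w. ?T ` \<xi> w)"
    if "poisson_process (?I t) M \<xi>" for M :: "'w measure" and \<xi>
    using poisson_process_scale_centers[OF \<mu> _ t(1) that, of s] s by (simp add: sd)
  define E where "E r = {\<omega> :: ('a \<times> real) set. connects (boolean_set \<omega>) (sphere 0 (r / 2)) (sphere 0 r)}" for r
  have E: "E r \<in> sigma_sets UNIV (avoiding UNIV)" for r
    using sigma_sets_avoiding_connects[of UNIV] by (simp add: E_def)
  \<comment> \<open>Scaling space by 1/s takes the spheres of radii r and 2r to those of radii r/s
    and 2r/s, hence the event \<open>E\<close> at 2r/s.\<close>
  have dil: "?T ` \<omega> \<in> E (2 * r / s)"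
    if "connects (boolean_set ((\<lambda>(c, r). (c, s * r)) ` \<omega>)) (sphere 0 r) (sphere 0 (2 * r))" for \<omega> r
  proof -
    have "(\<lambda>(c, r). (c, s * r)) ` \<omega> = scale_points s ` ?T ` \<omega>"
      using s by (simp add: image_image scale_points_def case_prod_beta)
    then have "boolean_set ((\<lambda>(c, r). (c, s * r)) ` \<omega>) = (\<lambda>x. s *\<^sub>R x) ` boolean_set (?T ` \<omega>)"
      using s by (simp add: boolean_set_scale_points)
    then have "(\<lambda>x. (1 / s) *\<^sub>R x) ` boolean_set ((\<lambda>(c, r). (c, s * r)) ` \<omega>) = boolean_set (?T ` \<omega>)"
      using s by (simp add: image_image)
    then show ?thesis
      using connects_scaleR[OF _ that, of "1 / s"] s by (simp add: E_def)
  qed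
  show ?thesis
  proof (rule exI[of _ s], intro conjI allI impI s)
    fix \<epsilon> :: real assume \<epsilon>: "\<epsilon> > 0"
    show "\<exists>R>0. \<forall>(M :: 'w measure) (\<xi> :: 'w \<Rightarrow> ('a \<times> real) set). poisson_process (?I t) M \<xi> \<longrightarrow>
      (\<forall>r\<ge>R. measure M {w \<in> space M.
       connects (boolean_set ((\<lambda>(c, r). (c, s * r)) ` \<xi> w)) (sphere 0 r) (sphere 0 (2 * r))} \<le> \<epsilon>)"
    \<comment> \<open>One existing process fixes the canonical law P, from which R is read off. If
      there is none on the type \<open>'w\<close>, the claim is vacuous.\<close>
    proof (cases "\<exists>(M0 :: 'w measure) \<xi>0. poisson_process (?I t) M0 \<xi>0")
      case True
      then obtain M0 :: "'w measure" and \<xi>0 where pp0: "poisson_process (?I t) M0 \<xi>0" by blast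
      define P where "P = distr M0 (configurations (?I t')) (\<lambda>w. ?T ` \<xi>0 w)"
      have P: "poisson_process (?I t') P (\<lambda>\<omega>. \<omega>)"
        unfolding P_def by (rule poisson_process_distr[OF T[OF pp0]])
      have "eventually (\<lambda>r. crossing_prob P (boolean_set :: ('a \<times> real) set \<Rightarrow> 'a set) r < \<epsilon>) at_top"
        using order_tendstoD(2)[OF cr[OF P] \<epsilon>] .
      then obtain R where R: "\<And>r. r \<ge> R \<Longrightarrow> crossing_prob P (boolean_set :: ('a \<times> real) set \<Rightarrow> 'a set) r < \<epsilon>"
        by (auto simp: eventually_at_top_linorder)
      show ?thesis
      \<comment> \<open>This value is positive and makes 2r/s at least R.\<close>
      proof (rule exI[of _ "max 1 (s * R)"], intro conjI allI impI)
        fix M :: "'w measure" and \<xi> and r assume pp: "poisson_process (?I t) M \<xi>" and r: "r \<ge> max 1 (s * R)"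
        interpret M: prob_space M using pp by (simp add: poisson_process_def)
        have vp: "void_process (ball_intensity (scale_measure (ennreal t') \<mu>)) M (\<lambda>w. ?T ` \<xi> w)"
          by (rule void_process_poisson[OF sets T[OF pp]])
        have "M.prob {w \<in> space M. connects (boolean_set ((\<lambda>(c, r). (c, s * r)) ` \<xi> w)) (sphere 0 r) (sphere 0 (2 * r))}
            \<le> M.prob {w \<in> space M. ?T ` \<xi> w \<in> E (2 * r / s)}"
          using void_process_sets[OF vp E[of "2 * r / s"]] dil
          by (intro M.finite_measure_mono) auto
        also have "\<dots> = measure P {\<omega> \<in> space P. \<omega> \<in> E (2 * r / s)}"
          by (rule void_process_unique[OF vp void_process_poisson[OF sets P] refl E])
        also have "\<dots> = crossing_prob P (boolean_set :: ('a \<times> real) set \<Rightarrow> 'a set) (2 * r / s)"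
          by (simp add: crossing_prob_def E_def)
        also have "\<dots> < \<epsilon>"
        proof (rule R)
          have "s * R \<le> 2 * r" using r by auto
          then show "R \<le> 2 * r / s" using s by (simp add: field_simps)
        qed
        finally show "M.prob {w \<in> space M. connects (boolean_set ((\<lambda>(c, r). (c, s * r)) ` \<xi> w))
          (sphere 0 r) (sphere 0 (2 * r))} \<le> \<epsilon>" by simp
      qed simp
    next
      case False
      then show ?thesis by (intro exI[of _ 1] conjI allI impI) (simp, blast)
    qed
  qed
qed

subsection \<open>Geometry of the renormalization\<close>

text \<open>A ball that meets \<open>cball x (2 * \<alpha>)\<close> has its centre at norm below r +
  22\<alpha>, since x has norm at most 20\<alpha>. Hence \<open>small\<close> applies to it, its
  radius is at most \<alpha> and its centre lies within 3\<alpha> of x: the crossing around x uses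
  only balls centred in that region.\<close>

lemma local_crossing:
  fixes x :: "'a::euclidean_space"
  assumes ab: "path_component (boolean_set \<omega>) a b" "dist x a \<le> \<alpha>" "2 * \<alpha> \<le> dist x b"
    and \<alpha>: "0 < \<alpha>" and x: "norm x \<le> 20 * \<alpha>"
    and small: "\<And>c r. (c, r) \<in> \<omega> \<Longrightarrow> norm c < r + 23 * \<alpha> \<Longrightarrow> r \<le> \<alpha>"
  shows "connects (boolean_set (\<omega> \<inter> ball x (3 * \<alpha>) \<times> UNIV)) (sphere x \<alpha>) (sphere x (2 * \<alpha>))"
proof (rule connects_mono)
  show "connects (boolean_set \<omega> \<inter> cball x (2 * \<alpha>)) (sphere x \<alpha>) (sphere x (2 * \<alpha>))"
    using \<alpha> by (intro connects_sphere_trim[OF ab(1)] ab) auto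
  show "boolean_set \<omega> \<inter> cball x (2 * \<alpha>) \<subseteq> boolean_set (\<omega> \<inter> ball x (3 * \<alpha>) \<times> UNIV)"
  proof
    fix y assume y: "y \<in> boolean_set \<omega> \<inter> cball x (2 * \<alpha>)"
    then obtain c r where cr: "(c, r) \<in> \<omega>" "dist c y < r" by (auto simp: mem_boolean_set)
    have xy: "dist x y \<le> 2 * \<alpha>" using y by simp
    have "norm c \<le> norm x + dist x y + dist c y"
      using norm_triangle_ineq[of x "c - x"] dist_triangle[of x c y]
      by (simp add: dist_norm norm_minus_commute)
    then have "r \<le> \<alpha>" using x xy cr \<alpha> by (intro small[OF cr(1)]) linarith
    then have "dist x c < 3 * \<alpha>" using xy cr(2) dist_triangle[of x c y] by (simp add: dist_commute)
    then show "y \<in> boolean_set (\<omega> \<inter> ball x (3 * \<alpha>) \<times> UNIV)"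
      using cr by (auto simp: mem_boolean_set)
  qed
qed

text \<open>The start of the path is within \<alpha> of a net point of the inner sphere and its end
  is far from that point, so the path crosses the annulus around it; the same holds at the other
  end. The nets live on spheres of radii 10 and 20 and are scaled by \<alpha>, so the number of
  pairs does not depend on \<alpha>.\<close>

lemma crossing_split:
  fixes \<omega> :: "('a::euclidean_space \<times> real) set"
  assumes cr: "connects (boolean_set \<omega>) (sphere 0 (10 * \<alpha>)) (sphere 0 (20 * \<alpha>))"
    and \<alpha>: "0 < \<alpha>"
    and K: "K \<subseteq> sphere 0 10" "sphere 0 10 \<subseteq> (\<Union>k\<in>K. ball k 1)"
    and L: "L \<subseteq> sphere 0 20" "sphere 0 20 \<subseteq> (\<Union>k\<in>L. ball k 1)"
    and small: "\<And>c r. (c, r) \<in> \<omega> \<Longrightarrow> norm c < r + 23 * \<alpha> \<Longrightarrow> r \<le> \<alpha>"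
  shows "\<exists>k\<in>K. \<exists>l\<in>L. \<forall>x\<in>{\<alpha> *\<^sub>R k, \<alpha> *\<^sub>R l}.
    connects (boolean_set (\<omega> \<inter> ball x (3 * \<alpha>) \<times> UNIV)) (sphere x \<alpha>) (sphere x (2 * \<alpha>))"
proof -
  obtain a b where ab: "norm a = 10 * \<alpha>" "norm b = 20 * \<alpha>" "path_component (boolean_set \<omega>) a b"
    using cr unfolding connects_def by auto
  have near: "\<exists>k\<in>K. dist (\<alpha> *\<^sub>R k) a \<le> \<alpha>" if net: "sphere 0 R \<subseteq> (\<Union>k\<in>K. ball k 1)" and a: "norm a = R * \<alpha>"
    for K R and a :: 'a
  proof -
    have "a /\<^sub>R \<alpha> \<in> sphere 0 R" using a \<alpha> by simp
    then have "a /\<^sub>R \<alpha> \<in> (\<Union>k\<in>K. ball k 1)" by (rule subsetD[OF net])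
    then obtain k where k: "k \<in> K" "dist k (a /\<^sub>R \<alpha>) < 1" by auto
    have "\<alpha> *\<^sub>R k - a = \<alpha> *\<^sub>R (k - a /\<^sub>R \<alpha>)" using \<alpha> by (simp add: scaleR_right_diff_distrib)
    then have "dist (\<alpha> *\<^sub>R k) a = \<alpha> * dist k (a /\<^sub>R \<alpha>)" using \<alpha> by (simp add: dist_norm)
    also have "\<dots> \<le> \<alpha>" using k(2) \<alpha> by simp
    finally show ?thesis using k(1) by blast
  qed
  obtain k where k: "k \<in> K" "dist (\<alpha> *\<^sub>R k) a \<le> \<alpha>" using near[OF K(2) ab(1)] by blast
  obtain l where l: "l \<in> L" "dist (\<alpha> *\<^sub>R l) b \<le> \<alpha>" using near[OF L(2) ab(2)] by blast
  have nk: "norm (\<alpha> *\<^sub>R k) = 10 * \<alpha>" "norm (\<alpha> *\<^sub>R l) = 20 * \<alpha>" using K(1) L(1) k(1) l(1) \<alpha> by auto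
  have far: "2 * \<alpha> \<le> dist (\<alpha> *\<^sub>R k) b" "2 * \<alpha> \<le> dist (\<alpha> *\<^sub>R l) a"
    using norm_triangle_ineq2[of b "\<alpha> *\<^sub>R k"] norm_triangle_ineq2[of "\<alpha> *\<^sub>R l" a] nk ab \<alpha>
    by (auto simp: dist_norm norm_minus_commute)
  show ?thesis
  proof (intro bexI[OF _ k(1)] bexI[OF _ l(1)] ballI)
    fix x assume "x \<in> {\<alpha> *\<^sub>R k, \<alpha> *\<^sub>R l}"
    then consider "x = \<alpha> *\<^sub>R k" | "x = \<alpha> *\<^sub>R l" by auto
    then show "connects (boolean_set (\<omega> \<inter> ball x (3 * \<alpha>) \<times> UNIV)) (sphere x \<alpha>) (sphere x (2 * \<alpha>))"
    proof cases
      case 1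
      then show ?thesis using k(2) far(1) nk \<alpha> by (intro local_crossing[OF ab(3) _ _ \<alpha> _ small]) auto
    next
      case 2
      then show ?thesis using l(2) far(2) nk \<alpha>
        by (intro local_crossing[OF path_component_sym[OF ab(3)] _ _ \<alpha> _ small]) auto
    qed
  qed
qed

text \<open>Let p be a point of the path that no ball of \<omega> covers. The path goes to distance
  3\<epsilon> from p, and it cannot do so within S alone without crossing the annulus around a net
  point. Thus a ball of \<omega> comes within 3\<epsilon> of p; its radius r is at least \<eta>, so
  the dilation adds (s - 1) r \<ge> 3\<epsilon> and reaches p.\<close>

lemma thick_crossing:
  fixes \<omega> :: "('a::euclidean_space \<times> real) set"
  assumes cr: "connects (boolean_set \<omega> \<union> S) (sphere 0 \<alpha>) (sphere 0 (2 * \<alpha>))"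
    and X: "cball 0 (2 * \<alpha>) \<subseteq> (\<Union>x\<in>X. ball x \<epsilon>)"
    and no_crossing: "\<And>x. x \<in> X \<Longrightarrow> \<not> connects S (sphere x \<epsilon>) (sphere x (2 * \<epsilon>))"
    and \<epsilon>: "0 < \<epsilon>" "6 * \<epsilon> \<le> \<alpha>" "3 * \<epsilon> \<le> (s - 1) * \<eta>" and s: "s > 1"
    and large: "\<And>c r. (c, r) \<in> \<omega> \<Longrightarrow> norm c < 2 * \<alpha> + 3 * \<epsilon> + \<eta> \<Longrightarrow> \<eta> \<le> r"
  shows "connects (boolean_set ((\<lambda>(c, r). (c, s * r)) ` \<omega>)) (sphere 0 \<alpha>) (sphere 0 (2 * \<alpha>))"
proof -
  obtain a b where "norm a = \<alpha>" "norm b = 2 * \<alpha>" "path_component (boolean_set \<omega> \<union> S) a b"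
    using cr unfolding connects_def by auto
  \<comment> \<open>Trimming keeps the path in the region covered by the net X.\<close>
  then have "connects ((boolean_set \<omega> \<union> S) \<inter> cball 0 (2 * \<alpha>)) (sphere 0 \<alpha>) (sphere 0 (2 * \<alpha>))"
    using \<epsilon> by (intro connects_sphere_trim) auto
  then obtain g where g: "path g" "path_image g \<subseteq> (boolean_set \<omega> \<union> S) \<inter> cball 0 (2 * \<alpha>)"
      "pathstart g \<in> sphere 0 \<alpha>" "pathfinish g \<in> sphere 0 (2 * \<alpha>)"
    unfolding connects_iff_path_image by blast
  have "path_image g \<subseteq> boolean_set ((\<lambda>(c, r). (c, s * r)) ` \<omega>)"
  proof
    fix p assume p: "p \<in> path_image g"
    have np: "norm p \<le> 2 * \<alpha>" using p g(2) by auto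
    show "p \<in> boolean_set ((\<lambda>(c, r). (c, s * r)) ` \<omega>)"
    proof (cases "p \<in> boolean_set \<omega>")
      case True
      then obtain c r where cr: "(c, r) \<in> \<omega>" "dist c p < r" by (auto simp: mem_boolean_set)
      have "0 < r" using cr(2) zero_le_dist[of c p] by linarith
      then have "r \<le> s * r" using s by simp
      then have "dist c p < s * r" using cr(2) by linarith
      moreover have "(c, s * r) \<in> (\<lambda>(c, r). (c, s * r)) ` \<omega>" using cr(1) by force
      ultimately show ?thesis unfolding mem_boolean_set by blast
    next
      case False
      have "norm (pathstart g) = \<alpha>" "norm (pathfinish g) = 2 * \<alpha>" using g by auto
      then have "\<alpha> \<le> dist (pathstart g) (pathfinish g)"
        using norm_triangle_ineq2[of "pathfinish g" "pathstart g"] by (simp add: dist_norm norm_minus_commute)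
      \<comment> \<open>The endpoints are at least \<alpha> \<ge> 6\<epsilon> apart, so one of them
        is at distance 3\<epsilon> or more from p.\<close>
      then have "3 * \<epsilon> \<le> dist p (pathstart g) \<or> 3 * \<epsilon> \<le> dist p (pathfinish g)"
        using dist_triangle[of "pathstart g" "pathfinish g" p] \<epsilon>(2) by (auto simp: dist_commute)
      then obtain q where q: "q \<in> path_image g" "3 * \<epsilon> \<le> dist p q" by auto
      have pq: "path_component (path_image g) p q"
        using path_connected_path_image[OF g(1)] p q by (simp add: path_connected_component)
      \<comment> \<open>Inner radius 0: the sphere of radius 0 is the point p.\<close>
      have loc: "connects (path_image g \<inter> cball p (3 * \<epsilon>)) (sphere p 0) (sphere p (3 * \<epsilon>))"
        using q \<epsilon> by (intro connects_sphere_trim[OF pq]) auto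
      have "\<exists>z\<in>boolean_set \<omega>. dist p z \<le> 3 * \<epsilon>"
      proof (rule ccontr)
        assume "\<not> ?thesis"
        then have "path_image g \<inter> cball p (3 * \<epsilon>) \<subseteq> S" using g(2) by auto
        then have "connects S (sphere p 0) (sphere p (3 * \<epsilon>))" using loc connects_mono by blast
        then obtain q' where q': "path_component S p q'" "dist p q' = 3 * \<epsilon>"
          unfolding connects_def by auto
        obtain x where x: "x \<in> X" "dist x p < \<epsilon>" using X np by (auto simp: subset_iff)
        \<comment> \<open>The net point x is within \<epsilon> of p and q' is at distance
          3\<epsilon> from p, so the path from p to q' in S crosses from radius \<epsilon> to
          2\<epsilon> around x.\<close>
        have "2 * \<epsilon> \<le> dist x q'" using q'(2) x(2) dist_triangle[of p q' x] by (simp add: dist_commute)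
        then have "connects (S \<inter> cball x (2 * \<epsilon>)) (sphere x \<epsilon>) (sphere x (2 * \<epsilon>))"
          using x(2) \<epsilon> by (intro connects_sphere_trim[OF q'(1)]) auto
        then show False using no_crossing[OF x(1)] connects_mono by blast
      qed
      then obtain z c r where z: "dist p z \<le> 3 * \<epsilon>" "(c, r) \<in> \<omega>" "dist c z < r"
        by (auto simp: mem_boolean_set)
      have cp: "dist c p < r + 3 * \<epsilon>" using z dist_triangle[of c p z] by (simp add: dist_commute)
      have "norm c \<le> norm p + dist c p" using norm_triangle_ineq[of p "c - p"] by (simp add: dist_norm)
      \<comment> \<open>If r < \<eta>, the norm of c is below 2\<alpha> + 3\<epsilon> + \<eta>, and
        then \<open>large\<close> gives \<eta> \<le> r all the same.\<close>
      then have "\<eta> \<le> r" using large[OF z(2)] cp np by fastforce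
      then have "3 * \<epsilon> \<le> (s - 1) * r" using \<epsilon>(3) s mult_left_mono[of \<eta> r "s - 1"] by linarith
      then have "dist c p < s * r" using cp by (simp add: algebra_simps)
      moreover have "(c, s * r) \<in> (\<lambda>(c, r). (c, s * r)) ` \<omega>" using z(2) by force
      ultimately show ?thesis unfolding mem_boolean_set by blast
    qed
  qed
  then show ?thesis unfolding connects_iff_path_image using g by blast
qed

section \<open>Unbounded components and decay from a quadratic recursion\<close>

lemma unbounded_component_connects:
  fixes S :: "'a::euclidean_space set"
  assumes S: "open S" "\<not> bounded (connected_component_set S 0)" and r: "0 < r" "r < r'"
  shows "connects S (sphere 0 r) (sphere 0 r')"
proof -
  obtain y where y: "y \<in> connected_component_set S 0" "r' < norm y"
    using S(2) unfolding bounded_iff by (meson not_le)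
  then have "path_component S 0 y"
    using path_component_eq_connected_component[OF open_imp_locally_path_connected[OF S(1)]] by simp
  then have "connects (S \<inter> cball 0 r') (sphere 0 r) (sphere 0 r')"
    using r y by (intro connects_sphere_trim) auto
  then show ?thesis using connects_mono by blast
qed

text \<open>In an open set components are path components, so percolation becomes a countable
  intersection of connection events, whose measurability is known.\<close>

lemma unbounded_boolean_component_iff:
  "\<not> bounded (connected_component_set (boolean_set \<omega>) 0) \<longleftrightarrow>
    (\<forall>m::nat. connects (boolean_set \<omega>) {0} (- cball 0 (real m)))"
proof -
  have "connects (boolean_set \<omega>) {0} (- cball 0 r) \<longleftrightarrow>
      (\<exists>y\<in>connected_component_set (boolean_set \<omega>) 0. r < norm y)" for r
    using path_component_eq_connected_component[OF open_imp_locally_path_connected[OF open_boolean_set[of \<omega>]]]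
    by (auto simp: connects_def not_le)
  moreover have "bounded T \<longleftrightarrow> (\<exists>m::nat. \<forall>y\<in>T. norm y \<le> real m)" for T :: "'a set"
    unfolding bounded_iff by (meson order.trans real_arch_simple)
  ultimately show ?thesis by (simp add: Ball_def Bex_def not_le)
qed

text \<open>The threshold A is chosen before f, which later gives a decay rate uniform in the number
  of levels and in \<rho>. Where f \<le> 1/(4C), the quadratic term is at most a quarter of any
  bound on f; hence the bound 1/(4C) passes from decade to decade, and each further factor 10 halves
  the bound once h is below a quarter of it.\<close>

lemma quadratic_recursion_decay:
  fixes h :: "real \<Rightarrow> real"
  assumes C: "C > 0" and h: "(h \<longlongrightarrow> 0) at_top" and \<alpha>0: "\<alpha>0 > 0"
    and h_small: "\<And>\<alpha>. \<alpha>0 \<le> \<alpha> \<Longrightarrow> h \<alpha> \<le> 1 / (8 * C)" and \<epsilon>: "\<epsilon> > 0"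
  shows "\<exists>A. \<forall>f. (\<forall>\<alpha>. 0 \<le> f \<alpha>) \<longrightarrow> (\<forall>\<alpha>\<in>{\<alpha>0..10 * \<alpha>0}. f \<alpha> \<le> 1 / (4 * C)) \<longrightarrow>
    (\<forall>\<alpha>\<ge>\<alpha>0. f (10 * \<alpha>) \<le> C * (f \<alpha>)\<^sup>2 + h \<alpha>) \<longrightarrow> (\<forall>\<alpha>\<ge>A. f \<alpha> \<le> \<epsilon>)"
proof -
  define ok where "ok f \<longleftrightarrow> (\<forall>\<alpha>. 0 \<le> f \<alpha>) \<and> (\<forall>\<alpha>\<in>{\<alpha>0..10 * \<alpha>0}. f \<alpha> \<le> 1 / (4 * C)) \<and>
    (\<forall>\<alpha>\<ge>\<alpha>0. f (10 * \<alpha>) \<le> C * (f \<alpha>)\<^sup>2 + h \<alpha>)" for f :: "real \<Rightarrow> real"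
  have step: "f \<alpha> \<le> C * (f (\<alpha> / 10))\<^sup>2 + h (\<alpha> / 10)" if "ok f" "10 * \<alpha>0 \<le> \<alpha>" for f \<alpha>
  proof -
    have "\<alpha>0 \<le> \<alpha> / 10" using that(2) by simp
    then have "f (10 * (\<alpha> / 10)) \<le> C * (f (\<alpha> / 10))\<^sup>2 + h (\<alpha> / 10)"
      using that(1) unfolding ok_def by blast
    then show ?thesis by simp
  qed
  have quad: "C * y\<^sup>2 \<le> b / 4" if "0 \<le> y" "y \<le> 1 / (4 * C)" "y \<le> b" for y b
  proof -
    have "C * y\<^sup>2 = C * y * y" by (simp add: power2_eq_square)
    also have "\<dots> \<le> (C * (1 / (4 * C))) * b"
      using that C by (intro mult_mono) auto
    also have "\<dots> = b / 4" using C by simp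
    finally show ?thesis .
  qed
  have bdd: "f \<alpha> \<le> 1 / (4 * C)" if "ok f" "\<alpha>0 \<le> \<alpha>" for f \<alpha>
  proof -
    \<comment> \<open>Induction over decades: a point of the next decade divided by 10 falls into
      the range already treated.\<close>
    have all: "\<forall>\<alpha>\<in>{\<alpha>0..10 ^ Suc k * \<alpha>0}. f \<alpha> \<le> 1 / (4 * C)" for k
    proof (induction k)
      case 0
      then show ?case using \<open>ok f\<close> by (simp add: ok_def)
    next
      case (Suc k)
      show ?case
      proof
        fix \<alpha> assume \<alpha>: "\<alpha> \<in> {\<alpha>0..10 ^ Suc (Suc k) * \<alpha>0}"
        show "f \<alpha> \<le> 1 / (4 * C)"
        proof (cases "\<alpha> \<le> 10 * \<alpha>0")
          case True
          then show ?thesis using \<alpha> \<open>ok f\<close> by (simp add: ok_def)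
        next
          case False
          then have *: "\<alpha> / 10 \<in> {\<alpha>0..10 ^ Suc k * \<alpha>0}" using \<alpha> by auto
          then have "C * (f (\<alpha> / 10))\<^sup>2 \<le> (1 / (4 * C)) / 4"
            using Suc.IH \<open>ok f\<close> by (intro quad) (auto simp: ok_def)
          moreover have "h (\<alpha> / 10) \<le> 1 / (8 * C)" using * by (intro h_small) auto
          \<comment> \<open>In units of 1/C: 1/16 + 1/8 = 3/16 < 1/4.\<close>
          moreover have "(1 / (4 * C)) / 4 + 1 / (8 * C) \<le> 1 / (4 * C)" using C by (simp add: field_simps)
          ultimately show ?thesis using step[OF \<open>ok f\<close>, of \<alpha>] False by linarith
        qed
      qed
    qed
    obtain k where "\<alpha> / \<alpha>0 < 10 ^ k" using real_arch_pow[of 10 "\<alpha> / \<alpha>0"] by auto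
    then have "\<alpha> \<le> 10 ^ k * \<alpha>0" using \<alpha>0 by (simp add: field_simps)
    moreover have "10 ^ k * \<alpha>0 \<le> 10 ^ Suc k * \<alpha>0" using \<alpha>0 by simp
    ultimately have "\<alpha> \<in> {\<alpha>0..10 ^ Suc k * \<alpha>0}"
      unfolding atLeastAtMost_iff using \<open>\<alpha>0 \<le> \<alpha>\<close> by (meson order.trans)
    then show ?thesis using all by blast
  qed
  have "\<exists>A. \<forall>f \<alpha>. ok f \<longrightarrow> A \<le> \<alpha> \<longrightarrow> f \<alpha> \<le> (1 / (4 * C)) / 2 ^ k" for k
  proof (induction k)
    case 0
    then show ?case using bdd by auto
  next
    case (Suc k)
    define b where "b = (1 / (4 * C)) / 2 ^ k"
    have b: "b > 0" using C by (simp add: b_def)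
    obtain A where A: "\<And>f \<alpha>. ok f \<Longrightarrow> A \<le> \<alpha> \<Longrightarrow> f \<alpha> \<le> b" using Suc.IH unfolding b_def by blast
    have "eventually (\<lambda>\<alpha>. h \<alpha> < b / 4) at_top" using order_tendstoD(2)[OF h, of "b / 4"] b by simp
    then obtain B where B: "\<And>\<alpha>. B \<le> \<alpha> \<Longrightarrow> h \<alpha> < b / 4" by (auto simp: eventually_at_top_linorder)
    have "f \<alpha> \<le> b / 2" if "ok f" "10 * max \<alpha>0 (max A B) \<le> \<alpha>" for f \<alpha>
    proof -
      have *: "\<alpha>0 \<le> \<alpha> / 10" "A \<le> \<alpha> / 10" "B \<le> \<alpha> / 10" using that(2) by auto
      have "C * (f (\<alpha> / 10))\<^sup>2 \<le> b / 4"
        using bdd[OF that(1) *(1)] A[OF that(1) *(2)] that(1) by (intro quad) (auto simp: ok_def)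
      then show ?thesis using step[OF that(1), of \<alpha>] B[OF *(3)] *(1) by linarith
    qed
    then show ?case unfolding b_def by (intro exI[of _ "10 * max \<alpha>0 (max A B)"]) (auto simp: field_simps)
  qed
  moreover obtain k where "(1 / (4 * C)) / \<epsilon> < 2 ^ k" using real_arch_pow[of 2 "(1 / (4 * C)) / \<epsilon>"] by auto
  then have "(1 / (4 * C)) / 2 ^ k \<le> \<epsilon>" using \<epsilon> C by (simp add: divide_simps mult_ac)
  ultimately obtain A where "\<And>f \<alpha>. ok f \<Longrightarrow> A \<le> \<alpha> \<Longrightarrow> f \<alpha> \<le> \<epsilon>" by (meson order.trans)
  then show ?thesis unfolding ok_def by (intro exI[of _ A]) blast
qed

subsection \<open>Intensity estimates\<close>

text \<open>Counts the levels at which a ball of radius r still has radius above A after shrinking.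
  Such n satisfy 2^n \<le> r, so there are at most logarithmically many, uniformly in N and \<rho>
  \<ge> 2; this is the source of the factor ln \<beta>.\<close>

lemma card_levels_le:
  fixes A \<rho> r :: real
  assumes "1 \<le> A" "2 \<le> \<rho>" "1 < r"
  shows "real (card {n. n < N \<and> \<rho> ^ n * A < r}) \<le> 1 + 2 * ln r"
proof -
  have "{n. n < N \<and> \<rho> ^ n * A < r} \<subseteq> {..nat \<lfloor>2 * ln r\<rfloor>}"
  proof
    fix n assume "n \<in> {n. n < N \<and> \<rho> ^ n * A < r}"
    then have n: "\<rho> ^ n * A < r" by simp
    have "(2::real) ^ n * 1 \<le> \<rho> ^ n * A" using assms by (intro mult_mono power_mono) auto
    then have "(2::real) ^ n \<le> r" using n by simp
    then have "ln (2 ^ n) \<le> ln r" using assms(3) by (subst ln_le_cancel_iff) auto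
    then have "real n * ln 2 \<le> ln r" by (simp add: ln_realpow)
    \<comment> \<open>The crude bound ln 2 \<ge> 1/2 gives the constant 2 in front of ln r.\<close>
    moreover have "real n * (1 / 2) \<le> real n * ln 2" using ln2_ge_two_thirds by (intro mult_left_mono) auto
    ultimately show "n \<in> {..nat \<lfloor>2 * ln r\<rfloor>}" by (simp add: le_nat_floor)
  qed
  then have "card {n. n < N \<and> \<rho> ^ n * A < r} \<le> nat \<lfloor>2 * ln r\<rfloor> + 1"
    using card_mono[of "{..nat \<lfloor>2 * ln r\<rfloor>}"] by fastforce
  moreover have "real (nat \<lfloor>2 * ln r\<rfloor>) \<le> 2 * ln r" using assms(3) by simp
  ultimately show ?thesis by linarith
qed

lemma emeasure_lborel_ball_eq:
  fixes c :: "'a::euclidean_space"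
  assumes "r \<ge> 0"
  shows "emeasure lborel (ball c r) = ennreal (unit_ball_vol (real DIM('a)) * r ^ DIM('a))"
  using emeasure_ball[OF assms, of c] by simp

text \<open>The second condition says that the ball meets the ball of radius 23 A about the origin,
  the region in which \<open>local_crossing\<close> needs small radii.\<close>

definition large_balls :: "real \<Rightarrow> ('a::euclidean_space \<times> real) set" where
  "large_balls A = {(c, r). A < r \<and> norm c < r + 23 * A}"

definition small_balls :: "real \<Rightarrow> real \<Rightarrow> ('a::euclidean_space \<times> real) set" where
  "small_balls \<eta> R = {(c, r). r < \<eta> \<and> norm c < R}"

text \<open>The balls that contain the closed ball of radius R about the origin.\<close>

definition covering_balls :: "real \<Rightarrow> ('a::euclidean_space \<times> real) set" where
  "covering_balls R = {(c, r). norm c + R < r}"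

lemma balls_sets_borel [measurable]:
  "large_balls A \<in> sets borel" "small_balls \<eta> R \<in> sets borel" "covering_balls R \<in> sets borel"
  unfolding large_balls_def small_balls_def covering_balls_def case_prod_beta
  by (intro borel_open open_Collect_conj open_Collect_less continuous_intros)+

lemma scale_points_vimage_sets [measurable]:
  "A \<in> sets borel \<Longrightarrow> scale_points k -` A \<in> sets (borel :: ('a::euclidean_space \<times> real) measure)"
  using measurable_sets[OF scale_points_measurable, of A k] by simp

context
  fixes \<nu> :: "real measure"
  assumes sets_\<nu>: "sets \<nu> = sets (restrict_space borel {0<..})" and fin: "finite_measure \<nu>"
begin

lemma borel_measurable_radius: "f \<in> borel_measurable borel \<Longrightarrow> f \<in> borel_measurable \<nu>"
  using measurable_compose[OF measurable_radius[OF sets_\<nu>]] .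

lemma space_radius: "space \<nu> = {0<..}"
  using sets_eq_imp_space_eq[OF sets_\<nu>] by (simp add: space_restrict_space)

text \<open>A ball of level n counts iff \<rho>^n A < r and its centre has norm below r + 23
  \<rho>^n A, hence below 24 r. So each contributing level has section volume at most K r^d, and
  \<open>card_levels_le\<close> bounds the number of these levels. The result is free of N and
  \<rho>.\<close>

lemma levels_large_balls_le:
  assumes A: "1 \<le> A" and \<rho>: "2 \<le> \<rho>"
  shows "(\<Sum>n<N. ball_intensity \<nu> (scale_points (1 / \<rho> ^ n) -` (large_balls A :: ('a::euclidean_space \<times> real) set))) \<le>
    (\<integral>\<^sup>+ r. ennreal (unit_ball_vol (real DIM('a)) * 24 ^ DIM('a) * (r ^ DIM('a) * (1 + 2 * ln r))) * indicator {A<..} r \<partial>\<nu>)"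
proof -
  define K where "K = unit_ball_vol (real DIM('a)) * 24 ^ DIM('a)"
  have K: "K \<ge> 0" by (simp add: K_def)
  let ?L = "large_balls A :: ('a \<times> real) set"
  have sec: "emeasure lborel {c. (c, r) \<in> scale_points (1 / \<rho> ^ n) -` ?L} \<le>
      (if \<rho> ^ n * A < r then ennreal (K * r ^ DIM('a)) else 0)" for n r
  proof -
    have pos: "\<rho> ^ n > 0" using \<rho> by simp
    have iff: "(c, r) \<in> scale_points (1 / \<rho> ^ n) -` ?L \<longleftrightarrow> \<rho> ^ n * A < r \<and> norm c < r + 23 * (\<rho> ^ n * A)" for c :: 'a
    proof -
      have "(c, r) \<in> scale_points (1 / \<rho> ^ n) -` ?L \<longleftrightarrow> A < r / \<rho> ^ n \<and> norm c / \<rho> ^ n < r / \<rho> ^ n + 23 * A"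
        using \<rho> by (simp add: scale_points_def large_balls_def)
      also have "\<dots> \<longleftrightarrow> \<rho> ^ n * A < r \<and> norm c < r + 23 * (\<rho> ^ n * A)"
        using pos \<rho> by (simp add: field_simps)
      finally show ?thesis .
    qed
    show ?thesis
    proof (cases "\<rho> ^ n * A < r")
      case True
      then have r: "r > 0" using pos A by (smt (verit) mult_pos_pos)
      have "{c. (c, r) \<in> scale_points (1 / \<rho> ^ n) -` ?L} \<subseteq> ball 0 (24 * r)"
        using iff True by auto
      then have "emeasure lborel {c. (c, r) \<in> scale_points (1 / \<rho> ^ n) -` ?L} \<le> emeasure lborel (ball (0 :: 'a) (24 * r))"
        by (intro emeasure_mono) auto
      also have "\<dots> = ennreal (K * r ^ DIM('a))"
        using r by (simp add: emeasure_lborel_ball_eq K_def power_mult_distrib mult_ac)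
      finally show ?thesis using True by simp
    next
      case False
      then have "{c. (c, r) \<in> scale_points (1 / \<rho> ^ n) -` ?L} = {}" using iff by auto
      then show ?thesis by simp
    qed
  qed
  have "(\<Sum>n<N. ball_intensity \<nu> (scale_points (1 / \<rho> ^ n) -` ?L)) =
      (\<Sum>n<N. \<integral>\<^sup>+ r. emeasure lborel {c. (c, r) \<in> scale_points (1 / \<rho> ^ n) -` ?L} \<partial>\<nu>)"
    by (intro sum.cong refl ball_intensity_section[OF sets_\<nu> fin]) measurable
  also have "\<dots> = (\<integral>\<^sup>+ r. (\<Sum>n<N. emeasure lborel {c. (c, r) \<in> scale_points (1 / \<rho> ^ n) -` ?L}) \<partial>\<nu>)"
    by (intro nn_integral_sum[symmetric] measurable_section_measure[OF sets_\<nu> fin]) measurable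
  also have "\<dots> \<le> (\<integral>\<^sup>+ r. ennreal (K * (r ^ DIM('a) * (1 + 2 * ln r))) * indicator {A<..} r \<partial>\<nu>)"
  proof (rule nn_integral_mono)
    fix r
    have "(\<Sum>n<N. emeasure lborel {c. (c, r) \<in> scale_points (1 / \<rho> ^ n) -` ?L}) \<le>
        (\<Sum>n<N. if \<rho> ^ n * A < r then ennreal (K * r ^ DIM('a)) else 0)"
      by (intro sum_mono sec)
    also have "\<dots> = of_nat (card {n. n < N \<and> \<rho> ^ n * A < r}) * ennreal (K * r ^ DIM('a))"
      by (simp add: sum.If_cases lessThan_def Collect_conj_eq)
    also have "\<dots> \<le> ennreal (K * (r ^ DIM('a) * (1 + 2 * ln r))) * indicator {A<..} r"
    proof (cases "A < r")
      case True
      have "of_nat (card {n. n < N \<and> \<rho> ^ n * A < r}) * ennreal (K * r ^ DIM('a)) =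
          ennreal (real (card {n. n < N \<and> \<rho> ^ n * A < r}) * (K * r ^ DIM('a)))"
        using K True A by (simp add: ennreal_mult flip: ennreal_of_nat_eq_real_of_nat)
      also have "\<dots> \<le> ennreal ((1 + 2 * ln r) * (K * r ^ DIM('a)))"
        using K True A \<rho> by (intro ennreal_leI mult_right_mono card_levels_le) auto
      finally show ?thesis using True by (simp add: mult_ac)
    next
      case False
      have "\<not> \<rho> ^ n * A < r" for n
      proof -
        have "1 * A \<le> \<rho> ^ n * A" using \<rho> A by (intro mult_right_mono one_le_power) auto
        then show ?thesis using False by simp
      qed
      then show ?thesis by simp
    qed
    finally show "(\<Sum>n<N. emeasure lborel {c. (c, r) \<in> scale_points (1 / \<rho> ^ n) -` ?L}) \<le> \<dots>" .
  qed
  finally show ?thesis by (simp add: K_def)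
qed

text \<open>Dominated convergence: on r > 1 the integrand is at most a multiple of r^d ln r plus a
  constant, and both are integrable since \<nu> is finite.\<close>

lemma large_balls_tail_vanishes:
  fixes K :: real
  assumes ln_fin: "(\<integral>\<^sup>+\<beta>\<in>{1..}. ennreal (\<beta> ^ d * ln \<beta>) \<partial>\<nu>) < \<infinity>" and K: "0 \<le> K" and \<delta>: "0 < \<delta>"
  shows "\<exists>A0\<ge>1. \<forall>A\<ge>A0. (\<integral>\<^sup>+ r. ennreal (K * (r ^ d * (1 + 2 * ln r))) * indicator {A<..} r \<partial>\<nu>) \<le> ennreal \<delta>"
proof -
  interpret finite_measure \<nu> by (rule fin)
  let ?f = "\<lambda>A r. ennreal (K * (r ^ d * (1 + 2 * ln r))) * indicator {A<..} r"
  have meas: "?f A \<in> borel_measurable \<nu>" for A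
    by (rule borel_measurable_radius) measurable
  have bound: "?f 1 r \<le> ennreal (3 * K) * (ennreal (r ^ d * ln r) * indicator {1..} r) + ennreal (K * exp 1 ^ d)" for r
  proof (cases "1 < r")
    case True
    have "r ^ d * (1 + 2 * ln r) \<le> 3 * (r ^ d * ln r) + exp 1 ^ d"
    \<comment> \<open>Below e the term r^d is bounded by a constant; above e it is absorbed by r^d
      ln r, since ln r \<ge> 1.\<close>
    proof (cases "r \<le> exp 1")
      case True
      have "r ^ d \<le> exp 1 ^ d" using True \<open>1 < r\<close> by (intro power_mono) auto
      moreover have "0 \<le> r ^ d * ln r" using \<open>1 < r\<close> by simp
      ultimately show ?thesis by (simp add: algebra_simps)
    next
      case False
      then have "ln (exp 1) \<le> ln r" using \<open>1 < r\<close> by (subst ln_le_cancel_iff) auto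
      then have "r ^ d * 1 \<le> r ^ d * ln r" using \<open>1 < r\<close> by (intro mult_left_mono) auto
      moreover have "0 \<le> exp (1::real) ^ d" by simp
      moreover have "r ^ d * (1 + 2 * ln r) = r ^ d + 2 * (r ^ d * ln r)" by (simp add: algebra_simps)
      ultimately show ?thesis by linarith
    qed
    then have "K * (r ^ d * (1 + 2 * ln r)) \<le> K * (3 * (r ^ d * ln r) + exp 1 ^ d)"
      using K by (rule mult_left_mono)
    then have "ennreal (K * (r ^ d * (1 + 2 * ln r))) \<le> ennreal ((3 * K) * (r ^ d * ln r) + K * exp 1 ^ d)"
      by (intro ennreal_leI) (simp add: algebra_simps)
    also have "\<dots> = ennreal (3 * K) * ennreal (r ^ d * ln r) + ennreal (K * exp 1 ^ d)"
      using True K by (simp add: ennreal_mult)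
    finally show ?thesis using True by simp
  qed simp
  have "(\<integral>\<^sup>+ r. ?f 1 r \<partial>\<nu>) \<le>
      (\<integral>\<^sup>+ r. ennreal (3 * K) * (ennreal (r ^ d * ln r) * indicator {1..} r) + ennreal (K * exp 1 ^ d) \<partial>\<nu>)"
    by (intro nn_integral_mono bound)
  also have "\<dots> = ennreal (3 * K) * (\<integral>\<^sup>+\<beta>\<in>{1..}. ennreal (\<beta> ^ d * ln \<beta>) \<partial>\<nu>) + ennreal (K * exp 1 ^ d) * emeasure \<nu> (space \<nu>)"
    by (subst nn_integral_add nn_integral_cmult; (rule borel_measurable_radius, measurable)?)+ simp
  also have "\<dots> < \<infinity>"
    using ln_fin emeasure_finite[of "space \<nu>"]
    by (auto simp: ennreal_mult_eq_top_iff less_top[symmetric])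
  finally have fin1: "(\<integral>\<^sup>+ r. ?f 1 r \<partial>\<nu>) < \<infinity>" .
  have mono: "?f A r \<le> ?f B r" if "B \<le> A" for A B r
    using that by (intro mult_left_mono) (auto simp: indicator_def)
  have "(\<lambda>n. \<integral>\<^sup>+ r. ?f (real (Suc n)) r \<partial>\<nu>) \<longlonglongrightarrow> (\<integral>\<^sup>+ r. 0 \<partial>\<nu>)"
  proof (rule nn_integral_dominated_convergence[where w="?f 1"])
    show "AE r in \<nu>. (\<lambda>n. ?f (real (Suc n)) r) \<longlonglongrightarrow> 0"
    proof (rule AE_I2)
      fix r
      obtain m where m: "r \<le> real m" using real_arch_simple by blast
      have "eventually (\<lambda>n. ?f (real (Suc n)) r = 0) sequentially"
        using eventually_ge_at_top[of m] by eventually_elim (use m in auto)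
      then show "(\<lambda>n. ?f (real (Suc n)) r) \<longlonglongrightarrow> 0" by (rule tendsto_eventually)
    qed
  qed (use meas fin1 mono in \<open>auto intro!: AE_I2\<close>)
  then have "eventually (\<lambda>n. (\<integral>\<^sup>+ r. ?f (real (Suc n)) r \<partial>\<nu>) < ennreal \<delta>) sequentially"
    using \<delta> by (intro order_tendstoD(2)[of _ 0]) auto
  then obtain n where n: "(\<integral>\<^sup>+ r. ?f (real (Suc n)) r \<partial>\<nu>) < ennreal \<delta>"
    by (meson eventually_sequentially order_refl)
  show ?thesis
  proof (intro exI[of _ "real (Suc n)"] conjI allI impI)
    fix A assume "real (Suc n) \<le> A"
    then have "(\<integral>\<^sup>+ r. ?f A r \<partial>\<nu>) \<le> (\<integral>\<^sup>+ r. ?f (real (Suc n)) r \<partial>\<nu>)"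
      by (intro nn_integral_mono mono)
    then show "(\<integral>\<^sup>+ r. ?f A r \<partial>\<nu>) \<le> ennreal \<delta>" using n by simp
  qed simp
qed

text \<open>Radii are strictly positive, so the sets of radii below 1/n decrease to the empty set
  and their mass under the finite measure \<nu> vanishes.\<close>

lemma small_balls_vanish:
  assumes \<delta>: "0 < \<delta>"
  shows "\<exists>\<eta>>0. \<eta> \<le> 1 \<and> ball_intensity \<nu> (small_balls \<eta> R :: ('a::euclidean_space \<times> real) set) \<le> ennreal \<delta>"
proof -
  interpret finite_measure \<nu> by (rule fin)
  define W where "W = emeasure lborel (ball (0 :: 'a) R)"
  have W: "W < \<infinity>" unfolding W_def by (rule emeasure_lborel_ball_finite)
  have eq: "ball_intensity \<nu> (small_balls \<eta> R :: ('a \<times> real) set) = (\<integral>\<^sup>+ r. W * indicator {..<\<eta>} r \<partial>\<nu>)" for \<eta>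
  proof -
    have "{c :: 'a. (c, r) \<in> small_balls \<eta> R} = (if r < \<eta> then ball 0 R else {})" for r
      by (auto simp: small_balls_def)
    then have "emeasure lborel {c :: 'a. (c, r) \<in> small_balls \<eta> R} = W * indicator {..<\<eta>} r" for r
      by (simp add: W_def)
    then show ?thesis by (subst ball_intensity_section[OF sets_\<nu> fin]) auto
  qed
  have "(\<lambda>n. \<integral>\<^sup>+ r. W * indicator {..<1 / real (Suc n)} r \<partial>\<nu>) \<longlonglongrightarrow> (\<integral>\<^sup>+ r. 0 \<partial>\<nu>)"
  proof (rule nn_integral_dominated_convergence[where w="\<lambda>_. W"])
    show "(\<integral>\<^sup>+ r. W \<partial>\<nu>) < \<infinity>" using W emeasure_finite[of "space \<nu>"]
      by (auto simp: ennreal_mult_eq_top_iff less_top[symmetric])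
    show "(\<lambda>r. W * indicator {..<1 / real (Suc n)} r) \<in> borel_measurable \<nu>" for n
      by (rule borel_measurable_radius) measurable
    show "AE r in \<nu>. (\<lambda>n. W * indicator {..<1 / real (Suc n)} r) \<longlonglongrightarrow> 0"
    proof (rule AE_I2)
      fix r assume "r \<in> space \<nu>"
      then have "r > 0" by (simp add: space_radius)
      then obtain m where m: "inverse (real (Suc m)) < r" using reals_Archimedean by blast
      have "eventually (\<lambda>n. W * indicator {..<1 / real (Suc n)} r = 0) sequentially"
        using eventually_ge_at_top[of m]
      proof eventually_elim
        case (elim n)
        then have "1 / real (Suc n) \<le> inverse (real (Suc m))" by (simp add: field_simps)
        then show ?case using m by simp
      qed
      then show "(\<lambda>n. W * indicator {..<1 / real (Suc n)} r) \<longlonglongrightarrow> 0" by (rule tendsto_eventually)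
    qed
  qed (auto intro!: AE_I2 simp: indicator_def)
  then have "eventually (\<lambda>n. (\<integral>\<^sup>+ r. W * indicator {..<1 / real (Suc n)} r \<partial>\<nu>) < ennreal \<delta>) sequentially"
    using \<delta> by (intro order_tendstoD(2)[of _ 0]) auto
  then obtain n where "(\<integral>\<^sup>+ r. W * indicator {..<1 / real (Suc n)} r \<partial>\<nu>) < ennreal \<delta>"
    by (meson eventually_sequentially order_refl)
  then show ?thesis by (intro exI[of _ "1 / real (Suc n)"]) (auto simp: eq)
qed

text \<open>After shrinking, a ball of level n covers radius R iff it covers \<rho>^n R before. For
  large r there are about ln r / ln \<rho> such levels, each with section volume at least that of a
  ball of radius r/2, so r^d ln r is bounded by a constant plus a multiple of the sum of the section
  volumes.\<close>

lemma covering_balls_infinite: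
  assumes ln_inf: "(\<integral>\<^sup>+\<beta>\<in>{1..}. ennreal (\<beta> ^ DIM('a) * ln \<beta>) \<partial>\<nu>) = \<infinity>"
    and \<rho>: "1 < \<rho>" and R: "1 \<le> R"
  shows "(\<Sum>n. ball_intensity \<nu> (covering_balls (\<rho> ^ n * R) :: ('a::euclidean_space \<times> real) set)) = \<infinity>"
proof -
  interpret finite_measure \<nu> by (rule fin)
  define V where "V = unit_ball_vol (real DIM('a))"
  have V: "V > 0" by (simp add: V_def)
  define e where "e n r = emeasure lborel {c :: 'a. (c, r) \<in> covering_balls (\<rho> ^ n * R)}" for n r
  \<comment> \<open>Bounds r^d ln r on the range r < 4 R^2, where the count of levels gives
    nothing.\<close>
  define c1 where "c1 = (4 * R\<^sup>2) ^ DIM('a) * ln (4 * R\<^sup>2)"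
  \<comment> \<open>Undoes the volume V (r/2)^d of one section and the factor 2 ln \<rho> per
    level.\<close>
  define c2 where "c2 = 2 * ln \<rho> * 2 ^ DIM('a) / V"
  have R2: "1 \<le> R\<^sup>2" using R by simp
  have c2: "0 \<le> c2" using V \<rho> by (simp add: c2_def)
  have c1: "0 \<le> c1" unfolding c1_def using R2 by (intro mult_nonneg_nonneg) auto
  have meas: "e n \<in> borel_measurable \<nu>" for n
    unfolding e_def by (rule measurable_section_measure[OF sets_\<nu> fin]) measurable
  have pt: "ennreal (r ^ DIM('a) * ln r) * indicator {1..} r \<le> ennreal c1 + ennreal c2 * (\<Sum>n. e n r)" for r
  proof (cases "1 \<le> r")
    case r: True
    show ?thesis
    proof (cases "r < 4 * R\<^sup>2")
      case True
      have "r ^ DIM('a) * ln r \<le> c1"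
        unfolding c1_def using r True by (intro mult_mono power_mono) (auto intro!: ln_mono)
      then have "ennreal (r ^ DIM('a) * ln r) \<le> ennreal c1" by (rule ennreal_leI)
      also have "\<dots> \<le> ennreal c1 + ennreal c2 * (\<Sum>n. e n r)" by simp
      finally show ?thesis using r by simp
    next
      case False
      \<comment> \<open>\<rho>^n R \<le> r/2 holds iff n \<le> y. Adding 1 to the floor counts level
        0, so that there are m \<ge> y such levels.\<close>
      define y where "y = ln (r / (2 * R)) / ln \<rho>"
      define m where "m = nat \<lfloor>y\<rfloor> + 1"
      have y: "0 \<le> y"
      proof -
        have "2 * R \<le> 4 * R\<^sup>2" using R by (simp add: power2_eq_square)
        then have "1 \<le> r / (2 * R)" using False R by (simp add: field_simps)
        then show ?thesis using \<rho> by (simp add: y_def)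
      qed
      have m: "y \<le> real m" unfolding m_def using y by linarith
      have en: "ennreal (V * (r / 2) ^ DIM('a)) \<le> e n r" if "n < m" for n
      proof -
        have "real n \<le> y" using that y unfolding m_def by linarith
        then have "real n * ln \<rho> \<le> ln (r / (2 * R))" using \<rho> by (simp add: y_def field_simps)
        then have "ln (\<rho> ^ n) \<le> ln (r / (2 * R))" using \<rho> by (simp add: ln_realpow)
        then have "\<rho> ^ n \<le> r / (2 * R)" using \<rho> r R by (subst (asm) ln_le_cancel_iff) auto
        then have le: "\<rho> ^ n * R \<le> r / 2" using R by (simp add: field_simps)
        have "V * (r / 2) ^ DIM('a) = unit_ball_vol (real DIM('a)) * (r / 2) ^ DIM('a)" by (simp add: V_def)
        then have "ennreal (V * (r / 2) ^ DIM('a)) = emeasure lborel (ball (0 :: 'a) (r / 2))"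
          using r by (subst emeasure_lborel_ball_eq) auto
        also have "\<dots> \<le> e n r"
          unfolding e_def using le section_sets[OF balls_sets_borel(3)]
          by (intro emeasure_mono) (auto simp: covering_balls_def)
        finally show ?thesis .
      qed
      \<comment> \<open>From r \<ge> 4 R^2: r is at most the square of r/(2R).\<close>
      have lnr: "ln r \<le> 2 * ln (r / (2 * R))"
      proof -
        have "r * (4 * R\<^sup>2) \<le> r * r" using False r by (intro mult_left_mono) auto
        then have "r \<le> (r / (2 * R)) ^ 2" using R by (simp add: field_simps power2_eq_square)
        then have "ln r \<le> ln ((r / (2 * R)) ^ 2)" using r R by (subst ln_le_cancel_iff) auto
        also have "\<dots> = 2 * ln (r / (2 * R))" using r R by (subst ln_realpow) auto
        finally show ?thesis .
      qed
      have "ln (r / (2 * R)) \<le> real m * ln \<rho>" using m \<rho> by (simp add: y_def field_simps)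
      then have "ln r \<le> 2 * (real m * ln \<rho>)" using lnr by linarith
      then have "r ^ DIM('a) * ln r \<le> r ^ DIM('a) * (2 * (real m * ln \<rho>))"
        using r by (intro mult_left_mono) auto
      also have "\<dots> = c2 * (real m * (V * (r / 2) ^ DIM('a)))"
        using V by (simp add: c2_def power_divide field_simps)
      finally have "ennreal (r ^ DIM('a) * ln r) \<le> ennreal (c2 * (real m * (V * (r / 2) ^ DIM('a))))"
        by (rule ennreal_leI)
      also have "\<dots> = ennreal c2 * (\<Sum>n<m. ennreal (V * (r / 2) ^ DIM('a)))"
        using c2 V r by (simp add: ennreal_mult ennreal_of_nat_eq_real_of_nat)
      also have "\<dots> \<le> ennreal c2 * (\<Sum>n<m. e n r)"
        by (intro mult_left_mono sum_mono en) auto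
      also have "\<dots> \<le> ennreal c2 * (\<Sum>n. e n r)"
        by (intro mult_left_mono sum_le_suminf) auto
      also have "\<dots> \<le> ennreal c1 + ennreal c2 * (\<Sum>n. e n r)" by simp
      finally show ?thesis using r by simp
    qed
  qed simp
  have "\<infinity> \<le> (\<integral>\<^sup>+ r. ennreal c1 + ennreal c2 * (\<Sum>n. e n r) \<partial>\<nu>)"
    unfolding ln_inf[symmetric] by (intro nn_integral_mono pt)
  also have "\<dots> = ennreal c1 * emeasure \<nu> (space \<nu>) + ennreal c2 * (\<integral>\<^sup>+ r. (\<Sum>n. e n r) \<partial>\<nu>)"
    using meas by (subst nn_integral_add) (auto simp: nn_integral_cmult)
  \<comment> \<open>The term with c1 is finite because \<nu> is, so the other term carries the
    infinity.\<close>
  finally have "(\<integral>\<^sup>+ r. (\<Sum>n. e n r) \<partial>\<nu>) = \<infinity>"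
    using emeasure_finite by (auto simp: top_unique ennreal_mult_eq_top_iff)
  then have "(\<Sum>n. \<integral>\<^sup>+ r. e n r \<partial>\<nu>) = \<infinity>" using meas by (subst (asm) nn_integral_suminf)
  then show ?thesis by (simp add: e_def ball_intensity_section[OF sets_\<nu> fin])
qed

end

subsection \<open>Renormalization\<close>

definition crossing :: "'a::euclidean_space \<Rightarrow> real \<Rightarrow> ('a \<times> real) set set" where
  "crossing x \<alpha> = {\<omega>. connects (boolean_set \<omega>) (sphere x \<alpha>) (sphere x (2 * \<alpha>))}"

lemma sigma_sets_avoiding_crossing: "crossing x \<alpha> \<in> sigma_sets UNIV (avoiding UNIV)"
  using sigma_sets_avoiding_connects[of UNIV] by (simp add: crossing_def)

lemma crossing_translate_iff:
  "(\<lambda>(c, r). (x + c, r)) ` \<omega> \<in> crossing x \<alpha> \<longleftrightarrow> \<omega> \<in> crossing 0 \<alpha>"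
proof -
  have "(+) (- x) ` (+) x ` boolean_set \<omega> = boolean_set \<omega>" by (simp add: image_image)
  then show ?thesis
    using connects_translate[of "boolean_set \<omega>" 0 \<alpha> "2 * \<alpha>" x]
      connects_translate[of "(+) x ` boolean_set \<omega>" x \<alpha> "2 * \<alpha>" "- x"]
    by (auto simp: crossing_def boolean_set_translate)
qed

lemma translate_measurable: "(\<lambda>(c, r). (x + c, r)) \<in> borel \<rightarrow>\<^sub>M (borel :: ('a::euclidean_space \<times> real) measure)"
  unfolding case_prod_beta by (intro borel_measurable_continuous_onI continuous_intros)

lemma finite_net:
  fixes S :: "'a::metric_space set"
  assumes "compact S" "e > 0"
  shows "\<exists>X. finite X \<and> X \<subseteq> S \<and> S \<subseteq> (\<Union>x\<in>X. ball x e)"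
proof -
  have "S \<subseteq> (\<Union>x\<in>S. ball x e)" using assms(2) by force
  then obtain X where "X \<subseteq> S" "finite X" "S \<subseteq> (\<Union>x\<in>X. ball x e)"
    using compactE_image[OF assms(1), of S "\<lambda>x. ball x e"] by (metis open_ball)
  then show ?thesis by blast
qed

context
  fixes \<Lambda> :: "('a::euclidean_space \<times> real) set \<Rightarrow> ennreal"
  assumes translate: "\<And>x A. A \<in> sets borel \<Longrightarrow> \<Lambda> ((\<lambda>(c, r). (x + c, r)) -` A) = \<Lambda> A"
begin

text \<open>The translated process has the same void probabilities, hence the same law on crossing
  events.\<close>

lemma crossing_prob_translate:
  assumes vp: "void_process \<Lambda> M \<omega>"
  shows "measure M {w \<in> space M. \<omega> w \<in> crossing x \<alpha>} = measure M {w \<in> space M. \<omega> w \<in> crossing 0 \<alpha>}"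
proof -
  have "measure M {w \<in> space M. \<omega> w \<in> crossing x \<alpha>} =
      measure M {w \<in> space M. (\<lambda>(c, r). (x + c, r)) ` \<omega> w \<in> crossing x \<alpha>}"
    by (rule void_process_unique[OF vp void_process_image[OF vp translate_measurable]
        translate[symmetric] sigma_sets_avoiding_crossing])
  then show ?thesis by (simp only: crossing_translate_iff)
qed

text \<open>Unless a large ball is near, a crossing at scale 10\<alpha> produces two crossings at
  scale \<alpha>, around a point of each net. They depend on balls with centres in disjoint regions,
  hence are independent; a union bound over the pairs of net points gives the constant.\<close>

lemma crossing_prob_recursion:
  fixes K L :: "'a set"
  assumes vp: "void_process \<Lambda> M \<omega>"
    and add: "\<And>A B. A \<in> sets borel \<Longrightarrow> B \<in> sets borel \<Longrightarrow> A \<inter> B = {} \<Longrightarrow> \<Lambda> (A \<union> B) = \<Lambda> A + \<Lambda> B"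
    and \<alpha>: "0 < \<alpha>" and b: "\<Lambda> (large_balls \<alpha>) \<le> ennreal b" "0 \<le> b"
    and K: "finite K" "K \<subseteq> sphere 0 10" "sphere 0 10 \<subseteq> (\<Union>k\<in>K. ball k 1)"
    and L: "finite L" "L \<subseteq> sphere 0 20" "sphere 0 20 \<subseteq> (\<Union>k\<in>L. ball k 1)"
  shows "measure M {w \<in> space M. \<omega> w \<in> crossing 0 (10 * \<alpha>)} \<le>
    real (card K * card L) * (measure M {w \<in> space M. \<omega> w \<in> crossing 0 \<alpha>})\<^sup>2 + b"
proof -
  interpret prob_space M using vp by (simp add: void_process_def)
  define W where "W x = ball x (3 * \<alpha>) \<times> (UNIV :: real set)" for x :: 'a
  \<comment> \<open>Restricting \<omega> to \<open>W x\<close> puts the event into the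
    \<sigma>-algebra of that region. Restriction can only destroy a crossing, so the probability
    stays at most p.\<close>
  define F where "F x = {\<omega>. connects (boolean_set (\<omega> \<inter> W x)) (sphere x \<alpha>) (sphere x (2 * \<alpha>))}" for x
  define p where "p = prob {w \<in> space M. \<omega> w \<in> crossing 0 \<alpha>}"
  have W: "W x \<in> sets borel" for x unfolding W_def by (intro borel_open open_Times) auto
  have F: "F x \<in> sigma_sets UNIV (avoiding (W x))" for x
    unfolding F_def by (rule sigma_sets_avoiding_connects[OF W])
  have F_UNIV: "F x \<in> sigma_sets UNIV (avoiding UNIV)" for x
    using F sigma_sets_avoiding_mono[of "W x" UNIV] by blast
  have F_ev: "{w \<in> space M. \<omega> w \<in> F x} \<in> events" for x by (rule void_process_sets[OF vp F_UNIV])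
  have F_le: "prob {w \<in> space M. \<omega> w \<in> F x} \<le> p" for x
  proof -
    have "F x \<subseteq> crossing x \<alpha>"
    proof
      fix \<omega>' assume "\<omega>' \<in> F x"
      then have "connects (boolean_set (\<omega>' \<inter> W x)) (sphere x \<alpha>) (sphere x (2 * \<alpha>))" by (simp add: F_def)
      then have "connects (boolean_set \<omega>') (sphere x \<alpha>) (sphere x (2 * \<alpha>))"
        by (rule connects_mono) (intro boolean_set_mono Int_lower1)
      then show "\<omega>' \<in> crossing x \<alpha>" by (simp add: crossing_def)
    qed
    then have "prob {w \<in> space M. \<omega> w \<in> F x} \<le> prob {w \<in> space M. \<omega> w \<in> crossing x \<alpha>}"
      by (intro finite_measure_mono void_process_sets[OF vp sigma_sets_avoiding_crossing]) blast
    then show ?thesis using crossing_prob_translate[OF vp, of x \<alpha>] by (simp add: p_def)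
  qed
  have FF_ev: "{w \<in> space M. \<omega> w \<in> F x \<and> \<omega> w \<in> F y} \<in> events" for x y
  proof -
    have "{w \<in> space M. \<omega> w \<in> F x \<and> \<omega> w \<in> F y} = {w \<in> space M. \<omega> w \<in> F x} \<inter> {w \<in> space M. \<omega> w \<in> F y}"
      by blast
    then show ?thesis using F_ev by simp
  qed
  have FF_le: "prob {w \<in> space M. \<omega> w \<in> F (\<alpha> *\<^sub>R k) \<and> \<omega> w \<in> F (\<alpha> *\<^sub>R l)} \<le> p\<^sup>2" if "k \<in> K" "l \<in> L" for k l
  proof -
    have "norm (\<alpha> *\<^sub>R k) = 10 * \<alpha>" "norm (\<alpha> *\<^sub>R l) = 20 * \<alpha>" using K(2) L(2) that \<alpha> by auto
    \<comment> \<open>The centres are 10\<alpha> apart, more than the sum 6\<alpha> of the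
      radii.\<close>
    then have far: "10 * \<alpha> \<le> dist (\<alpha> *\<^sub>R k) (\<alpha> *\<^sub>R l)"
      using norm_triangle_ineq2[of "\<alpha> *\<^sub>R l" "\<alpha> *\<^sub>R k"] by (simp add: dist_norm norm_minus_commute)
    have "ball (\<alpha> *\<^sub>R k) (3 * \<alpha>) \<inter> ball (\<alpha> *\<^sub>R l) (3 * \<alpha>) = {}"
      by (rule disjoint_ballI) (use far \<alpha> in simp)
    then have "W (\<alpha> *\<^sub>R k) \<inter> W (\<alpha> *\<^sub>R l) = {}" unfolding W_def by blast
    then have "prob {w \<in> space M. \<omega> w \<in> F (\<alpha> *\<^sub>R k) \<and> \<omega> w \<in> F (\<alpha> *\<^sub>R l)} =
      prob {w \<in> space M. \<omega> w \<in> F (\<alpha> *\<^sub>R k)} * prob {w \<in> space M. \<omega> w \<in> F (\<alpha> *\<^sub>R l)}"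
      by (intro void_process_indep[OF vp add _ F F])
    also have "\<dots> \<le> p * p" by (intro mult_mono F_le) (auto simp: p_def)
    finally show ?thesis by (simp add: power2_eq_square)
  qed
  let ?D = "{w \<in> space M. \<omega> w \<inter> large_balls \<alpha> \<noteq> {}}"
  let ?G = "\<lambda>(k, l). {w \<in> space M. \<omega> w \<in> F (\<alpha> *\<^sub>R k) \<and> \<omega> w \<in> F (\<alpha> *\<^sub>R l)}"
  note D = void_process_hit[OF vp balls_sets_borel(1) b]
  have "{w \<in> space M. \<omega> w \<in> crossing 0 (10 * \<alpha>)} \<subseteq> ?D \<union> (\<Union>q\<in>K \<times> L. ?G q)"
  proof
    fix w assume w: "w \<in> {w \<in> space M. \<omega> w \<in> crossing 0 (10 * \<alpha>)}"
    show "w \<in> ?D \<union> (\<Union>q\<in>K \<times> L. ?G q)"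
    proof (cases "\<omega> w \<inter> large_balls \<alpha> = {}")
      case True
      then have "r \<le> \<alpha>" if "(c, r) \<in> \<omega> w" "norm c < r + 23 * \<alpha>" for c r
        using that unfolding large_balls_def by force
      moreover have "connects (boolean_set (\<omega> w)) (sphere 0 (10 * \<alpha>)) (sphere 0 (20 * \<alpha>))"
        using w by (simp add: crossing_def)
      ultimately have "\<exists>k\<in>K. \<exists>l\<in>L. \<forall>x\<in>{\<alpha> *\<^sub>R k, \<alpha> *\<^sub>R l}. \<omega> w \<in> F x"
        using crossing_split[OF _ \<alpha> K(2,3) L(2,3), of "\<omega> w"] unfolding F_def W_def by simp
      then show ?thesis using w by auto
    qed (use w in auto)
  qed
  then have "prob {w \<in> space M. \<omega> w \<in> crossing 0 (10 * \<alpha>)} \<le> prob (?D \<union> (\<Union>q\<in>K \<times> L. ?G q))"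
    using D(1) FF_ev K(1) L(1) by (intro finite_measure_mono sets.Un sets.finite_UN) auto
  also have "\<dots> \<le> prob ?D + prob (\<Union>q\<in>K \<times> L. ?G q)"
    using D(1) FF_ev K(1) L(1) by (intro measure_Un_le sets.finite_UN) auto
  also have "prob (\<Union>q\<in>K \<times> L. ?G q) \<le> (\<Sum>q\<in>K \<times> L. prob (?G q))"
    using FF_ev K(1) L(1) by (intro measure_UNION_le) auto
  also have "\<dots> \<le> (\<Sum>q\<in>K \<times> L. p\<^sup>2)" using FF_le by (intro sum_mono) auto
  finally show ?thesis using D(2) by (simp add: p_def card_cartesian_product)
qed

end

section \<open>Truncations of the multiscale model to finitely many levels\<close>

definition level_points :: "real \<Rightarrow> nat \<Rightarrow> (nat \<Rightarrow> ('a::euclidean_space \<times> real) set) \<Rightarrow> ('a \<times> real) set" where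
  "level_points \<rho> N \<xi> = (\<Union>n<N. scale_points (1 / \<rho> ^ n) ` \<xi> n)"

definition level_intensity :: "real \<Rightarrow> nat \<Rightarrow> real measure \<Rightarrow> ('a::euclidean_space \<times> real) set \<Rightarrow> ennreal" where
  "level_intensity \<rho> N \<nu> A = (\<Sum>n<N. ball_intensity \<nu> (scale_points (1 / \<rho> ^ n) -` A))"

lemma scale_points_compose: "scale_points k (scale_points l p) = scale_points (k * l) p"
  by (simp add: scale_points_def case_prod_beta)

text \<open>Self-similarity: behind level 0 stands the N-level model of the shifted sequence, shrunk
  by \<rho>. The induction on N rests on this.\<close>

lemma level_points_Suc:
  "level_points \<rho> (Suc N) \<xi> = \<xi> 0 \<union> scale_points (1 / \<rho>) ` level_points \<rho> N (\<lambda>n. \<xi> (Suc n))"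
proof -
  have "scale_points 1 ` \<xi> 0 = \<xi> 0" by (simp add: scale_points_def case_prod_beta)
  then show ?thesis
    unfolding level_points_def lessThan_Suc_eq_insert_0
    by (simp add: image_UN image_image scale_points_compose)
qed

text \<open>The truncations are open and increase to the multiscale set, so a path, being compact,
  lies in one of them.\<close>

lemma multiscale_connects_iff:
  assumes \<rho>: "\<rho> > 0"
  shows "connects (multiscale_set \<rho> \<xi>) A B \<longleftrightarrow> (\<exists>N. connects (boolean_set (level_points \<rho> N \<xi>)) A B)"
proof
  assume "connects (multiscale_set \<rho> \<xi>) A B"
  then obtain g where g: "path g" "pathstart g \<in> A" "pathfinish g \<in> B" "path_image g \<subseteq> multiscale_set \<rho> \<xi>"
    unfolding connects_iff_path_image by blast
  have "multiscale_set \<rho> \<xi> = (\<Union>N. boolean_set (level_points \<rho> N \<xi>))"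
  proof -
    have "(\<Union>n. scale_points (1 / \<rho> ^ n) ` \<xi> n) = (\<Union>N. level_points \<rho> N \<xi>)"
      unfolding level_points_def by blast
    then show ?thesis by (simp add: multiscale_set_eq[OF \<rho>]) (simp add: boolean_set_def)
  qed
  then have "path_image g \<subseteq> (\<Union>N\<in>UNIV. boolean_set (level_points \<rho> N \<xi>))" using g(4) by simp
  then obtain D where D: "finite D" "path_image g \<subseteq> (\<Union>N\<in>D. boolean_set (level_points \<rho> N \<xi>))"
    using compactE_image[OF compact_path_image[OF g(1)], of UNIV "\<lambda>N. boolean_set (level_points \<rho> N \<xi>)"]
      open_boolean_set by metis
  have "boolean_set (level_points \<rho> N \<xi>) \<subseteq> boolean_set (level_points \<rho> (Max (insert 0 D)) \<xi>)" if "N \<in> D" for N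
  proof -
    \<comment> \<open>Inserting 0 keeps the maximum meaningful should D be empty.\<close>
    have "N \<le> Max (insert 0 D)" using D(1) that by simp
    then show ?thesis unfolding level_points_def by (intro boolean_set_mono UN_mono) auto
  qed
  then have "path_image g \<subseteq> boolean_set (level_points \<rho> (Max (insert 0 D)) \<xi>)" using D(2) by blast
  then show "\<exists>N. connects (boolean_set (level_points \<rho> N \<xi>)) A B"
    unfolding connects_iff_path_image using g by blast
next
  assume "\<exists>N. connects (boolean_set (level_points \<rho> N \<xi>)) A B"
  then obtain N where "connects (boolean_set (level_points \<rho> N \<xi>)) A B" by blast
  moreover have "boolean_set (level_points \<rho> N \<xi>) \<subseteq> multiscale_set \<rho> \<xi>"
    unfolding multiscale_set_eq[OF \<rho>] level_points_def by (intro boolean_set_mono) auto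
  ultimately show "connects (multiscale_set \<rho> \<xi>) A B" by (rule connects_mono)
qed

context
  fixes \<nu> :: "real measure"
  assumes sets_\<nu>: "sets \<nu> = sets (restrict_space borel {0<..})" and fin: "finite_measure \<nu>"
begin

lemma level_intensity_Un:
  assumes "A \<in> sets borel" "B \<in> sets borel" "A \<inter> B = {}"
  shows "level_intensity \<rho> N \<nu> (A \<union> B) = level_intensity \<rho> N \<nu> A + level_intensity \<rho> N \<nu> B"
proof -
  have "ball_intensity \<nu> (scale_points k -` (A \<union> B)) =
      ball_intensity \<nu> (scale_points k -` A) + ball_intensity \<nu> (scale_points k -` B)" for k
    unfolding vimage_Un using assms by (intro ball_intensity_Un[OF sets_\<nu>] scale_points_vimage_sets) auto
  then show ?thesis by (simp add: level_intensity_def sum.distrib)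
qed

lemma level_intensity_translate:
  fixes A :: "('a::euclidean_space \<times> real) set"
  assumes A: "A \<in> sets borel" and \<rho>: "\<rho> > 0"
  shows "level_intensity \<rho> N \<nu> ((\<lambda>(c, r). (x + c, r)) -` A) = level_intensity \<rho> N \<nu> A"
proof -
  \<comment> \<open>A translation by x after shrinking is a translation by \<rho>^n x before
    it.\<close>
  have "scale_points (1 / \<rho> ^ n) -` (\<lambda>(c, r). (x + c, r)) -` A =
      (\<lambda>(c, r). (\<rho> ^ n *\<^sub>R x + c, r)) -` scale_points (1 / \<rho> ^ n) -` A" for n
    using \<rho> by (auto simp: scale_points_def scaleR_add_right)
  then show ?thesis
    unfolding level_intensity_def
    by (simp add: ball_intensity_translate[OF sets_\<nu> fin scale_points_vimage_sets[OF A]])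
qed

context
  fixes M :: "'w measure" and \<Xi> :: "nat \<Rightarrow> 'w \<Rightarrow> ('a::euclidean_space \<times> real) set"
  assumes ip: "independent_poisson_processes (boolean_intensity \<nu>) M \<Xi>"
begin

lemma void_process_level_points:
  "void_process (level_intensity \<rho> N \<nu>) M (\<lambda>w. level_points \<rho> N (\<lambda>n. \<Xi> n w))"
  using void_process_levels[OF sets_\<nu> ip, of "{..<N}" "\<lambda>n. scale_points (1 / \<rho> ^ n)"]
  by (simp add: level_points_def level_intensity_def[abs_def])

text \<open>Shifted and unshifted sequences have the same intensity, hence equal crossing
  probabilities. The levels used are 1 to N, whence the exponent n - 1 in the instance.\<close>

lemma void_process_level_points_shift:
  "void_process (level_intensity \<rho> N \<nu>) M (\<lambda>w. level_points \<rho> N (\<lambda>n. \<Xi> (Suc n) w))"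
  using void_process_levels[OF sets_\<nu> ip, of "Suc ` {..<N}" "\<lambda>n. scale_points (1 / \<rho> ^ (n - 1))"]
  by (simp add: level_points_def level_intensity_def[abs_def] sum.reindex)

text \<open>A union bound over the ways in which \<open>thick_crossing\<close> can apply or fail:
  the dilated level 0 crosses, level 0 has a ball of radius below \<eta> nearby, or the finer levels
  cross at scale \<epsilon> around a net point. Scaling by \<rho> turns the last into a crossing of
  the N-level model at scale \<rho> \<epsilon>.\<close>

lemma crossing_prob_Suc:
  fixes X :: "'a set"
  assumes \<rho>: "\<rho> > 0" and X: "finite X" "cball 0 (2 * \<alpha>) \<subseteq> (\<Union>x\<in>X. ball x \<epsilon>)"
    and \<epsilon>: "0 < \<epsilon>" "6 * \<epsilon> \<le> \<alpha>" "3 * \<epsilon> \<le> (s - 1) * \<eta>" and s: "s > 1"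
    and R: "2 * \<alpha> + 3 * \<epsilon> + \<eta> \<le> R"
    and b: "ball_intensity \<nu> (small_balls \<eta> R :: ('a \<times> real) set) \<le> ennreal b" "0 \<le> b"
  shows "measure M {w \<in> space M. level_points \<rho> (Suc N) (\<lambda>n. \<Xi> n w) \<in> crossing 0 \<alpha>} \<le>
    measure M {w \<in> space M. (\<lambda>(c, r). (c, s * r)) ` \<Xi> 0 w \<in> crossing 0 \<alpha>} + b +
    real (card X) * measure M {w \<in> space M. level_points \<rho> N (\<lambda>n. \<Xi> n w) \<in> crossing 0 (\<rho> * \<epsilon>)}"
proof -
  have pp: "poisson_process (boolean_intensity \<nu>) M (\<Xi> 0)"
    using ip by (simp add: independent_poisson_processes_def)
  interpret prob_space M using pp by (simp add: poisson_process_def)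
  note vp0 = void_process_poisson[OF sets_\<nu> pp]
  note vpS = void_process_level_points_shift[of \<rho> N]
  have "(\<lambda>(c, r). (c, s * r)) \<in> borel \<rightarrow>\<^sub>M (borel :: ('a \<times> real) measure)"
    unfolding case_prod_beta by (intro borel_measurable_continuous_onI continuous_intros)
  note vpd = void_process_image[OF vp0 this]
  let ?A = "{w \<in> space M. (\<lambda>(c, r). (c, s * r)) ` \<Xi> 0 w \<in> crossing 0 \<alpha>}"
  let ?B = "{w \<in> space M. \<Xi> 0 w \<inter> small_balls \<eta> R \<noteq> {}}"
  let ?C = "\<lambda>x. {w \<in> space M. level_points \<rho> N (\<lambda>n. \<Xi> (Suc n) w) \<in> crossing (\<rho> *\<^sub>R x) (\<rho> * \<epsilon>)}"
  have A: "?A \<in> events" by (rule void_process_sets[OF vpd sigma_sets_avoiding_crossing])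
  note B = void_process_hit[OF vp0 balls_sets_borel(2) b]
  have C: "?C x \<in> events" for x by (rule void_process_sets[OF vpS sigma_sets_avoiding_crossing])
  \<comment> \<open>Translation moves the centre to the origin; equality of laws removes the shift
    of the levels.\<close>
  have C_eq: "prob (?C x) = prob {w \<in> space M. level_points \<rho> N (\<lambda>n. \<Xi> n w) \<in> crossing 0 (\<rho> * \<epsilon>)}" for x
    by (rule trans[OF crossing_prob_translate[OF level_intensity_translate[OF _ \<rho>] vpS]
      void_process_unique[OF vpS void_process_level_points refl sigma_sets_avoiding_crossing]])
  have "{w \<in> space M. level_points \<rho> (Suc N) (\<lambda>n. \<Xi> n w) \<in> crossing 0 \<alpha>} \<subseteq> (?A \<union> ?B) \<union> (\<Union>x\<in>X. ?C x)"
  proof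
    fix w assume w: "w \<in> {w \<in> space M. level_points \<rho> (Suc N) (\<lambda>n. \<Xi> n w) \<in> crossing 0 \<alpha>}"
    define S where "S = boolean_set (level_points \<rho> N (\<lambda>n. \<Xi> (Suc n) w))"
    have cr: "connects (boolean_set (\<Xi> 0 w) \<union> (\<lambda>x. (1 / \<rho>) *\<^sub>R x) ` S) (sphere 0 \<alpha>) (sphere 0 (2 * \<alpha>))"
      using w \<rho> by (simp add: crossing_def level_points_Suc boolean_set_Un boolean_set_scale_points S_def)
    show "w \<in> (?A \<union> ?B) \<union> (\<Union>x\<in>X. ?C x)"
    proof (rule ccontr)
      assume neg: "w \<notin> (?A \<union> ?B) \<union> (\<Union>x\<in>X. ?C x)"
      have "connects (boolean_set ((\<lambda>(c, r). (c, s * r)) ` \<Xi> 0 w)) (sphere 0 \<alpha>) (sphere 0 (2 * \<alpha>))"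
      proof (rule thick_crossing[OF cr X(2) _ \<epsilon> s])
        fix x assume x: "x \<in> X"
        show "\<not> connects ((\<lambda>x. (1 / \<rho>) *\<^sub>R x) ` S) (sphere x \<epsilon>) (sphere x (2 * \<epsilon>))"
        proof
          assume "connects ((\<lambda>x. (1 / \<rho>) *\<^sub>R x) ` S) (sphere x \<epsilon>) (sphere x (2 * \<epsilon>))"
          from connects_scaleR[OF \<rho> this] have "w \<in> ?C x"
            using w \<rho> by (simp add: crossing_def image_image S_def mult_ac)
          then show False using neg x by blast
        qed
      next
        fix c r assume cr: "(c, r) \<in> \<Xi> 0 w" "norm c < 2 * \<alpha> + 3 * \<epsilon> + \<eta>"
        have "(c, r) \<notin> small_balls \<eta> R" using neg w cr(1) by auto
        then show "\<eta> \<le> r" using cr(2) R by (simp add: small_balls_def)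
      qed
      then show False using neg w by (simp add: crossing_def)
    qed
  qed
  then have "prob {w \<in> space M. level_points \<rho> (Suc N) (\<lambda>n. \<Xi> n w) \<in> crossing 0 \<alpha>} \<le>
      prob ((?A \<union> ?B) \<union> (\<Union>x\<in>X. ?C x))"
    using A B(1) C X(1) by (intro finite_measure_mono sets.Un sets.finite_UN) auto
  also have "\<dots> \<le> prob (?A \<union> ?B) + prob (\<Union>x\<in>X. ?C x)"
    using A B(1) C X(1) by (intro measure_Un_le sets.Un sets.finite_UN) auto
  also have "prob (?A \<union> ?B) \<le> prob ?A + prob ?B"
    using A B(1) by (intro measure_Un_le) auto
  also have "prob (\<Union>x\<in>X. ?C x) \<le> (\<Sum>x\<in>X. prob (?C x))"
    using C X(1) by (intro measure_UNION_le) auto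
  finally show ?thesis using B(2) unfolding C_eq by simp
qed

text \<open>The crossing events of the truncations increase to that of the whole model, so a bound
  uniform in N survives by continuity of the measure.\<close>

lemma multiscale_crossing_bound:
  assumes \<rho>: "\<rho> > 0"
    and le: "\<And>N. measure M {w \<in> space M. level_points \<rho> N (\<lambda>n. \<Xi> n w) \<in> crossing 0 (r / 2)} \<le> \<delta>"
  shows "{w \<in> space M. connects (multiscale_set \<rho> (\<lambda>n. \<Xi> n w)) (sphere 0 (r / 2)) (sphere 0 r)} \<in> sets M"
    and "crossing_prob M (\<lambda>w. multiscale_set \<rho> (\<lambda>n. \<Xi> n w)) r \<le> \<delta>"
proof -
  have pp: "poisson_process (boolean_intensity \<nu>) M (\<Xi> 0)"
    using ip by (simp add: independent_poisson_processes_def)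
  interpret prob_space M using pp by (simp add: poisson_process_def)
  let ?E = "\<lambda>N. {w \<in> space M. level_points \<rho> N (\<lambda>n. \<Xi> n w) \<in> crossing 0 (r / 2)}"
  have E: "?E N \<in> events" for N
    by (rule void_process_sets[OF void_process_level_points sigma_sets_avoiding_crossing])
  have eq: "{w \<in> space M. connects (multiscale_set \<rho> (\<lambda>n. \<Xi> n w)) (sphere 0 (r / 2)) (sphere 0 r)} = (\<Union>N. ?E N)"
    by (auto simp: multiscale_connects_iff[OF \<rho>] crossing_def)
  show "{w \<in> space M. connects (multiscale_set \<rho> (\<lambda>n. \<Xi> n w)) (sphere 0 (r / 2)) (sphere 0 r)} \<in> events"
    unfolding eq using E by blast
  have "incseq ?E"
  proof (rule incseq_SucI, rule subsetI)
    fix N w assume w: "w \<in> ?E N"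
    have "level_points \<rho> N (\<lambda>n. \<Xi> n w) \<subseteq> level_points \<rho> (Suc N) (\<lambda>n. \<Xi> n w)"
      unfolding level_points_def by (intro UN_mono) auto
    then show "w \<in> ?E (Suc N)" using w connects_mono[OF _ boolean_set_mono] by (auto simp: crossing_def)
  qed
  then have "(\<lambda>N. prob (?E N)) \<longlonglongrightarrow> prob (\<Union>N. ?E N)"
    using E by (intro finite_Lim_measure_incseq) auto
  then have "prob (\<Union>N. ?E N) \<le> \<delta>" using le by (intro LIMSEQ_le_const2) auto
  then show "crossing_prob M (\<lambda>w. multiscale_set \<rho> (\<lambda>n. \<Xi> n w)) r \<le> \<delta>"
    by (simp add: crossing_prob_def eq)
qed

end
end

subsection \<open>The two regimes\<close>

text \<open>The constants are fixed in the order \<alpha>0, \<eta>, \<epsilon>, X, \<delta>0, A2,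
  \<rho>0. This is possible because A2 comes from \<open>quadratic_recursion_decay\<close> and so
  depends neither on N nor on \<rho>; \<rho>0 can then be fixed before the induction on N.\<close>

lemma subcritical_multiscale_crossing:
  fixes \<mu> :: "real measure"
  assumes \<mu>: "sets \<mu> = sets (restrict_space borel {0<..})" "finite_measure \<mu>"
    and ln_fin: "(\<integral>\<^sup>+\<beta>\<in>{1..}. ennreal (\<beta> ^ DIM('a::euclidean_space) * ln \<beta>) \<partial>\<mu>) < \<infinity>"
    and t: "0 < t" "ennreal t < critical_parameter TYPE('a) \<mu>"
  shows "\<exists>\<rho>0>1. \<forall>\<delta>>0. \<exists>A. \<forall>\<rho>\<ge>\<rho>0. \<forall>(M :: 'w measure) (\<Xi> :: nat \<Rightarrow> 'w \<Rightarrow> ('a \<times> real) set).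
    independent_poisson_processes (boolean_intensity (scale_measure (ennreal t) \<mu>)) M \<Xi> \<longrightarrow>
    (\<forall>N. \<forall>\<alpha>\<ge>A. measure M {w \<in> space M. level_points \<rho> N (\<lambda>n. \<Xi> n w) \<in> crossing 0 \<alpha>} \<le> \<delta>)"
proof -
  define \<nu> where "\<nu> = scale_measure (ennreal t) \<mu>"
  have sets_\<nu>: "sets \<nu> = sets (restrict_space borel {0<..})" using \<mu>(1) by (simp add: \<nu>_def)
  have fin: "finite_measure \<nu>" unfolding \<nu>_def by (rule finite_measure_scale_measure[OF \<mu>(2)]) simp
  have "(\<lambda>\<beta>. ennreal (\<beta> ^ DIM('a) * ln \<beta>) * indicator {1..} \<beta>) \<in> borel_measurable \<mu>"
    by (rule borel_measurable_radius[OF \<mu>]) measurable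
  then have ln_fin': "(\<integral>\<^sup>+\<beta>\<in>{1..}. ennreal (\<beta> ^ DIM('a) * ln \<beta>) \<partial>\<nu>) < \<infinity>"
    using ln_fin by (simp add: \<nu>_def nn_integral_scale_measure ennreal_mult_less_top)
  obtain K :: "'a set" where K: "finite K" "K \<subseteq> sphere 0 10" "sphere 0 10 \<subseteq> (\<Union>k\<in>K. ball k 1)"
    using finite_net[of "sphere (0 :: 'a) 10" 1] by auto
  obtain L :: "'a set" where L: "finite L" "L \<subseteq> sphere 0 20" "sphere 0 20 \<subseteq> (\<Union>k\<in>L. ball k 1)"
    using finite_net[of "sphere (0 :: 'a) 20" 1] by auto
  \<comment> \<open>The summand 1 makes C positive without further argument.\<close>
  define C where "C = 1 + real (card K * card L)"
  have C: "C > 0" "real (card K * card L) \<le> C" unfolding C_def by (auto intro: add_pos_nonneg)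
  define V where "V = unit_ball_vol (real DIM('a)) * 24 ^ DIM('a)"
  define T where "T A = (\<integral>\<^sup>+ r. ennreal (V * (r ^ DIM('a) * (1 + 2 * ln r))) * indicator {A<..} r \<partial>\<nu>)" for A
  have V: "0 \<le> V" by (simp add: V_def)
  have T_van: "\<exists>A0\<ge>1. \<forall>A\<ge>A0. T A \<le> ennreal \<delta>" if "\<delta> > 0" for \<delta>
    unfolding T_def by (rule large_balls_tail_vanishes[OF sets_\<nu> fin ln_fin' V that])
  \<comment> \<open>Where T is infinite, h is 0 and bounds nothing; hence \<open>h_van\<close> also
    records T A \<le> h A beyond the threshold.\<close>
  define h where "h A = enn2real (T A)" for A
  have h_van: "\<exists>A0\<ge>1. \<forall>A\<ge>A0. h A \<le> \<delta> \<and> T A \<le> ennreal (h A)" if \<delta>: "\<delta> > 0" for \<delta>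
  proof -
    obtain A0 where A0: "1 \<le> A0" "\<And>A. A0 \<le> A \<Longrightarrow> T A \<le> ennreal \<delta>" using T_van[OF \<delta>] by blast
    have "h A \<le> \<delta> \<and> T A \<le> ennreal (h A)" if "A0 \<le> A" for A
    proof -
      have "T A < top" using A0(2)[OF that] ennreal_less_top by (rule le_less_trans)
      then show ?thesis using A0(2)[OF that] \<delta> by (simp add: h_def enn2real_leI)
    qed
    then show ?thesis using A0(1) by blast
  qed
  have h_lim: "(h \<longlongrightarrow> 0) at_top"
  proof (rule order_tendstoI)
    fix a :: real assume "a < 0"
    then have "a < h A" for A using enn2real_nonneg[of "T A"] by (simp add: h_def del: enn2real_nonneg)
    then show "eventually (\<lambda>A. a < h A) at_top" by simp
  next
    fix a :: real assume "0 < a"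
    then obtain A0 where "\<And>A. A0 \<le> A \<Longrightarrow> h A \<le> a / 2" using h_van[of "a / 2"] by auto
    then have "h A < a" if "A0 \<le> A" for A using that \<open>0 < a\<close> by fastforce
    then show "eventually (\<lambda>A. h A < a) at_top" by (auto simp: eventually_at_top_linorder)
  qed
  obtain s where s: "s > 1" and dil: "\<forall>\<epsilon>>0. \<exists>R>0. \<forall>(M :: 'w measure) (\<xi> :: 'w \<Rightarrow> ('a \<times> real) set).
    poisson_process (boolean_intensity \<nu>) M \<xi> \<longrightarrow>
    (\<forall>r\<ge>R. measure M {w \<in> space M.
       connects (boolean_set ((\<lambda>(c, r). (c, s * r)) ` \<xi> w)) (sphere 0 r) (sphere 0 (2 * r))} \<le> \<epsilon>)"
    using subcritical_dilated_crossing[OF \<mu> t, where 'w='w] unfolding \<nu>_def by blast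
  have pos: "0 < 1 / (8 * C)" "0 < 1 / (16 * C)" using C by auto
  obtain R0 where R0: "\<And>(M :: 'w measure) (\<xi> :: 'w \<Rightarrow> ('a \<times> real) set) r.
    poisson_process (boolean_intensity \<nu>) M \<xi> \<Longrightarrow> R0 \<le> r \<Longrightarrow>
    measure M {w \<in> space M. (\<lambda>(c, r). (c, s * r)) ` \<xi> w \<in> crossing 0 r} \<le> 1 / (8 * C)"
    using dil[rule_format, OF pos(1)] unfolding crossing_def by auto
  obtain A1 where A1: "1 \<le> A1" "\<And>A. A1 \<le> A \<Longrightarrow> h A \<le> 1 / (8 * C) \<and> T A \<le> ennreal (h A)"
    using h_van[OF pos(1)] by blast
  \<comment> \<open>Beyond A1 the error h is at most 1/(8C); beyond R0 so is the crossing
    probability of the dilated level 0.\<close>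
  define \<alpha>0 where "\<alpha>0 = max A1 R0"
  have \<alpha>0: "1 \<le> \<alpha>0" "A1 \<le> \<alpha>0" "R0 \<le> \<alpha>0" using A1(1) by (auto simp: \<alpha>0_def)
  have decay: "\<exists>A. \<forall>f. (\<forall>\<alpha>. 0 \<le> f \<alpha>) \<longrightarrow> (\<forall>\<alpha>\<in>{\<alpha>0..10 * \<alpha>0}. f \<alpha> \<le> 1 / (4 * C)) \<longrightarrow>
    (\<forall>\<alpha>\<ge>\<alpha>0. f (10 * \<alpha>) \<le> C * (f \<alpha>)\<^sup>2 + h \<alpha>) \<longrightarrow> (\<forall>\<alpha>\<ge>A. f \<alpha> \<le> \<delta>)" if "\<delta> > 0" for \<delta>
    using \<alpha>0 A1(2) that by (intro quadratic_recursion_decay[OF C(1) h_lim]) auto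
  \<comment> \<open>For \<alpha> \<le> 10 \<alpha>0, \<epsilon> \<le> 1 and \<eta> \<le> 1, the
    radius 2\<alpha> + 3\<epsilon> + \<eta> of \<open>crossing_prob_Suc\<close> stays below 20
    \<alpha>0 + 5.\<close>
  obtain \<eta> where \<eta>: "0 < \<eta>" "\<eta> \<le> 1"
      "ball_intensity \<nu> (small_balls \<eta> (20 * \<alpha>0 + 5) :: ('a \<times> real) set) \<le> ennreal (1 / (16 * C))"
    using small_balls_vanish[OF sets_\<nu> fin pos(2)] by blast
  define \<epsilon> where "\<epsilon> = min (\<alpha>0 / 6) (min 1 ((s - 1) * \<eta> / 3))"
  have \<epsilon>: "0 < \<epsilon>" "\<epsilon> \<le> 1" "6 * \<epsilon> \<le> \<alpha>0" "3 * \<epsilon> \<le> (s - 1) * \<eta>"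
    using \<alpha>0 s \<eta>(1) by (auto simp: \<epsilon>_def)
  \<comment> \<open>One net serves the whole decade, on which 2\<alpha> \<le> 20 \<alpha>0.\<close>
  obtain X :: "'a set" where X: "finite X" "cball 0 (20 * \<alpha>0) \<subseteq> (\<Union>x\<in>X. ball x \<epsilon>)"
    using finite_net[OF compact_cball \<epsilon>(1), of "0 :: 'a" "20 * \<alpha>0"] by blast
  define \<delta>0 where "\<delta>0 = 1 / (16 * C) / (1 + real (card X))"
  have \<delta>0: "0 < \<delta>0" "real (card X) * \<delta>0 \<le> 1 / (16 * C)"
    using C(1) by (auto simp: \<delta>0_def divide_simps)
  obtain A2 where A2: "\<forall>f. (\<forall>\<alpha>. 0 \<le> f \<alpha>) \<longrightarrow> (\<forall>\<alpha>\<in>{\<alpha>0..10 * \<alpha>0}. f \<alpha> \<le> 1 / (4 * C)) \<longrightarrow>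
    (\<forall>\<alpha>\<ge>\<alpha>0. f (10 * \<alpha>) \<le> C * (f \<alpha>)\<^sup>2 + h \<alpha>) \<longrightarrow> (\<forall>\<alpha>\<ge>A2. f \<alpha> \<le> \<delta>0)"
    using decay[OF \<delta>0(1)] by blast
  \<comment> \<open>The 2 is for \<open>card_levels_le\<close>; the quotient gives \<rho> \<epsilon>
    \<ge> A2, so the scale at which the finer levels must cross lies in the range of decay.\<close>
  define \<rho>0 where "\<rho>0 = max 2 (A2 / \<epsilon>)"
  have initial: "(\<forall>\<alpha>\<in>{\<alpha>0..10 * \<alpha>0}. f N \<alpha> \<le> 1 / (4 * C)) \<and> (\<forall>\<alpha>\<ge>\<alpha>0. f N (10 * \<alpha>) \<le> C * (f N \<alpha>)\<^sup>2 + h \<alpha>)"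
    if ip: "independent_poisson_processes (boolean_intensity \<nu>) M \<Xi>" and \<rho>: "\<rho>0 \<le> \<rho>"
      and f: "\<And>N \<alpha>. f N \<alpha> = measure M {w \<in> space M. level_points \<rho> N (\<lambda>n. \<Xi> n w) \<in> crossing 0 \<alpha>}"
    for M :: "'w measure" and \<Xi> :: "nat \<Rightarrow> 'w \<Rightarrow> ('a \<times> real) set" and \<rho> f N
  proof -
    have \<rho>2: "2 \<le> \<rho>" "A2 \<le> \<rho> * \<epsilon>" using \<rho> \<epsilon>(1) by (auto simp: \<rho>0_def field_simps)
    then have \<rho>_pos: "0 < \<rho>" by simp
    have rec: "f N (10 * \<alpha>) \<le> C * (f N \<alpha>)\<^sup>2 + h \<alpha>" if "\<alpha>0 \<le> \<alpha>" for N \<alpha>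
    proof -
      have \<alpha>: "1 \<le> \<alpha>" "A1 \<le> \<alpha>" using that \<alpha>0 by auto
      have "level_intensity \<rho> N \<nu> (large_balls \<alpha> :: ('a \<times> real) set) \<le> T \<alpha>"
        unfolding level_intensity_def T_def V_def by (rule levels_large_balls_le[OF sets_\<nu> fin \<alpha>(1) \<rho>2(1)])
      also have "\<dots> \<le> ennreal (h \<alpha>)" using A1(2)[OF \<alpha>(2)] by simp
      finally have b: "level_intensity \<rho> N \<nu> (large_balls \<alpha> :: ('a \<times> real) set) \<le> ennreal (h \<alpha>)" .
      have "f N (10 * \<alpha>) \<le> real (card K * card L) * (f N \<alpha>)\<^sup>2 + h \<alpha>"
        unfolding f using \<alpha>(1)
        by (intro crossing_prob_recursion[OF level_intensity_translate[OF sets_\<nu> fin _ \<rho>_pos]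
              void_process_level_points[OF sets_\<nu> fin ip] level_intensity_Un[OF sets_\<nu> fin] _ b _ K L])
          (auto simp: h_def)
      also have "\<dots> \<le> C * (f N \<alpha>)\<^sup>2 + h \<alpha>" using C(2) by (intro add_right_mono mult_right_mono) auto
      finally show ?thesis .
    qed
    have "\<forall>\<alpha>\<in>{\<alpha>0..10 * \<alpha>0}. f N \<alpha> \<le> 1 / (4 * C)" for N
    proof (induction N)
      case 0
      have "f 0 \<alpha> = 0" for \<alpha> by (simp add: f level_points_def crossing_def)
      then show ?case using C(1) by simp
    next
      case (Suc N)
      \<comment> \<open>The induction hypothesis on the decade, together with the recursion,
        activates the decay for N levels, in particular at the scale \<rho> \<epsilon>.\<close>
      have small: "f N (\<rho> * \<epsilon>) \<le> \<delta>0"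
        using A2[rule_format, of "f N" "\<rho> * \<epsilon>"] Suc.IH rec \<rho>2(2) by (simp add: f)
      show ?case
      proof
        fix \<alpha> assume \<alpha>: "\<alpha> \<in> {\<alpha>0..10 * \<alpha>0}"
        have net: "cball 0 (2 * \<alpha>) \<subseteq> (\<Union>x\<in>X. ball x \<epsilon>)"
        proof -
          have "cball (0 :: 'a) (2 * \<alpha>) \<subseteq> cball 0 (20 * \<alpha>0)" using \<alpha> by (intro subset_cball) auto
          then show ?thesis using X(2) by blast
        qed
        have "f (Suc N) \<alpha> \<le> measure M {w \<in> space M. (\<lambda>(c, r). (c, s * r)) ` \<Xi> 0 w \<in> crossing 0 \<alpha>}
            + 1 / (16 * C) + real (card X) * f N (\<rho> * \<epsilon>)"
          unfolding f using \<alpha> \<epsilon> \<eta> pos(2)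
          by (intro crossing_prob_Suc[OF sets_\<nu> fin ip \<rho>_pos X(1) net \<epsilon>(1) _ \<epsilon>(4) s _ \<eta>(3)]) auto
        also have "measure M {w \<in> space M. (\<lambda>(c, r). (c, s * r)) ` \<Xi> 0 w \<in> crossing 0 \<alpha>} \<le> 1 / (8 * C)"
          using ip \<alpha> \<alpha>0(3) by (intro R0) (auto simp: independent_poisson_processes_def)
        also have "real (card X) * f N (\<rho> * \<epsilon>) \<le> 1 / (16 * C)"
          using mult_left_mono[OF small, of "real (card X)"] \<delta>0(2) by simp
        \<comment> \<open>The budget: dilated level 0, small balls, finer levels.\<close>
        also have "1 / (8 * C) + 1 / (16 * C) + 1 / (16 * C) = 1 / (4 * C)" using C(1) by (simp add: field_simps)
        finally show "f (Suc N) \<alpha> \<le> 1 / (4 * C)" by simp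
      qed
    qed
    then show ?thesis using rec by blast
  qed
  show ?thesis
  proof (rule exI[of _ \<rho>0], intro conjI allI impI)
    show "1 < \<rho>0" by (simp add: \<rho>0_def)
    fix \<delta> :: real assume "0 < \<delta>"
    then obtain A where A: "\<forall>f. (\<forall>\<alpha>. 0 \<le> f \<alpha>) \<longrightarrow> (\<forall>\<alpha>\<in>{\<alpha>0..10 * \<alpha>0}. f \<alpha> \<le> 1 / (4 * C)) \<longrightarrow>
      (\<forall>\<alpha>\<ge>\<alpha>0. f (10 * \<alpha>) \<le> C * (f \<alpha>)\<^sup>2 + h \<alpha>) \<longrightarrow> (\<forall>\<alpha>\<ge>A. f \<alpha> \<le> \<delta>)"
      using decay by blast
    show "\<exists>A. \<forall>\<rho>\<ge>\<rho>0. \<forall>(M :: 'w measure) (\<Xi> :: nat \<Rightarrow> 'w \<Rightarrow> ('a \<times> real) set).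
      independent_poisson_processes (boolean_intensity (scale_measure (ennreal t) \<mu>)) M \<Xi> \<longrightarrow>
      (\<forall>N. \<forall>\<alpha>\<ge>A. measure M {w \<in> space M. level_points \<rho> N (\<lambda>n. \<Xi> n w) \<in> crossing 0 \<alpha>} \<le> \<delta>)"
    proof (rule exI[of _ A], intro allI impI)
      fix \<rho> :: real and M :: "'w measure" and \<Xi> :: "nat \<Rightarrow> 'w \<Rightarrow> ('a \<times> real) set" and N \<alpha>
      assume \<rho>: "\<rho>0 \<le> \<rho>" and \<alpha>: "A \<le> \<alpha>"
        and ip: "independent_poisson_processes (boolean_intensity (scale_measure (ennreal t) \<mu>)) M \<Xi>"
      define f where "f N \<alpha> = measure M {w \<in> space M. level_points \<rho> N (\<lambda>n. \<Xi> n w) \<in> crossing 0 \<alpha>}" for N \<alpha>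
      have "0 \<le> f N \<alpha>" for \<alpha> by (simp add: f_def)
      then have "f N \<alpha> \<le> \<delta>"
        using A[rule_format, of "f N"] initial[OF ip[folded \<nu>_def] \<rho> f_def, of N] \<alpha> by blast
      then show "measure M {w \<in> space M. level_points \<rho> N (\<lambda>n. \<Xi> n w) \<in> crossing 0 \<alpha>} \<le> \<delta>"
        by (simp add: f_def)
    qed
  qed
qed

text \<open>For each R the events "level n has no ball whose shrunken copy covers radius R + 1" are
  independent, and their intensities sum to \<infinity>. All of them together have probability 0, so
  almost surely the multiscale set is the whole space.\<close>

lemma supercritical_percolates:
  fixes \<Xi> :: "nat \<Rightarrow> 'w \<Rightarrow> ('a::euclidean_space \<times> real) set"
  assumes sets_\<nu>: "sets \<nu> = sets (restrict_space borel {0<..})" and fin: "finite_measure \<nu>"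
    and ln_inf: "(\<integral>\<^sup>+\<beta>\<in>{1..}. ennreal (\<beta> ^ DIM('a) * ln \<beta>) \<partial>\<nu>) = \<infinity>"
    and \<rho>: "1 < \<rho>" and ip: "independent_poisson_processes (boolean_intensity \<nu>) M \<Xi>"
  shows "percolates M (\<lambda>w. multiscale_set \<rho> (\<lambda>n. \<Xi> n w))"
proof -
  have pp: "poisson_process (boolean_intensity \<nu>) M (\<Xi> n)" for n
    using ip by (simp add: independent_poisson_processes_def)
  interpret prob_space M using pp[of 0] by (simp add: poisson_process_def)
  \<comment> \<open>\<open>Suc R\<close> makes the radius at least 1, as
    \<open>covering_balls_infinite\<close> requires.\<close>
  define H where "H R n w \<longleftrightarrow> \<Xi> n w \<inter> covering_balls (\<rho> ^ n * real (Suc R)) = {}" for R n w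
  have H_sets: "{w \<in> space M. H R n w} \<in> events" for R n
    using void_process_poisson[OF sets_\<nu> pp[of n]] balls_sets_borel(3)
    by (simp add: void_process_def H_def)
  have H0: "prob {w \<in> space M. \<forall>n. H R n w} = 0" for R
  proof -
    let ?a = "\<lambda>n. ball_intensity \<nu> (covering_balls (\<rho> ^ n * real (Suc R)) :: ('a \<times> real) set)"
    have le: "prob {w \<in> space M. \<forall>n. H R n w} \<le> void_prob (\<Sum>n<N. ?a n)" for N
    proof -
      let ?W = "\<lambda>n. covering_balls (\<rho> ^ n * real (Suc R)) \<inter> space (boolean_intensity \<nu>)"
      have eq: "{w \<in> space M. \<forall>n\<in>{..<N}. H R n w} = {w \<in> space M. \<forall>n\<in>{..<N}. \<Xi> n w \<inter> ?W n = {}}"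
        using poisson_process_subset[OF pp] unfolding H_def by blast
      have W: "?W n \<in> sets (boolean_intensity \<nu>)" for n
        by (rule boolean_intensity_sets[OF sets_\<nu> balls_sets_borel(3)])
      have *: "{w \<in> space M. \<forall>n\<in>{..<N}. H R n w} \<in> events"
        "prob {w \<in> space M. \<forall>n\<in>{..<N}. H R n w} = void_prob (\<Sum>n<N. ?a n)"
        unfolding eq void_prob_sum ball_intensity_def
        by (rule independent_poisson_processes_void[OF ip finite_lessThan W])+
      show ?thesis unfolding *(2)[symmetric] using *(1) by (intro finite_measure_mono) auto
    qed
    have inf: "(\<Sum>n. ?a n) = \<infinity>" by (rule covering_balls_infinite[OF sets_\<nu> fin ln_inf \<rho>]) simp
    have "prob {w \<in> space M. \<forall>n. H R n w} \<le> e" if e: "0 < e" for e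
    proof -
      \<comment> \<open>A partial sum above - ln e makes the probability of no covering in the first
        N levels at most e.\<close>
      have "ennreal (- ln e) < (\<Sum>n. ?a n)" unfolding inf by simp
      then obtain N where N: "ennreal (- ln e) < (\<Sum>n<N. ?a n)"
        unfolding suminf_eq_SUP less_SUP_iff by blast
      have "void_prob (\<Sum>n<N. ?a n) \<le> e"
      proof (cases "(\<Sum>n<N. ?a n) = \<infinity>")
        case True
        then show ?thesis using e by (simp add: void_prob_def)
      next
        case False
        then obtain x where x: "(\<Sum>n<N. ?a n) = ennreal x" "0 \<le> x" by (cases "\<Sum>n<N. ?a n") auto
        then have "ennreal (- ln e) < ennreal x" using N by (simp only:)
        then have "\<not> x \<le> - ln e" using ennreal_leI leD by blast
        then have "- ln e \<le> enn2real (\<Sum>n<N. ?a n)" using x by simp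
        then have "exp (- enn2real (\<Sum>n<N. ?a n)) \<le> exp (ln e)" by simp
        then show ?thesis using e False by (simp add: void_prob_def)
      qed
      then show ?thesis using le[of N] by simp
    qed
    then show ?thesis using field_le_epsilon[of "prob {w \<in> space M. \<forall>n. H R n w}" 0]
      by (simp add: measure_nonneg antisym)
  qed
  have "AE w in M. \<not> (\<forall>n. H R n w)" for R
  proof -
    have "{w \<in> space M. \<forall>n. H R n w} \<in> events" by (intro sets.sets_Collect_countable_All H_sets)
    then show ?thesis using H0[of R] by (simp add: prob_Collect_eq_0)
  qed
  then have cover: "AE w in M. \<forall>R. \<not> (\<forall>n. H R n w)" unfolding AE_all_countable by blast
  have full: "multiscale_set \<rho> (\<lambda>n. \<Xi> n w) = UNIV" if all: "\<forall>R. \<not> (\<forall>n. H R n w)" for w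
  proof -
    have "x \<in> multiscale_set \<rho> (\<lambda>n. \<Xi> n w)" for x :: 'a
    proof -
      obtain R where R: "norm x \<le> real R" using real_arch_simple by blast
      obtain n where "\<not> H R n w" using all by blast
      then obtain c r where cr: "(c, r) \<in> \<Xi> n w" "norm c + \<rho> ^ n * real (Suc R) < r"
        unfolding H_def covering_balls_def by auto
      have "norm (\<rho> ^ n *\<^sub>R x) \<le> \<rho> ^ n * real (Suc R)"
        using R \<rho> by (simp add: mult_left_mono)
      then have "dist c (\<rho> ^ n *\<^sub>R x) < r"
        using norm_triangle_ineq4[of c "\<rho> ^ n *\<^sub>R x"] cr(2) by (simp add: dist_norm)
      then have "\<rho> ^ n *\<^sub>R x \<in> boolean_set (\<Xi> n w)" using cr(1) unfolding mem_boolean_set by blast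
      then have "(1 / \<rho> ^ n) *\<^sub>R (\<rho> ^ n *\<^sub>R x) \<in> multiscale_set \<rho> (\<lambda>n. \<Xi> n w)"
        unfolding multiscale_set_def by blast
      then show ?thesis using \<rho> by simp
    qed
    then show ?thesis by blast
  qed
  from cover have ae: "AE w in M. \<not> bounded (connected_component_set (multiscale_set \<rho> (\<lambda>n. \<Xi> n w)) 0)"
    by eventually_elim (simp add: full connected_component_eq_UNIV not_bounded_UNIV)
  have \<rho>_pos: "0 < \<rho>" using \<rho> by simp
  \<comment> \<open>\<open>percolates\<close> speaks of \<open>measure\<close>, which is 0 on sets
    that are not measurable, so the almost sure statement must be completed by measurability of the
    event.\<close>
  have unb: "\<not> bounded (connected_component_set (multiscale_set \<rho> (\<lambda>n. \<Xi> n w)) 0) \<longleftrightarrow>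
      (\<forall>m::nat. \<exists>N. connects (boolean_set (level_points \<rho> N (\<lambda>n. \<Xi> n w))) {0} (- cball 0 (real m)))" for w
    unfolding multiscale_connects_iff[OF \<rho>_pos, symmetric] unfolding multiscale_set_eq[OF \<rho>_pos]
    by (rule unbounded_boolean_component_iff)
  have "{w \<in> space M. connects (boolean_set (level_points \<rho> N (\<lambda>n. \<Xi> n w))) {0} (- cball 0 (real m))} \<in> events" for N and m :: nat
    using void_process_sets[OF void_process_level_points[OF sets_\<nu> fin ip]
        sigma_sets_avoiding_connects[of UNIV "{0}" "- cball 0 (real m)"], of \<rho> N] by simp
  then have "{w \<in> space M. \<not> bounded (connected_component_set (multiscale_set \<rho> (\<lambda>n. \<Xi> n w)) 0)} \<in> events"
    unfolding unb by measurable
  then have "prob {w \<in> space M. \<not> bounded (connected_component_set (multiscale_set \<rho> (\<lambda>n. \<Xi> n w)) 0)} = 1"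
    using ae by (simp add: prob_Collect_eq_1)
  then show ?thesis by (simp add: percolates_def)
qed

theorem theorem4:
  fixes \<mu> :: "real measure"
  assumes "DIM('a::euclidean_space) \<ge> 2"
    and "sets \<mu> = sets (restrict_space borel {0<..})"
    and "finite_measure \<mu>"
    and "emeasure \<mu> (space \<mu>) > 0"
  shows
    "((\<integral>\<^sup>+\<beta>\<in>{1..}. ennreal (\<beta> ^ DIM('a) * ln \<beta>) \<partial>\<mu>) < \<infinity> \<longrightarrow>
        (\<forall>t::real. 0 < t \<and> ennreal t < critical_parameter TYPE('a) \<mu> \<longrightarrow>
          (\<exists>\<rho>\<^sub>0>1. \<forall>\<rho>\<ge>\<rho>\<^sub>0. \<forall>(M :: 'w measure) (\<Xi> :: nat \<Rightarrow> 'w \<Rightarrow> ('a \<times> real) set).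
             independent_poisson_processes
               (boolean_intensity (scale_measure (ennreal t) \<mu>)) M \<Xi> \<longrightarrow>
             (crossing_prob M (\<lambda>w. multiscale_set \<rho> (\<lambda>n. \<Xi> n w)) \<longlongrightarrow> 0) at_top \<and>
             \<not> percolates M (\<lambda>w. multiscale_set \<rho> (\<lambda>n. \<Xi> n w))))) \<and>
     ((\<integral>\<^sup>+\<beta>\<in>{1..}. ennreal (\<beta> ^ DIM('a) * ln \<beta>) \<partial>\<mu>) = \<infinity> \<longrightarrow>
        (\<forall>t::real. t > 0 \<longrightarrow>
          (\<forall>\<rho>>1. \<forall>(M :: 'w measure) (\<Xi> :: nat \<Rightarrow> 'w \<Rightarrow> ('a \<times> real) set).
             independent_poisson_processes
               (boolean_intensity (scale_measure (ennreal t) \<mu>)) M \<Xi> \<longrightarrow>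
             percolates M (\<lambda>w. multiscale_set \<rho> (\<lambda>n. \<Xi> n w)))))"
proof (intro conjI impI allI)
  note \<mu> = assms(2,3)
  have sets: "sets (scale_measure k \<mu>) = sets (restrict_space borel {0<..})" for k using \<mu>(1) by simp
  have fin: "finite_measure (scale_measure (ennreal t) \<mu>)" for t
    by (rule finite_measure_scale_measure[OF \<mu>(2)]) simp
  {
    fix t :: real
    assume ln_fin: "(\<integral>\<^sup>+\<beta>\<in>{1..}. ennreal (\<beta> ^ DIM('a) * ln \<beta>) \<partial>\<mu>) < \<infinity>"
      and "0 < t \<and> ennreal t < critical_parameter TYPE('a) \<mu>"
    then have t: "0 < t" "ennreal t < critical_parameter TYPE('a) \<mu>" by auto
    obtain \<rho>0 where \<rho>0: "\<rho>0 > 1" and small: "\<forall>\<delta>>0. \<exists>A. \<forall>\<rho>\<ge>\<rho>0.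
      \<forall>(M :: 'w measure) (\<Xi> :: nat \<Rightarrow> 'w \<Rightarrow> ('a \<times> real) set).
      independent_poisson_processes (boolean_intensity (scale_measure (ennreal t) \<mu>)) M \<Xi> \<longrightarrow>
      (\<forall>N. \<forall>\<alpha>\<ge>A. measure M {w \<in> space M. level_points \<rho> N (\<lambda>n. \<Xi> n w) \<in> crossing 0 \<alpha>} \<le> \<delta>)"
      using subcritical_multiscale_crossing[OF \<mu> ln_fin t] by blast
    show "\<exists>\<rho>\<^sub>0>1. \<forall>\<rho>\<ge>\<rho>\<^sub>0. \<forall>(M :: 'w measure) (\<Xi> :: nat \<Rightarrow> 'w \<Rightarrow> ('a \<times> real) set).
             independent_poisson_processes
               (boolean_intensity (scale_measure (ennreal t) \<mu>)) M \<Xi> \<longrightarrow>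
             (crossing_prob M (\<lambda>w. multiscale_set \<rho> (\<lambda>n. \<Xi> n w)) \<longlongrightarrow> 0) at_top \<and>
             \<not> percolates M (\<lambda>w. multiscale_set \<rho> (\<lambda>n. \<Xi> n w))"
    proof (rule exI[of _ \<rho>0], rule conjI[OF \<rho>0], intro allI impI conjI)
      fix \<rho> :: real and M :: "'w measure" and \<Xi> :: "nat \<Rightarrow> 'w \<Rightarrow> ('a \<times> real) set"
      assume \<rho>: "\<rho>0 \<le> \<rho>"
        and ip: "independent_poisson_processes (boolean_intensity (scale_measure (ennreal t) \<mu>)) M \<Xi>"
      have "poisson_process (boolean_intensity (scale_measure (ennreal t) \<mu>)) M (\<Xi> 0)"
        using ip by (simp add: independent_poisson_processes_def)
      then interpret prob_space M by (simp add: poisson_process_def)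
      have \<rho>_pos: "0 < \<rho>" using \<rho> \<rho>0 by simp
      let ?S = "\<lambda>w. multiscale_set \<rho> (\<lambda>n. \<Xi> n w)"
      have bound: "\<exists>R. \<forall>r\<ge>R. {w \<in> space M. connects (?S w) (sphere 0 (r / 2)) (sphere 0 r)} \<in> events \<and>
          crossing_prob M ?S r \<le> \<delta>" if "\<delta> > 0" for \<delta>
      proof -
        obtain A where A: "\<And>N \<alpha>. A \<le> \<alpha> \<Longrightarrow> prob {w \<in> space M. level_points \<rho> N (\<lambda>n. \<Xi> n w) \<in> crossing 0 \<alpha>} \<le> \<delta>"
          using small \<open>\<delta> > 0\<close> \<rho> ip by meson
        have "{w \<in> space M. connects (?S w) (sphere 0 (r / 2)) (sphere 0 r)} \<in> events \<and> crossing_prob M ?S r \<le> \<delta>"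
          \<comment> \<open>The crossing from radius r/2 to r is the one of scale \<alpha> =
            r/2.\<close>
          if "2 * A \<le> r" for r
          using multiscale_crossing_bound[OF sets fin ip \<rho>_pos A, of "r / 2"] that
          by (intro conjI multiscale_crossing_bound[OF sets fin ip \<rho>_pos A]) auto
        then show ?thesis by blast
      qed
      show "(crossing_prob M ?S \<longlongrightarrow> 0) at_top"
      proof (rule order_tendstoI)
        fix a :: real assume "a < 0"
        then have "a < crossing_prob M ?S r" for r
          unfolding crossing_prob_def by (rule less_le_trans) simp
        then show "eventually (\<lambda>r. a < crossing_prob M ?S r) at_top" by simp
      next
        fix a :: real assume "0 < a"
        then obtain R where "\<And>r. R \<le> r \<Longrightarrow> crossing_prob M ?S r \<le> a / 2" using bound[of "a / 2"] by auto
        then have "crossing_prob M ?S r < a" if "R \<le> r" for r using that \<open>0 < a\<close> by fastforce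
        then show "eventually (\<lambda>r. crossing_prob M ?S r < a) at_top" by (auto simp: eventually_at_top_linorder)
      qed
      show "\<not> percolates M ?S"
      proof
        assume "percolates M ?S"
        then have pos: "0 < prob {w \<in> space M. \<not> bounded (connected_component_set (?S w) 0)}" (is "0 < ?p")
          by (simp add: percolates_def)
        then obtain R where R: "\<And>r. R \<le> r \<Longrightarrow> {w \<in> space M. connects (?S w) (sphere 0 (r / 2)) (sphere 0 r)} \<in> events"
            "\<And>r. R \<le> r \<Longrightarrow> crossing_prob M ?S r \<le> ?p / 2"
          using bound[of "?p / 2"] by auto
        \<comment> \<open>An unbounded component of the origin forces every crossing at positive
          radius; r \<ge> 1 provides positivity.\<close>
        define r where "r = max R 1"
        have "open (?S w)" for w unfolding multiscale_set_eq[OF \<rho>_pos] by (rule open_boolean_set)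
        then have "?p \<le> crossing_prob M ?S r"
          unfolding crossing_prob_def using R(1)[of r]
          by (intro finite_measure_mono) (auto simp: r_def intro!: unbounded_component_connects)
        then show False using R(2)[of r] pos by (simp add: r_def)
      qed
    qed
  }
  {
    fix t \<rho> :: real and M :: "'w measure" and \<Xi> :: "nat \<Rightarrow> 'w \<Rightarrow> ('a \<times> real) set"
    assume ln_inf: "(\<integral>\<^sup>+\<beta>\<in>{1..}. ennreal (\<beta> ^ DIM('a) * ln \<beta>) \<partial>\<mu>) = \<infinity>" and t: "0 < t" and \<rho>: "1 < \<rho>"
      and ip: "independent_poisson_processes (boolean_intensity (scale_measure (ennreal t) \<mu>)) M \<Xi>"
    have "(\<lambda>\<beta>. ennreal (\<beta> ^ DIM('a) * ln \<beta>) * indicator {1..} \<beta>) \<in> borel_measurable \<mu>"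
      by (rule borel_measurable_radius[OF \<mu>]) measurable
    \<comment> \<open>Multiplying the measure by t > 0 keeps the integral infinite.\<close>
    then have "(\<integral>\<^sup>+\<beta>\<in>{1..}. ennreal (\<beta> ^ DIM('a) * ln \<beta>) \<partial>scale_measure (ennreal t) \<mu>) = \<infinity>"
      using ln_inf t by (simp add: nn_integral_scale_measure ennreal_mult_top)
    from supercritical_percolates[OF sets fin this \<rho> ip]
    show "percolates M (\<lambda>w. multiscale_set \<rho> (\<lambda>n. \<Xi> n w))" .
  }
qed

end
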